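(* Let $s\in(0,1)$ and let $\Omega\subset\mathbb{R}^n$ be a bounded open set with Lipschitz boundary. Assume that $u\in L^\infty(\mathbb{R}^n)$ has finite $s$-fractional variation in $\Omega$. Then there exists a function $w\in BV(\Omega)$ such that $$Dw=D^su\quad\text{in }\mathcal M_b(\Omega;\mathbb{R}^n).$$
   Context: $\mathcal M_b(\Omega;\mathbb{R}^n)$ is the space of finite $\mathbb{R}^n$-valued Radon measures on $\Omega$, and $Dw$ is the distributional derivative of $w$ in $\Omega$. For $s\in(0,1)$ let $\mu_s=\frac{2^s\Gamma(\frac{n+s+1}{2})}{\pi^{n/2}\Gamma(\frac{1-s}{2})}$ and, for $\Psi\in C^1_c(\mathbb{R}^n;\mathbb{R}^n)$, $\operatorname{div}^s\Psi(x)=\mu_s\int_{\mathbb{R}^n}\frac{(\Psi(y)-\Psi(x))\cdot(y-x)}{|y-x|^{n+s+1}}\,\mathrm dy$. For $u\in L^\infty(\mathbb{R}^n)$ the $s$-fractional variation in $\Omega$ is $V^s(u,\Omega)=\sup\{\int_{\mathbb{R}^n}u\operatorname{div}^s\Psi\,\mathrm dy:\Psi\in C^1_c(\Omega;\mathbb{R}^n),\ \|\Psi\|_{L^\infty(\Omega)}\le1\}$. If it is finite, $D^su\in\mathcal M_b(\Omega;\mathbb{R}^n)$ denotes the unique measure with $\int_\Omega\Psi\cdot\mathrm dD^su=-\int_{\mathbb{R}^n}u\operatorname{div}^s\Psi\,\mathrm dy$ for all $\Psi\in C^1_c(\Omega;\mathbb{R}^n)$. *)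

theory Defs
  imports "HOL-Analysis.Analysis"
begin

section \<open>Domains and function spaces\<close>

text \<open>
  Near every boundary point, and for a suitable unit vector \<open>e\<close>, the set is the strict epigraph in
  direction \<open>e\<close> of a Lipschitz function on the hyperplane orthogonal to \<open>e\<close>; the vector
  \<open>x - (x \<bullet> e) *\<^sub>R e\<close> is the projection of \<open>x\<close> onto that hyperplane.
\<close>

definition lipschitz_boundary :: "'a::euclidean_space set \<Rightarrow> bool" where
  "lipschitz_boundary \<Omega> \<longleftrightarrow>
     (\<forall>p\<in>frontier \<Omega>. \<exists>e r L \<gamma>. norm e = 1 \<and> r > 0 \<and> L-lipschitz_on {v. v \<bullet> e = 0} \<gamma> \<and>
        \<Omega> \<inter> ball p r = {x \<in> ball p r. \<gamma> (x - (x \<bullet> e) *\<^sub>R e) < x \<bullet> e})"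

text \<open>
  Elements of \<open>C\<^sup>1\<^sub>c(\<Omega>)\<close> are identified with their extensions by zero to the whole space.
\<close>

definition C1c :: "'a::euclidean_space set \<Rightarrow> ('a \<Rightarrow> 'b::real_normed_vector) set" where
  "C1c \<Omega> = {\<Psi>.
     (\<exists>\<Psi>' :: 'a \<Rightarrow> 'a \<Rightarrow>\<^sub>L 'b.
        (\<forall>x. (\<Psi> has_derivative blinfun_apply (\<Psi>' x)) (at x)) \<and> continuous_on UNIV \<Psi>') \<and>
     compact (closure {x. \<Psi> x \<noteq> 0}) \<and> closure {x. \<Psi> x \<noteq> 0} \<subseteq> \<Omega>}"

definition Linfty :: "('a::euclidean_space \<Rightarrow> real) set" where
  "Linfty = {u. u \<in> borel_measurable lebesgue \<and> (\<exists>C. AE x in lebesgue. \<bar>u x\<bar> \<le> C)}"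

definition divergence :: "('a::euclidean_space \<Rightarrow> 'a) \<Rightarrow> 'a \<Rightarrow> real" where
  "divergence \<Psi> x = (\<Sum>b\<in>Basis. frechet_derivative \<Psi> (at x) b \<bullet> b)"


section \<open>Finite vector-valued Radon measures\<close>

text \<open>
  A finite vector-valued Radon measure on \<open>\<Omega>\<close> is a countably additive set function on the Borel
  subsets of \<open>\<Omega>\<close>. Since its values lie in a finite-dimensional space, its total variation is
  automatically finite, and since \<open>\<Omega>\<close> is an open subset of a Euclidean space, regularity is
  automatic as well. The value \<open>0\<close> on all other sets is a convention that makes equality of
  functions coincide with equality of measures. Taking all \<open>A i\<close> empty shows \<open>\<nu> {} = 0\<close>.
\<close>

definition Mb :: "'a::euclidean_space set \<Rightarrow> ('a set \<Rightarrow> 'b::euclidean_space) set" where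
  "Mb \<Omega> = {\<nu>.
     (\<forall>A :: nat \<Rightarrow> 'a set. range A \<subseteq> sets (restrict_space borel \<Omega>) \<longrightarrow> disjoint_family A \<longrightarrow>
        (\<lambda>i. \<nu> (A i)) sums \<nu> (\<Union>i. A i)) \<and>
     (\<forall>A. A \<notin> sets (restrict_space borel \<Omega>) \<longrightarrow> \<nu> A = 0)}"

text \<open>
  The positive part \<open>\<mu>\<^sup>+\<close> of the Jordan decomposition of a real-valued measure \<open>\<mu>\<close> on \<open>\<Omega>\<close>; the
  negative part is the positive part of \<open>-\<mu>\<close>. The truncation of negative numbers by \<open>ennreal\<close> is
  harmless because \<open>E = {}\<close> is admissible in the supremum.
\<close>

definition jordan_pos :: "'a::euclidean_space set \<Rightarrow> ('a set \<Rightarrow> real) \<Rightarrow> 'a measure" where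
  "jordan_pos \<Omega> \<mu> = measure_of \<Omega> (sets (restrict_space borel \<Omega>))
     (\<lambda>A. SUP E\<in>{E \<in> sets (restrict_space borel \<Omega>). E \<subseteq> A}. ennreal (\<mu> E))"

definition signed_integral ::
  "'a::euclidean_space set \<Rightarrow> ('a set \<Rightarrow> real) \<Rightarrow> ('a \<Rightarrow> real) \<Rightarrow> real" where
  "signed_integral \<Omega> \<mu> f =
     integral\<^sup>L (jordan_pos \<Omega> \<mu>) f - integral\<^sup>L (jordan_pos \<Omega> (\<lambda>A. - \<mu> A)) f"

text \<open>The integral of \<open>\<Psi> \<bullet> d\<nu>\<close> over \<open>\<Omega>\<close>, defined componentwise.\<close>

definition vector_integral ::
  "'a::euclidean_space set \<Rightarrow> ('a set \<Rightarrow> 'b::euclidean_space) \<Rightarrow> ('a \<Rightarrow> 'b) \<Rightarrow> real" where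
  "vector_integral \<Omega> \<nu> \<Psi> = (\<Sum>b\<in>Basis. signed_integral \<Omega> (\<lambda>A. \<nu> A \<bullet> b) (\<lambda>x. \<Psi> x \<bullet> b))"


section \<open>Functions of bounded variation\<close>

text \<open>
  The distributional derivative of \<open>w\<close> in \<open>\<Omega>\<close> is the measure \<open>\<nu>\<close>. Since \<open>\<nu>\<close> is a finite measure,
  testing with \<open>C\<^sup>1\<^sub>c\<close> fields is the same as testing with smooth compactly supported ones.
\<close>

definition is_distr_deriv ::
  "'a::euclidean_space set \<Rightarrow> ('a \<Rightarrow> real) \<Rightarrow> ('a set \<Rightarrow> 'a) \<Rightarrow> bool" where
  "is_distr_deriv \<Omega> w \<nu> \<longleftrightarrow> \<nu> \<in> Mb \<Omega> \<and>
     (\<forall>\<Psi>\<in>C1c \<Omega>. vector_integral \<Omega> \<nu> \<Psi> = - (LINT x:\<Omega>|lebesgue. w x * divergence \<Psi> x))"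

text \<open>
  The values outside \<open>\<Omega>\<close> of a function in \<open>BV \<Omega>\<close> are irrelevant.
\<close>

definition BV :: "'a::euclidean_space set \<Rightarrow> ('a \<Rightarrow> real) set" where
  "BV \<Omega> = {w. set_integrable lebesgue \<Omega> w \<and> (\<exists>\<nu>. is_distr_deriv \<Omega> w \<nu>)}"

definition distr_deriv :: "'a::euclidean_space set \<Rightarrow> ('a \<Rightarrow> real) \<Rightarrow> 'a set \<Rightarrow> 'a" where
  "distr_deriv \<Omega> w = (THE \<nu>. is_distr_deriv \<Omega> w \<nu>)"


section \<open>Fractional variation\<close>

definition frac_const :: "nat \<Rightarrow> real \<Rightarrow> real" where
  "frac_const n s =
     2 powr s * Gamma ((real n + s + 1) / 2) / (pi powr (real n / 2) * Gamma ((1 - s) / 2))"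

definition frac_div :: "real \<Rightarrow> ('a::euclidean_space \<Rightarrow> 'a) \<Rightarrow> 'a \<Rightarrow> real" where
  "frac_div s \<Psi> x = frac_const DIM('a) s *
     (LINT y|lebesgue. ((\<Psi> y - \<Psi> x) \<bullet> (y - x)) / norm (y - x) powr (real DIM('a) + s + 1))"

definition frac_variation :: "real \<Rightarrow> ('a::euclidean_space \<Rightarrow> real) \<Rightarrow> 'a set \<Rightarrow> ereal" where
  "frac_variation s u \<Omega> =
     (SUP \<Psi>\<in>{\<Psi> \<in> C1c \<Omega>. AE x in lebesgue. x \<in> \<Omega> \<longrightarrow> norm (\<Psi> x) \<le> 1}.
        ereal (LINT y|lebesgue. u y * frac_div s \<Psi> y))"

definition is_frac_deriv ::
  "real \<Rightarrow> 'a::euclidean_space set \<Rightarrow> ('a \<Rightarrow> real) \<Rightarrow> ('a set \<Rightarrow> 'a) \<Rightarrow> bool" where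
  "is_frac_deriv s \<Omega> u \<nu> \<longleftrightarrow> \<nu> \<in> Mb \<Omega> \<and>
     (\<forall>\<Psi>\<in>C1c \<Omega>. vector_integral \<Omega> \<nu> \<Psi> = - (LINT y|lebesgue. u y * frac_div s \<Psi> y))"

definition frac_deriv ::
  "real \<Rightarrow> 'a::euclidean_space set \<Rightarrow> ('a \<Rightarrow> real) \<Rightarrow> 'a set \<Rightarrow> 'a" where
  "frac_deriv s \<Omega> u = (THE \<nu>. is_frac_deriv s \<Omega> u \<nu>)"

end

theory Submission
  imports Defs
begin

text \<open>
  Write \<open>n\<close> for the dimension and \<open>k z = norm z powr - (n + s - 1)\<close> for the kernel of the Riesz potential
  of order \<open>1 - s\<close>, up to a constant. Two facts prove the theorem.

  The first is that the fractional divergence is the Riesz potential of the classical one: an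
  integration by parts gives \<open>frac_div s \<Psi> y = c * (LINT x. k (x - y) * divergence \<Psi> x)\<close>. The
  singularity of \<open>k\<close> and the missing decay of \<open>\<Psi> x - \<Psi> y\<close> are dealt with by replacing \<open>k z\<close> with the
  smooth kernel \<open>(z \<bullet> z + e) powr - ((n + s - 1) / 2)\<close>, whose gradient is odd, and letting \<open>e\<close> tend
  to \<open>0\<close> by dominated convergence. For bounded \<open>u\<close> the natural candidate \<open>c * (LINT y. u y * k (x - y))\<close>
  for \<open>w x\<close> need not converge at infinity. However, \<open>divergence \<Psi>\<close> has integral \<open>0\<close>, so a constant may be
  subtracted: the renormalized potential \<open>w x = c * (LINT y. u y * (k (x - y) - k y))\<close> converges
  absolutely, because \<open>k\<close> is locally integrable and \<open>k (x - y) - k y\<close> decays like the gradient of \<open>k\<close>,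
  that is, with exponent \<open>n + s\<close>. It is bounded on bounded sets, hence integrable over \<open>\<Omega>\<close>, and Fubini
  yields \<open>(LINT x. w x * divergence \<Psi> x) = (LINT y. u y * frac_div s \<Psi> y)\<close> for all test fields
  (proposition \<open>frac_div_dual_potential\<close>). Thus a measure is the distributional derivative of \<open>w\<close> in \<open>\<Omega>\<close> if
  and only if it is the fractional derivative of \<open>u\<close> in \<open>\<Omega>\<close>.

  The second fact is that such a measure exists. Finite fractional variation says that the functional
  \<open>\<Psi> \<mapsto> - (LINT y. u y * frac_div s \<Psi> y)\<close> is bounded in the supremum norm, and the Riesz representation
  theorem (proposition \<open>vector_riesz_representation\<close>) turns it into a measure. That theorem is reduced to
  scalar functionals by coordinates. A scalar functional extends by density from differentiable to
  continuous functions, where minima are available and it is a difference of two positive functionals.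
  A positive functional \<open>I\<close> is represented by viewing \<open>I (g - f)\<close> as the volume of the region between
  the graphs of \<open>f\<close> and \<open>g\<close>: these regions form a semiring, Caratheodory's theorem extends the volume to
  a measure, and the measure of \<open>A\<close> is the volume of the cylinder over \<open>A\<close> of height \<open>1\<close>.
\<close>

section \<open>Continuously differentiable maps with compact support\<close>

lemma continuous_if_has_derivative:
  assumes "\<And>x. (f has_derivative f' x) (at x)"
  shows "continuous_on UNIV f"
  by (rule continuous_at_imp_continuous_on) (use assms has_derivative_continuous in blast)

text \<open>
  Besides the continuous derivative, this provides one compact set off which both the map and its
  derivative vanish; the derivative vanishes there because the complement of the set is open.
\<close>

lemma C1cE:
  fixes \<Psi> :: "'a::euclidean_space \<Rightarrow> 'b::real_normed_vector"
  assumes "\<Psi> \<in> C1c \<Omega>"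
  obtains \<Psi>' :: "'a \<Rightarrow> 'a \<Rightarrow>\<^sub>L 'b" and K where
    "\<And>x. (\<Psi> has_derivative blinfun_apply (\<Psi>' x)) (at x)" "continuous_on UNIV \<Psi>'"
    "compact K" "K \<subseteq> \<Omega>" "\<And>x. x \<notin> K \<Longrightarrow> \<Psi> x = 0" "\<And>x. x \<notin> K \<Longrightarrow> \<Psi>' x = 0"
proof -
  obtain \<Psi>' :: "'a \<Rightarrow> 'a \<Rightarrow>\<^sub>L 'b" where
    d: "\<And>x. (\<Psi> has_derivative blinfun_apply (\<Psi>' x)) (at x)" and c: "continuous_on UNIV \<Psi>'"
    using assms by (auto simp: C1c_def)
  define K where "K = closure {x. \<Psi> x \<noteq> 0}"
  have K: "compact K" "K \<subseteq> \<Omega>" using assms by (auto simp: C1c_def K_def)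
  have z: "\<Psi> x = 0" if "x \<notin> K" for x
    using that closure_subset[of "{x. \<Psi> x \<noteq> 0}"] unfolding K_def by blast
  have "\<Psi>' x = 0" if "x \<notin> K" for x
  proof -
    have "((\<lambda>_. 0) has_derivative blinfun_apply (\<Psi>' x)) (at x)"
      by (rule has_derivative_transform_within_open[OF d, of "- K"])
        (use that K z in \<open>auto simp: compact_imp_closed open_Compl\<close>)
    moreover have "((\<lambda>_. 0) has_derivative (\<lambda>_. 0)) (at x)" by simp
    ultimately have "blinfun_apply (\<Psi>' x) = (\<lambda>_. 0)" by (rule has_derivative_unique)
    then show ?thesis by (intro blinfun_eqI) simp
  qed
  then show thesis using d c K z that by blast
qed

lemma C1cI:
  fixes \<Psi> :: "'a::euclidean_space \<Rightarrow> 'b::real_normed_vector"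
  assumes "\<And>x. (\<Psi> has_derivative blinfun_apply (\<Psi>' x)) (at x)" "continuous_on UNIV \<Psi>'"
    "compact K" "K \<subseteq> \<Omega>" "\<And>x. x \<notin> K \<Longrightarrow> \<Psi> x = 0"
  shows "\<Psi> \<in> C1c \<Omega>"
proof -
  have "closure {x. \<Psi> x \<noteq> 0} \<subseteq> K"
    using assms by (intro closure_minimal) (auto simp: compact_imp_closed)
  moreover from this have "compact (closure {x. \<Psi> x \<noteq> 0})"
    by (metis assms(3) closed_closure compact_Int_closed inf.absorb2)
  ultimately show ?thesis using assms(1,2,4) unfolding C1c_def by blast
qed

lemma bounded_if_vanishes_off_compact:
  fixes f :: "'a::topological_space \<Rightarrow> 'b::real_normed_vector"
  assumes "continuous_on UNIV f" "compact K" "\<And>x. x \<notin> K \<Longrightarrow> f x = 0"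
  obtains B where "0 < B" "\<And>x. norm (f x) \<le> B"
proof -
  have "compact (f ` K)" using assms continuous_on_subset[OF assms(1)] by (intro compact_continuous_image) auto
  then obtain B where B: "0 < B" "\<forall>y\<in>f ` K. norm y \<le> B"
    using compact_imp_bounded bounded_pos by blast
  then have "norm (f x) \<le> B" for x
    by (cases "x \<in> K") (auto simp: assms(3))
  then show thesis by (rule that[OF B(1)])
qed

lemma integrable_if_vanishes_off_compact:
  fixes f :: "'a::euclidean_space \<Rightarrow> 'b::euclidean_space"
  assumes "continuous_on UNIV f" "compact K" "\<And>x. x \<notin> K \<Longrightarrow> f x = 0"
  shows "integrable lborel f"
proof -
  have "integrable lborel (\<lambda>x. indicator K x *\<^sub>R f x)"
    using assms continuous_on_subset[OF assms(1)] by (intro borel_integrable_compact) auto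
  also have "(\<lambda>x. indicator K x *\<^sub>R f x) = f" using assms(3) by (auto simp: fun_eq_iff indicator_def)
  finally show ?thesis .
qed

lemma C1c_mono: "\<Psi> \<in> C1c A \<Longrightarrow> A \<subseteq> B \<Longrightarrow> \<Psi> \<in> C1c B"
  by (auto simp: C1c_def)

lemma C1c_zero: "(\<lambda>_. 0) \<in> C1c \<Omega>"
  by (rule C1cI[of _ "\<lambda>_. 0" "{}"]) (auto simp: zero_blinfun.rep_eq)

lemma C1c_add:
  fixes \<phi> \<psi> :: "'a::euclidean_space \<Rightarrow> 'b::real_normed_vector"
  assumes "\<phi> \<in> C1c \<Omega>" "\<psi> \<in> C1c \<Omega>"
  shows "(\<lambda>x. \<phi> x + \<psi> x) \<in> C1c \<Omega>"
proof -
  obtain \<phi>' K where 1: "\<And>x. (\<phi> has_derivative blinfun_apply (\<phi>' x)) (at x)" "continuous_on UNIV \<phi>'"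
    "compact K" "K \<subseteq> \<Omega>" "\<And>x. x \<notin> K \<Longrightarrow> \<phi> x = 0" by (rule C1cE[OF assms(1)]) blast
  obtain \<psi>' L where 2: "\<And>x. (\<psi> has_derivative blinfun_apply (\<psi>' x)) (at x)" "continuous_on UNIV \<psi>'"
    "compact L" "L \<subseteq> \<Omega>" "\<And>x. x \<notin> L \<Longrightarrow> \<psi> x = 0" by (rule C1cE[OF assms(2)]) blast
  show ?thesis
  proof (rule C1cI[of _ "\<lambda>x. \<phi>' x + \<psi>' x" "K \<union> L"])
    show "((\<lambda>x. \<phi> x + \<psi> x) has_derivative blinfun_apply (\<phi>' x + \<psi>' x)) (at x)" for x
      using has_derivative_add[OF 1(1) 2(1)] by (simp add: plus_blinfun.rep_eq)
  qed (use 1 2 in \<open>auto intro!: continuous_intros\<close>)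
qed

lemma C1c_linear:
  fixes \<phi> :: "'a::euclidean_space \<Rightarrow> 'b::real_normed_vector" and F :: "'b \<Rightarrow> 'c::real_normed_vector"
  assumes "\<phi> \<in> C1c \<Omega>" "bounded_linear F"
  shows "(\<lambda>x. F (\<phi> x)) \<in> C1c \<Omega>"
proof -
  obtain \<phi>' K where 1: "\<And>x. (\<phi> has_derivative blinfun_apply (\<phi>' x)) (at x)" "continuous_on UNIV \<phi>'"
    "compact K" "K \<subseteq> \<Omega>" "\<And>x. x \<notin> K \<Longrightarrow> \<phi> x = 0" by (rule C1cE[OF assms(1)]) blast
  interpret F: bounded_linear F by fact
  have F: "blinfun_apply (Blinfun F) = F" by (rule bounded_linear_Blinfun_apply[OF assms(2)])
  show ?thesis
  proof (rule C1cI[of _ "\<lambda>x. Blinfun F o\<^sub>L \<phi>' x" K])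
    show "((\<lambda>x. F (\<phi> x)) has_derivative blinfun_apply (Blinfun F o\<^sub>L \<phi>' x)) (at x)" for x
      using F.has_derivative[OF 1(1)] by (simp add: F blinfun_compose.rep_eq comp_def)
  qed (use 1 in \<open>auto intro!: continuous_intros simp: F.zero\<close>)
qed

lemma C1c_scale: "\<phi> \<in> C1c \<Omega> \<Longrightarrow> (\<lambda>x. c * \<phi> x) \<in> C1c \<Omega>" for \<phi> :: "'a::euclidean_space \<Rightarrow> real"
  by (rule C1c_linear) (auto intro: bounded_linear_mult_right)

lemma lipschitz_if_C1c:
  fixes f :: "'a::euclidean_space \<Rightarrow> 'b::real_normed_vector" and f' :: "'a \<Rightarrow> 'a \<Rightarrow>\<^sub>L 'b"
  assumes d: "\<And>x. (f has_derivative blinfun_apply (f' x)) (at x)"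
    and "\<And>x. norm (f' x) \<le> B"
  shows "norm (f x - f y) \<le> B * norm (x - y)"
  using differentiable_bound[of UNIV f "\<lambda>x. blinfun_apply (f' x)" B x y] assms
  by (auto simp: norm_blinfun.rep_eq[symmetric] has_derivative_at_withinI)

lemma divergence_eq:
  assumes "(\<Psi> has_derivative blinfun_apply D) (at x)"
  shows "divergence \<Psi> x = (\<Sum>b\<in>Basis. D b \<bullet> b)"
  using frechet_derivative_at[OF assms] by (simp add: divergence_def)

lemma divergence_linear:
  fixes \<Psi> \<Phi> :: "'a::euclidean_space \<Rightarrow> 'a"
  assumes "\<Psi> \<in> C1c \<Omega>"
  shows "\<Phi> \<in> C1c \<Omega> \<Longrightarrow> divergence (\<lambda>x. \<Psi> x + \<Phi> x) x = divergence \<Psi> x + divergence \<Phi> x"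
    and "divergence (\<lambda>x. c *\<^sub>R \<Psi> x) x = c * divergence \<Psi> x"
proof -
  obtain \<Psi>' K where d: "\<And>x. (\<Psi> has_derivative blinfun_apply (\<Psi>' x)) (at x)" by (rule C1cE[OF assms]) blast
  have "((\<lambda>x. c *\<^sub>R \<Psi> x) has_derivative blinfun_apply (c *\<^sub>R \<Psi>' x)) (at x)"
    using has_derivative_scaleR_right[OF d[of x], of c] by (simp add: scaleR_blinfun.rep_eq)
  then show "divergence (\<lambda>x. c *\<^sub>R \<Psi> x) x = c * divergence \<Psi> x"
    by (simp add: divergence_eq[OF d] divergence_eq blinfun.scaleR_left sum_distrib_left)
  assume "\<Phi> \<in> C1c \<Omega>"
  then obtain \<Phi>' where e: "\<And>x. (\<Phi> has_derivative blinfun_apply (\<Phi>' x)) (at x)" by (rule C1cE) blast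
  have "((\<lambda>x. \<Psi> x + \<Phi> x) has_derivative blinfun_apply (\<Psi>' x + \<Phi>' x)) (at x)"
    using has_derivative_add[OF d[of x] e[of x]] by (simp add: plus_blinfun.rep_eq)
  then show "divergence (\<lambda>x. \<Psi> x + \<Phi> x) x = divergence \<Psi> x + divergence \<Phi> x"
    by (simp add: divergence_eq[OF d] divergence_eq[OF e] divergence_eq blinfun.add_left inner_add_left sum.distrib)
qed

lemma C1c_divergence:
  fixes \<Psi> :: "'a::euclidean_space \<Rightarrow> 'a"
  assumes "\<Psi> \<in> C1c \<Omega>"
  obtains K where "continuous_on UNIV (divergence \<Psi>)" "compact K" "K \<subseteq> \<Omega>"
    "\<And>x. x \<notin> K \<Longrightarrow> \<Psi> x = 0" "\<And>x. x \<notin> K \<Longrightarrow> divergence \<Psi> x = 0"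
proof -
  obtain \<Psi>' K where d: "\<And>x. (\<Psi> has_derivative blinfun_apply (\<Psi>' x)) (at x)"
    and c: "continuous_on UNIV \<Psi>'" and K: "compact K" "K \<subseteq> \<Omega>"
      "\<And>x. x \<notin> K \<Longrightarrow> \<Psi> x = 0" "\<And>x. x \<notin> K \<Longrightarrow> \<Psi>' x = 0"
    by (rule C1cE[OF assms]) blast
  have div\<Psi>: "divergence \<Psi> x = (\<Sum>b\<in>Basis. \<Psi>' x b \<bullet> b)" for x by (rule divergence_eq[OF d])
  show thesis
    by (rule that[of K]) (use K in \<open>auto simp: div\<Psi>[abs_def] intro!: continuous_intros c\<close>)
qed

section \<open>Integrability of powers of the norm\<close>

text \<open>
  A function that is at most \<open>c k\<close> on the \<open>k\<close>-th of a family of pieces contained in balls is dominated by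
  the sum of the functions \<open>c k * indicator (cball 0 (r k))\<close>, whose integrals are multiples of
  \<open>c k * r k ^ DIM('a)\<close>. Applied to dyadic shells, it takes the role of polar coordinates.
\<close>

lemma integrable_if_dominated_on_balls:
  fixes f :: "'a::euclidean_space \<Rightarrow> real" and r c :: "nat \<Rightarrow> real"
  assumes [measurable]: "f \<in> borel_measurable borel"
    and nonneg: "\<And>z. 0 \<le> f z" "\<And>k. 0 \<le> r k" "\<And>k. 0 \<le> c k"
    and bound: "\<And>z. f z \<noteq> 0 \<Longrightarrow> \<exists>k. norm z \<le> r k \<and> f z \<le> c k"
    and summable: "summable (\<lambda>k. c k * r k ^ DIM('a))"
  shows "integrable lborel f"
proof (rule integrableI_nonneg)
  have "(\<integral>\<^sup>+z. ennreal (f z) \<partial>lborel)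
      \<le> (\<integral>\<^sup>+z. (\<Sum>k. ennreal (c k) * indicator (cball 0 (r k)) z) \<partial>(lborel :: 'a measure))"
  proof (rule nn_integral_mono)
    fix z :: 'a
    show "ennreal (f z) \<le> (\<Sum>k. ennreal (c k) * indicator (cball 0 (r k)) z)"
    proof (cases "f z = 0")
      case False
      then obtain k where "norm z \<le> r k" "f z \<le> c k" using bound by blast
      then have "ennreal (f z) \<le> ennreal (c k) * indicator (cball 0 (r k)) z"
        by (simp add: ennreal_leI)
      also have "\<dots> \<le> (\<Sum>k. ennreal (c k) * indicator (cball 0 (r k)) z)"
        using sum_le_suminf[OF summableI finite.insertI[OF finite.emptyI],
            of k "\<lambda>k. ennreal (c k) * indicator (cball 0 (r k)) z"]
        by (simp only: sum.insert finite.emptyI empty_iff sum.empty not_False_eq_True add_0_right zero_le simp_thms)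
      finally show ?thesis .
    qed simp
  qed
  also have "\<dots> = (\<Sum>k. ennreal (c k) * emeasure lborel (cball (0 :: 'a) (r k)))"
    by (subst nn_integral_suminf) (auto intro!: suminf_cong borel_measurable_times_ennreal borel_measurable_indicator nn_integral_cmult_indicator)
  also have "\<dots> = (\<Sum>k. ennreal (unit_ball_vol DIM('a) * (c k * r k ^ DIM('a))))"
    using nonneg by (simp add: emeasure_cball ennreal_mult[symmetric] mult_ac)
  also have "\<dots> < \<infinity>"
    using summable nonneg
    by (subst suminf_ennreal2) (auto intro!: mult_nonneg_nonneg summable_mult simp: top.not_eq_extremum)
  finally show "(\<integral>\<^sup>+z. ennreal (f z) \<partial>lborel) < \<infinity>" .
qed (use nonneg in auto)

lemma powr_of_power: "0 < x \<Longrightarrow> (x ^ k) powr b = (x powr b) ^ k" for x b :: real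
  by (simp add: powr_realpow[symmetric] powr_powr mult.commute)

text \<open>
  Cutting the ball into dyadic shells bounds the integral by a geometric series with ratio
  \<open>2 powr (a - DIM('a))\<close>.
\<close>

lemma integrable_powr_cball:
  fixes a R :: real
  assumes "0 \<le> a" "a < DIM('a::euclidean_space)"
  shows "integrable lborel (\<lambda>z::'a. indicator (cball 0 R) z * norm z powr - a)"
proof (cases "R > 0")
  case R: True
  define q :: real where "q = 2 powr (a - DIM('a))"
  have q: "0 < q" "q < 1" using assms by (auto simp: q_def powr_less_one)
  show ?thesis
  proof (rule integrable_if_dominated_on_balls[of _ "\<lambda>k. R * (1/2)^k" "\<lambda>k. (R * (1/2)^(Suc k)) powr - a"])
    fix z :: 'a assume nz: "indicator (cball 0 R) z * norm z powr - a \<noteq> 0"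
    then have z: "norm z \<le> R" "0 < norm z" by (auto split: split_indicator_asm)
    obtain m where m: "(1/2)^m < norm z / R"
      using real_arch_pow_inv[of "norm z / R" "1/2"] z R by auto
    \<comment> \<open>the index of the dyadic shell that contains \<open>z\<close>\<close>
    define k where "k = (LEAST k. R * (1/2)^(Suc k) < norm z)"
    have "R * (1/2)^m < norm z" using m R by (simp add: field_simps)
    moreover have "R * (1/2)^(Suc m) \<le> R * (1/2)^m" using R by (simp add: field_simps)
    ultimately have ex: "R * (1/2)^(Suc m) < norm z" by linarith
    have k: "R * (1/2)^(Suc k) < norm z" unfolding k_def by (rule LeastI[of _ m]) (fact ex)
    have k2: "norm z \<le> R * (1/2)^k"
    proof (cases k)
      case (Suc j)
      then have "\<not> R * (1/2)^(Suc j) < norm z" 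
        using not_less_Least[of j "\<lambda>k. R * (1/2)^(Suc k) < norm z"] unfolding k_def by simp
      then show ?thesis using Suc by simp
    qed (use z in simp)
    have "norm z powr - a \<le> (R * (1/2)^(Suc k)) powr - a"
      using k R assms(1) by (intro powr_mono2') auto
    then show "\<exists>k. norm z \<le> R * (1/2)^k \<and>
        indicator (cball 0 R) z * norm z powr - a \<le> (R * (1/2)^(Suc k)) powr - a"
      using k2 z by (intro exI[of _ k]) auto
  next
    have "(R * (1/2)^(Suc k)) powr - a * (R * (1/2)^k) ^ DIM('a)
        = (R/2) powr -a * R ^ DIM('a) * q ^ k" for k
    proof -
      have "(R * (1/2)^(Suc k)) powr - a = (R/2) powr -a * ((1/2) powr -a) ^ k"
      proof -
        have "(R * (1/2)^(Suc k)) powr - a = (R/2 * (1/2)^k) powr - a" by simp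
        also have "\<dots> = (R/2) powr -a * ((1/2)^k) powr -a" by (rule powr_mult)
        also have "((1/2)^k) powr -a = ((1/2) powr -a) ^ k" by (rule powr_of_power) simp
        finally show ?thesis .
      qed
      moreover have "(R * (1/2)^k) ^ DIM('a) = R ^ DIM('a) * ((1/2) ^ DIM('a)) ^ k"
        by (simp only: power_mult_distrib power_mult[symmetric] mult.commute[of k])
      moreover have "q = (1/2) powr -a * (1/2) ^ DIM('a)"
        by (simp add: q_def powr_diff powr_minus_divide powr_divide powr_realpow power_one_over)
      ultimately show ?thesis by (simp only: power_mult_distrib mult_ac)
    qed
    then show "summable (\<lambda>k. (R * (1/2)^(Suc k)) powr - a * (R * (1/2)^k) ^ DIM('a))"
      using q by (simp only:) (intro summable_mult summable_geometric, simp)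
  qed (use R in \<open>auto intro!: borel_measurable_times borel_measurable_indicator\<close>)
next
  case False
  then have "(\<lambda>z::'a. indicator (cball 0 R) z * norm z powr - a) = (\<lambda>_. 0)"
    by (auto simp: fun_eq_iff split: split_indicator) (smt (verit) norm_le_zero_iff)
  then show ?thesis by (simp only: integrable_zero)
qed

text \<open>
  The dyadic shells now grow, and the ratio is \<open>2 powr (DIM('a) - b)\<close>.
\<close>

lemma integrable_powr_outside_cball:
  fixes b R :: real
  assumes "DIM('a::euclidean_space) < b" "0 < R"
  shows "integrable lborel (\<lambda>z::'a. indicator (- cball 0 R) z * norm z powr - b)"
proof -
  define q :: real where "q = 2 powr (DIM('a) - b)"
  have q: "0 < q" "q < 1" using assms by (auto simp: q_def powr_less_one)
  show ?thesis
  proof (rule integrable_if_dominated_on_balls[of _ "\<lambda>k. R * 2^(Suc k)" "\<lambda>k. (R * 2^k) powr - b"])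
    fix z :: 'a assume nz: "indicator (- cball 0 R) z * norm z powr - b \<noteq> 0"
    then have z: "R < norm z" by (auto split: split_indicator_asm)
    obtain m where m: "norm z / R < 2 ^ m" using real_arch_pow[of 2 "norm z / R"] by auto
    \<comment> \<open>the index of the dyadic shell that contains \<open>z\<close>\<close>
    define k where "k = (LEAST k. norm z \<le> R * 2^(Suc k))"
    have "norm z \<le> R * 2^m" using m assms by (simp add: field_simps)
    moreover have "R * 2^m \<le> R * 2^(Suc m)" using assms by (simp add: field_simps)
    ultimately have ex: "norm z \<le> R * 2^(Suc m)" by linarith
    have k: "norm z \<le> R * 2^(Suc k)" unfolding k_def by (rule LeastI[of _ m]) (fact ex)
    have k2: "R * 2^k \<le> norm z"
    proof (cases k)
      case (Suc j)
      then have "\<not> norm z \<le> R * 2^(Suc j)"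
        using not_less_Least[of j "\<lambda>k. norm z \<le> R * 2^(Suc k)"] unfolding k_def by simp
      then show ?thesis using Suc by simp
    qed (use z in simp)
    have "norm z powr - b \<le> (R * 2^k) powr - b"
      using k2 assms by (intro powr_mono2') auto
    then show "\<exists>k. norm z \<le> R * 2^(Suc k) \<and>
        indicator (- cball 0 R) z * norm z powr - b \<le> (R * 2^k) powr - b"
      using k z by (intro exI[of _ k]) auto
  next
    have "(R * 2^k) powr - b * (R * 2^(Suc k)) ^ DIM('a)
        = R powr -b * (2 * R) ^ DIM('a) * q ^ k" for k
    proof -
      have "(R * 2^k) powr - b = R powr -b * (2 powr -b) ^ k"
      proof -
        have "(R * 2^k) powr - b = R powr -b * (2^k) powr -b" by (rule powr_mult)
        also have "(2^k) powr -b = (2 powr -b) ^ k" by (rule powr_of_power) simp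
        finally show ?thesis .
      qed
      moreover have "(R * 2^(Suc k)) ^ DIM('a) = (2 * R) ^ DIM('a) * (2 ^ DIM('a)) ^ k"
        by (simp add: power_mult_distrib power_mult[symmetric] power_add mult.commute[of k])
      moreover have "q = 2 powr -b * 2 ^ DIM('a)"
        by (simp add: q_def powr_diff powr_minus_divide powr_realpow)
      ultimately show ?thesis by (simp only: power_mult_distrib mult_ac)
    qed
    then show "summable (\<lambda>k. (R * 2^k) powr - b * (R * 2^(Suc k)) ^ DIM('a))"
      using q by (simp only:) (intro summable_mult summable_geometric, simp)
  qed (use assms in \<open>auto intro!: borel_measurable_times borel_measurable_indicator borel_open simp: open_Compl\<close>)
qed

section \<open>The divergence theorem for compactly supported fields\<close>

lemma integral_lborel_translate:
  fixes f :: "'a::euclidean_space \<Rightarrow> 'b::euclidean_space"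
  assumes [measurable]: "f \<in> borel_measurable borel"
  shows "(LINT x|lborel. f (v + x)) = (LINT x|lborel. f x)"
  by (subst (2) lborel_distr_plus[of v, symmetric]) (simp add: integral_distr)

lemma integrable_lborel_translate:
  fixes f :: "'a::euclidean_space \<Rightarrow> 'b::euclidean_space"
  assumes "integrable lborel f"
  shows "integrable lborel (\<lambda>x. f (v + x))"
proof -
  have "integrable (distr lborel borel ((+) v)) f" using assms by (simp add: lborel_distr_plus)
  then show ?thesis by (rule integrable_distr[rotated]) simp
qed

lemma lborel_distr_minus: "distr lborel borel uminus = (lborel :: 'a::euclidean_space measure)"
proof -
  have "(lborel :: 'a measure) = density (distr lborel borel (\<lambda>x. 0 + (-1) *\<^sub>R x)) (\<lambda>_. 1)"
    using lborel_affine[of "-1" "0 :: 'a"] by simp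
  then show ?thesis by (simp add: density_1)
qed

lemma integral_lborel_reflect:
  fixes f :: "'a::euclidean_space \<Rightarrow> 'b::euclidean_space"
  assumes [measurable]: "f \<in> borel_measurable borel"
  shows "(LINT x|lborel. f (- x)) = (LINT x|lborel. f x)"
  by (subst (2) lborel_distr_minus[symmetric]) (simp add: integral_distr)

text \<open>
  By translation invariance every difference quotient of \<open>f\<close> in direction \<open>v\<close> has integral \<open>0\<close>. The
  quotients converge to \<open>f' x v\<close>, and the Lipschitz bound together with the compact support gives an
  integrable majorant.
\<close>

lemma integral_derivative_eq_0:
  fixes f :: "'a::euclidean_space \<Rightarrow> real" and f' :: "'a \<Rightarrow> 'a \<Rightarrow>\<^sub>L real"
  assumes d: "\<And>x. (f has_derivative blinfun_apply (f' x)) (at x)"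
    and f': "continuous_on UNIV f'"
    and K: "compact K" "\<And>x. x \<notin> K \<Longrightarrow> f x = 0" "\<And>x. x \<notin> K \<Longrightarrow> f' x = 0"
  shows "(LINT x|lborel. f' x v) = 0"
proof -
  have f: "continuous_on UNIV f"
    by (rule continuous_at_imp_continuous_on) (use d has_derivative_continuous in blast)
  have [measurable]: "f \<in> borel_measurable borel" using f by (rule borel_measurable_continuous_onI)
  have [measurable]: "(\<lambda>x. f' x v) \<in> borel_measurable borel"
    using f' by (intro borel_measurable_continuous_onI continuous_intros)
  obtain B where B: "0 < B" "\<And>x. norm (f' x) \<le> B"
    using bounded_if_vanishes_off_compact[OF f' K(1,3)] by blast
  obtain R where R: "0 < R" "\<And>x. x \<in> K \<Longrightarrow> norm x \<le> R"
    using compact_imp_bounded[OF K(1)] bounded_pos by blast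
  define e :: "nat \<Rightarrow> real" where "e i = 1 / Suc i" for i
  have e: "0 < e i" "e i \<le> 1" for i by (auto simp: e_def)
  have ene: "e i \<noteq> 0" for i using e(1)[of i] by simp
  have e0: "e \<longlonglongrightarrow> 0" unfolding e_def by (rule LIMSEQ_inverse_real_of_nat[unfolded inverse_eq_divide])
  have fint: "integrable lborel f" by (rule integrable_if_vanishes_off_compact[OF f K(1,2)])
  define q where "q i x = (f (e i *\<^sub>R v + x) - f x) / e i" for i x
  have q0: "(LINT x|lborel. q i x) = 0" for i
  proof -
    have "(LINT x|lborel. f (e i *\<^sub>R v + x) - f x) = 0"
      using Bochner_Integration.integral_diff[OF integrable_lborel_translate[OF fint] fint]
        integral_lborel_translate[of f "e i *\<^sub>R v"] by simp
    then show ?thesis unfolding q_def by simp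
  qed
  have "(\<lambda>i. LINT x|lborel. q i x) \<longlonglongrightarrow> (LINT x|lborel. f' x v)"
  proof (rule integral_dominated_convergence[where w="\<lambda>x. indicator (cball 0 (R + norm v)) x * (B * norm v)"])
    show "integrable lborel (\<lambda>x::'a. indicator (cball 0 (R + norm v)) x * (B * norm v))"
      by (intro integrable_mult_left integrable_real_indicator) (use emeasure_lborel_cball_finite[of 0 "R + norm v"] in \<open>simp_all add: borel_closed\<close>)
    show "AE x in lborel. norm (q i x) \<le> indicator (cball 0 (R + norm v)) x * (B * norm v)" for i
    proof (rule AE_I2)
      fix x
      have "norm (f (e i *\<^sub>R v + x) - f x) \<le> B * norm (e i *\<^sub>R v + x - x)"
        by (rule lipschitz_if_C1c[OF d B(2)])
      then have 1: "norm (q i x) \<le> B * norm v"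
        using e[of i] by (simp add: q_def field_simps)
      have "q i x = 0" if "norm x > R + norm v"
      proof -
        have "norm (e i *\<^sub>R v) \<le> norm v" using e[of i] by (simp add: mult_left_le_one_le)
        moreover have "norm x \<le> norm (e i *\<^sub>R v + x) + norm (e i *\<^sub>R v)"
          using norm_triangle_ineq4[of "e i *\<^sub>R v + x" "e i *\<^sub>R v"] by simp
        ultimately have "norm (e i *\<^sub>R v + x) > R" using that by linarith
        moreover have "norm x > R" using that norm_ge_zero[of v] by linarith
        ultimately have "e i *\<^sub>R v + x \<notin> K" "x \<notin> K"
          using R(2)[of "e i *\<^sub>R v + x"] R(2)[of x] by linarith+
        then show ?thesis using K by (simp add: q_def)
      qed
      with 1 show "norm (q i x) \<le> indicator (cball 0 (R + norm v)) x * (B * norm v)"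
        by (auto split: split_indicator)
    qed
    show "AE x in lborel. (\<lambda>i. q i x) \<longlonglongrightarrow> f' x v"
    proof (rule AE_I2)
      fix x
      have "((\<lambda>t. f (x + t *\<^sub>R v)) has_derivative (\<lambda>t. f' x (t *\<^sub>R v))) (at 0)"
        by (rule has_derivative_compose[where g = f, of _ "\<lambda>t. t *\<^sub>R v"])
          (auto intro!: derivative_eq_intros d)
      then have "((\<lambda>t. f (x + t *\<^sub>R v)) has_field_derivative f' x v) (at 0)"
        by (simp add: has_field_derivative_def blinfun.scaleR_right mult_commute_abs)
      then have "((\<lambda>h. (f (x + h *\<^sub>R v) - f x) / h) \<longlongrightarrow> f' x v) (at 0)"
        by (simp add: DERIV_def)
      then have "(\<lambda>i. (f (x + e i *\<^sub>R v) - f x) / e i) \<longlonglongrightarrow> f' x v"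
        by (rule filterlim_compose[where g="\<lambda>h. (f (x + h *\<^sub>R v) - f x) / h" and f=e]) (use e0 ene in \<open>auto simp: filterlim_at\<close>)
      then show "(\<lambda>i. q i x) \<longlonglongrightarrow> f' x v" by (simp add: q_def add.commute)
    qed
  qed (simp_all add: q_def[abs_def])
  then show ?thesis by (simp add: q0 LIMSEQ_const_iff)
qed

lemma integral_divergence_eq_0:
  fixes \<Phi> :: "'a::euclidean_space \<Rightarrow> 'a"
  assumes "\<Phi> \<in> C1c UNIV"
  shows "integrable lborel (divergence \<Phi>)" "(LINT x|lborel. divergence \<Phi> x) = 0"
proof -
  obtain \<Phi>' K where \<Phi>: "\<And>x. (\<Phi> has_derivative blinfun_apply (\<Phi>' x)) (at x)" "continuous_on UNIV \<Phi>'"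
    "compact K" "\<And>x. x \<notin> K \<Longrightarrow> \<Phi> x = 0" "\<And>x. x \<notin> K \<Longrightarrow> \<Phi>' x = 0"
    by (rule C1cE[OF assms]) blast
  define f' where "f' b x = blinfun_inner_left b o\<^sub>L \<Phi>' x" for b x
  have f': "f' b x v = \<Phi>' x v \<bullet> b" for b x v by (simp add: f'_def inner_commute)
  have cont: "continuous_on UNIV (f' b)" for b
    unfolding f'_def[abs_def] by (intro continuous_intros \<Phi>)
  have div: "divergence \<Phi> = (\<lambda>x. \<Sum>b\<in>Basis. f' b x b)"
    unfolding fun_eq_iff divergence_eq[OF \<Phi>(1)] by (simp add: f')
  have int: "integrable lborel (\<lambda>x. f' b x b)" for b
    by (rule integrable_if_vanishes_off_compact[OF _ \<Phi>(3)])
      (auto intro!: continuous_intros cont[unfolded f'_def[abs_def]] \<Phi>(2) simp: f'_def \<Phi>(5))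
  then show "integrable lborel (divergence \<Phi>)" unfolding div by auto
  have d: "((\<lambda>x. \<Phi> x \<bullet> b) has_derivative blinfun_apply (f' b x)) (at x)" for b x
  proof -
    have "blinfun_apply (f' b x) = (\<lambda>v. \<Phi>' x v \<bullet> b)" by (simp add: f' fun_eq_iff)
    then show ?thesis by (simp only:) (rule has_derivative_inner_left[OF \<Phi>(1)])
  qed
  have "(LINT x|lborel. f' b x b) = 0" for b
    by (rule integral_derivative_eq_0[OF d cont \<Phi>(3)]) (simp_all add: f'_def \<Phi>(4,5))
  then show "(LINT x|lborel. divergence \<Phi> x) = 0"  unfolding div using int by simp
qed

section \<open>The fractional divergence as a Riesz potential\<close>

text \<open>
  Integration by parts against a kernel without singularity: the divergence theorem for the compactly
  supported field \<open>z \<mapsto> g z *\<^sub>R \<Psi> (y + z)\<close>, where \<open>- a * G z\<close> times \<open>z\<close> is the gradient of \<open>g\<close>.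
\<close>

lemma regularized_kernel_by_parts:
  fixes \<Psi> :: "'a::euclidean_space \<Rightarrow> 'a" and a e :: real
  assumes \<Psi>: "\<Psi> \<in> C1c UNIV" and e: "0 < e"
  defines "g \<equiv> \<lambda>z::'a. (z \<bullet> z + e) powr (- a / 2)"
    and "G \<equiv> \<lambda>z::'a. (z \<bullet> z + e) powr (- a / 2 - 1)"
  shows "(LINT z|lborel. g z * divergence \<Psi> (y + z)) = a * (LINT z|lborel. G z * (z \<bullet> \<Psi> (y + z)))"
proof -
  obtain \<Psi>' K where d: "\<And>x. (\<Psi> has_derivative blinfun_apply (\<Psi>' x)) (at x)"
    and c: "continuous_on UNIV \<Psi>'"
    and K: "compact K" "\<And>x. x \<notin> K \<Longrightarrow> \<Psi> x = 0" "\<And>x. x \<notin> K \<Longrightarrow> \<Psi>' x = 0"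
    by (rule C1cE[OF \<Psi>]) blast
  have pos: "0 < z \<bullet> z + e" for z :: 'a using e by (simp add: add_nonneg_pos)
  then have nz: "z \<bullet> z + e \<noteq> 0" for z :: 'a by (metis less_irrefl)
  have cg: "continuous_on UNIV g" and cG: "continuous_on UNIV G"
    unfolding g_def G_def using nz by (auto intro!: continuous_intros)
  define g' where "g' z = (- a * G z) *\<^sub>R blinfun_inner_left z" for z
  have dg: "(g has_derivative blinfun_apply (g' z)) (at z)" for z
  proof -
    have "((\<lambda>z::'a. z \<bullet> z + e) has_derivative (\<lambda>h. 2 * (z \<bullet> h))) (at z)"
      by (auto intro!: derivative_eq_intros simp: inner_commute)
    moreover have "((\<lambda>t. t powr (- a / 2)) has_derivative
        (*) ((- a / 2) * (z \<bullet> z + e) powr (- a / 2 - 1))) (at (z \<bullet> z + e))"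
      using has_real_derivative_powr[OF pos[of z], of "- a / 2"] by (simp add: has_field_derivative_def)
    ultimately have "(g has_derivative (\<lambda>h. (- a / 2) * (z \<bullet> z + e) powr (- a / 2 - 1) * (2 * (z \<bullet> h)))) (at z)"
      unfolding g_def by (rule has_derivative_compose)
    also have "(\<lambda>h. (- a / 2) * (z \<bullet> z + e) powr (- a / 2 - 1) * (2 * (z \<bullet> h))) = blinfun_apply (g' z)"
      by (auto simp: fun_eq_iff g'_def G_def blinfun.scaleR_left blinfun.minus_left inner_commute)
    finally show ?thesis .
  qed
  define \<Phi> where "\<Phi> z = g z *\<^sub>R \<Psi> (y + z)" for z
  define \<Phi>' where "\<Phi>' z = g z *\<^sub>R \<Psi>' (y + z) + (blinfun_scaleR_left (\<Psi> (y + z)) o\<^sub>L g' z)" for z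
  have "((\<lambda>z. \<Psi> (y + z)) has_derivative blinfun_apply (\<Psi>' (y + z))) (at z)" for z
    by (rule has_derivative_compose[of "\<lambda>z. y + z" "\<lambda>h. h" _ _ \<Psi>, OF _ d]) (auto intro!: derivative_eq_intros)
  then have "(\<Phi> has_derivative (\<lambda>h. g z *\<^sub>R \<Psi>' (y + z) h + g' z h *\<^sub>R \<Psi> (y + z))) (at z)" for z
    unfolding \<Phi>_def[abs_def] by (intro has_derivative_scaleR dg)
  moreover have "(\<lambda>h. g z *\<^sub>R \<Psi>' (y + z) h + g' z h *\<^sub>R \<Psi> (y + z)) = blinfun_apply (\<Phi>' z)" for z
    by (auto simp: fun_eq_iff \<Phi>'_def blinfun.add_left blinfun.scaleR_left)
  ultimately have d\<Phi>: "(\<Phi> has_derivative blinfun_apply (\<Phi>' z)) (at z)" for z by simp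
  have c\<Psi>: "continuous_on UNIV \<Psi>" by (rule continuous_if_has_derivative[OF d])
  have trans: "continuous_on UNIV (\<lambda>z. f (y + z))" if "continuous_on UNIV f" for f :: "'a \<Rightarrow> 'b::topological_space"
    by (rule continuous_on_compose2[OF that]) (auto intro!: continuous_intros)
  have cg': "continuous_on UNIV g'"
    unfolding g'_def[abs_def] by (intro continuous_intros cG)
  have c\<Phi>': "continuous_on UNIV \<Phi>'"
    unfolding \<Phi>'_def[abs_def] by (intro continuous_intros cg cg' trans c c\<Psi>)
  define K' where "K' = (\<lambda>x. x - y) ` K"
  have K': "compact K'" unfolding K'_def
    by (intro compact_continuous_image K continuous_intros)
  have off: "y + z \<notin> K" if "z \<notin> K'" for z
  proof
    assume "y + z \<in> K"
    then have "(y + z) - y \<in> K'" unfolding K'_def by (rule imageI)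
    then show False using that by simp
  qed
  have "\<Phi> \<in> C1c UNIV"
    by (rule C1cI[OF d\<Phi> c\<Phi>' K']) (use off K in \<open>auto simp: \<Phi>_def\<close>)
  then have 0: "(LINT z|lborel. divergence \<Phi> z) = 0" by (rule integral_divergence_eq_0)
  have div\<Psi>: "divergence \<Psi> x = (\<Sum>b\<in>Basis. \<Psi>' x b \<bullet> b)" for x by (rule divergence_eq[OF d])
  have div\<Phi>: "divergence \<Phi> z = g z * divergence \<Psi> (y + z) - a * (G z * (z \<bullet> \<Psi> (y + z)))" for z
  proof -
    have "divergence \<Phi> z = (\<Sum>b\<in>Basis. \<Phi>' z b \<bullet> b)" by (rule divergence_eq[OF d\<Phi>])
    also have "\<dots> = (\<Sum>b\<in>Basis. g z * (\<Psi>' (y + z) b \<bullet> b) + (- a * G z) * ((z \<bullet> b) * (\<Psi> (y + z) \<bullet> b)))"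
      by (intro sum.cong)
        (auto simp: \<Phi>'_def g'_def blinfun.add_left blinfun.scaleR_left blinfun.minus_left inner_diff_left inner_add_left
            inner_commute[of z])
    also have "\<dots> = g z * (\<Sum>b\<in>Basis. \<Psi>' (y + z) b \<bullet> b)
        + (- a * G z) * (\<Sum>b\<in>Basis. (z \<bullet> b) * (\<Psi> (y + z) \<bullet> b))"
      by (simp only: sum.distrib sum_distrib_left)
    also have "(\<Sum>b\<in>Basis. (z \<bullet> b) * (\<Psi> (y + z) \<bullet> b)) = z \<bullet> \<Psi> (y + z)"
      by (rule euclidean_inner[symmetric])
    finally show ?thesis by (simp add: div\<Psi>)
  qed
  have "continuous_on UNIV (divergence \<Psi>)"
    unfolding div\<Psi>[abs_def] by (intro continuous_intros c)
  then have i1: "integrable lborel (\<lambda>z. g z * divergence \<Psi> (y + z))"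
    by (intro integrable_if_vanishes_off_compact[OF _ K'] continuous_intros cg trans)
      (use off K in \<open>auto simp: div\<Psi>\<close>)
  have i2: "integrable lborel (\<lambda>z. a * (G z * (z \<bullet> \<Psi> (y + z))))"
    by (rule integrable_if_vanishes_off_compact[OF _ K'])
      (use off K in \<open>auto intro!: continuous_intros cG trans c\<Psi>\<close>)
  show ?thesis using 0 unfolding div\<Phi> using Bochner_Integration.integral_diff[OF i1 i2] by simp
qed

text \<open>
  The limit of the regularized identity as the regularization \<open>e\<close> tends to \<open>0\<close>. Before passing to the limit, \<open>\<Psi> (y + z)\<close> on the right-hand
  side is replaced by \<open>\<Psi> (y + z) - \<Psi> y\<close>, which does not change the integral since \<open>z \<mapsto> G z *\<^sub>R z\<close> is odd. The
  difference gains one power of \<open>norm z\<close> near \<open>0\<close>, and this makes the limit integrand, of order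
  \<open>norm z powr - a\<close> near \<open>0\<close> and \<open>norm z powr - (a + 1)\<close> at infinity, integrable.
\<close>

lemma riesz_kernel_by_parts:
  fixes \<Psi> :: "'a::euclidean_space \<Rightarrow> 'a" and s :: real
  assumes \<Psi>: "\<Psi> \<in> C1c UNIV" and s: "0 < s" "s < 1"
  defines "a \<equiv> real DIM('a) + s - 1"
  shows "integrable lborel (\<lambda>z. norm z powr - a * divergence \<Psi> (y + z))" (is ?I)
    and "(LINT z|lborel. norm z powr - a * divergence \<Psi> (y + z))
      = a * (LINT z|lborel. ((\<Psi> (y + z) - \<Psi> y) \<bullet> z) / norm z powr (real DIM('a) + s + 1))" (is ?E)
proof -
  have D: "real DIM('a) \<ge> 1" by simp
  have a: "0 < a" "a < DIM('a)" "DIM('a) < a + 1" using s D unfolding a_def by linarith+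
  obtain \<Psi>' K where d: "\<And>x. (\<Psi> has_derivative blinfun_apply (\<Psi>' x)) (at x)"
    and c: "continuous_on UNIV \<Psi>'"
    and K: "compact K" "\<And>x. x \<notin> K \<Longrightarrow> \<Psi> x = 0" "\<And>x. x \<notin> K \<Longrightarrow> \<Psi>' x = 0"
    by (rule C1cE[OF \<Psi>]) blast
  have c\<Psi>: "continuous_on UNIV \<Psi>" by (rule continuous_if_has_derivative[OF d])
  have div\<Psi>: "divergence \<Psi> x = (\<Sum>b\<in>Basis. \<Psi>' x b \<bullet> b)" for x by (rule divergence_eq[OF d])
  have cdiv: "continuous_on UNIV (divergence \<Psi>)" unfolding div\<Psi>[abs_def] by (intro continuous_intros c)
  have [measurable]: "\<Psi> \<in> borel_measurable borel" "divergence \<Psi> \<in> borel_measurable borel"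
    using c\<Psi> cdiv by (auto intro: borel_measurable_continuous_onI)
  obtain B where B: "0 < B" "\<And>x. norm (\<Psi> x) \<le> B"
    using bounded_if_vanishes_off_compact[OF c\<Psi> K(1,2)] by blast
  obtain L where L: "0 < L" "\<And>x. norm (\<Psi>' x) \<le> L"
    using bounded_if_vanishes_off_compact[OF c K(1,3)] by blast
  have div0: "divergence \<Psi> x = 0" if "x \<notin> K" for x using that K by (simp add: div\<Psi>)
  obtain M where M: "0 < M" "\<And>x. norm (divergence \<Psi> x) \<le> M"
    using bounded_if_vanishes_off_compact[OF cdiv K(1) div0] by blast
  obtain R where R: "0 < R" "\<And>x. x \<in> K \<Longrightarrow> norm x \<le> R"
    using compact_imp_bounded[OF K(1)] bounded_pos by blast
  define e :: "nat \<Rightarrow> real" where "e i = 1 / Suc i" for i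
  have e: "0 < e i" for i by (auto simp: e_def)
  have e0: "e \<longlonglongrightarrow> 0" unfolding e_def by (rule LIMSEQ_inverse_real_of_nat[unfolded inverse_eq_divide])
  define g where "g i z = (z \<bullet> z + e i) powr (- a / 2)" for i and z :: 'a
  define G where "G i z = (z \<bullet> z + e i) powr (- a / 2 - 1)" for i and z :: 'a
  have sq: "(z \<bullet> z) powr t = norm z powr (2 * t)" for z :: 'a and t
  proof (cases "z = 0")
    case False
    then have "z \<bullet> z = norm z powr 2" by (simp add: dot_square_norm)
    then show ?thesis by (simp only: powr_powr)
  qed simp
  have lim: "(\<lambda>i. (z \<bullet> z + e i) powr t) \<longlonglongrightarrow> norm z powr (2 * t)" if "z \<noteq> 0" for z :: 'a and t
  proof -
    have "(\<lambda>i. (z \<bullet> z + e i) powr t) \<longlonglongrightarrow> (z \<bullet> z + 0) powr t"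
      using that by (intro tendsto_intros e0) auto
    then show ?thesis by (simp add: sq)
  qed
  have mono: "(z \<bullet> z + e i) powr t \<le> norm z powr (2 * t)" if "z \<noteq> 0" "t \<le> 0" for z :: 'a and i t
    unfolding sq[symmetric] using that e[of i] by (intro powr_mono2') auto
  define H where "H z = norm z powr - a * divergence \<Psi> (y + z)" for z
  define J where "J z = norm z powr (- a - 2) * (z \<bullet> (\<Psi> (y + z) - \<Psi> y))" for z
  \<comment> \<open>\<open>divergence \<Psi> (y + z)\<close> vanishes unless \<open>y + z\<close> lies in the ball of radius \<open>R\<close>.\<close>
  define wl where "wl z = M * (indicator (cball 0 (R + norm y)) z * norm z powr - a)" for z :: 'a
  have wl: "integrable lborel wl" unfolding wl_def
    by (intro integrable_mult_right integrable_powr_cball) (use a in auto)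
  have gz: "AE z in lborel. norm (g i z * divergence \<Psi> (y + z)) \<le> wl z" for i
    using AE_lborel_singleton[of 0]
  proof eventually_elim
    case (elim z)
    show ?case
    proof (cases "norm z \<le> R + norm y")
      case True
      have "g i z \<le> norm z powr - a" unfolding g_def using mono[OF elim, of "- a / 2" i] a by simp
      moreover have "0 \<le> g i z" by (simp add: g_def)
      ultimately have "norm (g i z * divergence \<Psi> (y + z)) \<le> norm z powr - a * M"
        using M(2)[of "y + z"] by (auto simp: abs_mult intro!: mult_mono)
      then show ?thesis using True by (simp add: wl_def mult.commute)
    next
      case False
      then have "norm (y + z) > R"
        using norm_triangle_ineq4[of "y + z" y] by simp
      then have "divergence \<Psi> (y + z) = 0" using R(2)[of "y + z"] div0 by force
      then show ?thesis using M by (simp add: wl_def)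
    qed
  qed
  have gl: "AE z in lborel. (\<lambda>i. g i z * divergence \<Psi> (y + z)) \<longlonglongrightarrow> H z"
    using AE_lborel_singleton[of 0]
  proof eventually_elim
    case (elim z)
    then show ?case unfolding H_def g_def using lim[OF elim, of "- a / 2"] by (intro tendsto_mult tendsto_const) simp
  qed
  have mg: "(\<lambda>z. g i z * divergence \<Psi> (y + z)) \<in> borel_measurable lborel" "H \<in> borel_measurable lborel" for i
    by (simp_all add: g_def H_def[abs_def])
  have left: "integrable lborel H" "(\<lambda>i. LINT z|lborel. g i z * divergence \<Psi> (y + z)) \<longlonglongrightarrow> (LINT z|lborel. H z)"
    using integrable_dominated_convergence[OF mg(2) mg(1) wl gl gz]
      integral_dominated_convergence[OF mg(2) mg(1) wl gl gz] by auto
  \<comment> \<open>Inside the unit ball the Lipschitz bound for \<open>\<Psi>\<close> is used, outside it the bound \<open>2 * B\<close>.\<close>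
  define wr where "wr z = L * (indicator (cball 0 1) z * norm z powr - a)
      + 2 * B * (indicator (- cball 0 1) z * norm z powr - (a + 1))" for z :: 'a
  have wr: "integrable lborel wr" unfolding wr_def
    by (intro Bochner_Integration.integrable_add integrable_mult_right integrable_powr_cball integrable_powr_outside_cball) (use a in auto)
  have Gz: "AE z in lborel. norm (G i z * (z \<bullet> (\<Psi> (y + z) - \<Psi> y))) \<le> wr z" for i
    using AE_lborel_singleton[of 0]
  proof eventually_elim
    case (elim z)
    have G1: "0 \<le> G i z" "G i z \<le> norm z powr (- a - 2)"
      unfolding G_def using mono[OF elim, of "- a / 2 - 1" i] a by simp_all
    have z: "0 < norm z" using elim by simp
    have "norm (\<Psi> (y + z) - \<Psi> y) \<le> L * norm (y + z - y)" by (rule lipschitz_if_C1c[OF d L(2)])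
    then have 1: "norm (\<Psi> (y + z) - \<Psi> y) \<le> L * norm z" by simp
    have 2: "norm (\<Psi> (y + z) - \<Psi> y) \<le> 2 * B"
      using norm_triangle_ineq4[of "\<Psi> (y + z)" "\<Psi> y"] B(2)[of y] B(2)[of "y + z"] by linarith
    have "norm (G i z * (z \<bullet> (\<Psi> (y + z) - \<Psi> y))) \<le> norm z powr (- a - 2) * (norm z * norm (\<Psi> (y + z) - \<Psi> y))"
      using G1 Cauchy_Schwarz_ineq2[of z "\<Psi> (y + z) - \<Psi> y"] by (auto simp: abs_mult intro!: mult_mono)
    also have "\<dots> \<le> wr z"
    proof (cases "norm z \<le> 1")
      case True
      have "norm z powr (- a - 2) * (norm z * norm (\<Psi> (y + z) - \<Psi> y)) \<le> norm z powr (- a - 2) * (norm z * (L * norm z))"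
        using 1 by (intro mult_left_mono) auto
      also have "\<dots> = L * norm z powr - a"
        using z by (simp add: powr_diff powr_realpow[of _ 2, simplified] power2_eq_square)
      finally show ?thesis using True by (simp add: wr_def)
    next
      case False
      have "norm z powr (- a - 2) * (norm z * norm (\<Psi> (y + z) - \<Psi> y)) \<le> norm z powr (- a - 2) * (norm z * (2 * B))"
        using 2 by (intro mult_left_mono) auto
      also have "\<dots> = 2 * B * (norm z powr (- a - 2) * norm z powr 1)"
        using z by simp
      also have "\<dots> = 2 * B * norm z powr - (a + 1)"
        by (simp only: powr_add[symmetric]) (simp add: algebra_simps)
      finally show ?thesis using False by (simp add: wr_def)
    qed
    finally show ?case .
  qed
  have Gl: "AE z in lborel. (\<lambda>i. G i z * (z \<bullet> (\<Psi> (y + z) - \<Psi> y))) \<longlonglongrightarrow> J z"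
    using AE_lborel_singleton[of 0]
  proof eventually_elim
    case (elim z)
    then show ?case unfolding J_def G_def using lim[OF elim, of "- a / 2 - 1"]
      by (intro tendsto_mult tendsto_const) simp
  qed
  have mG: "(\<lambda>z. G i z * (z \<bullet> (\<Psi> (y + z) - \<Psi> y))) \<in> borel_measurable lborel" "J \<in> borel_measurable lborel" for i
    by (simp_all add: G_def J_def[abs_def])
  have right: "(\<lambda>i. LINT z|lborel. G i z * (z \<bullet> (\<Psi> (y + z) - \<Psi> y))) \<longlonglongrightarrow> (LINT z|lborel. J z)"
    and Gint: "integrable lborel (\<lambda>z. G i z * (z \<bullet> (\<Psi> (y + z) - \<Psi> y)))" for i
    using integrable_dominated_convergence2[OF mG(2) mG(1) wr Gl Gz]
      integral_dominated_convergence[OF mG(2) mG(1) wr Gl Gz] by auto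
  have "(LINT z|lborel. g i z * divergence \<Psi> (y + z)) = a * (LINT z|lborel. G i z * (z \<bullet> (\<Psi> (y + z) - \<Psi> y)))" for i
  proof -
    have cG: "continuous_on UNIV (G i)"
    proof -
      have "z \<bullet> z + e i \<noteq> 0" for z :: 'a using e[of i] inner_ge_zero[of z] by linarith
      then show ?thesis unfolding G_def[abs_def] by (auto intro!: continuous_intros)
    qed
    have "integrable lborel (\<lambda>x. G i (x - y) * ((x - y) \<bullet> \<Psi> x))"
      by (rule integrable_if_vanishes_off_compact[OF _ K(1)])
        (auto simp: K(2) intro!: continuous_intros c\<Psi> continuous_on_compose2[OF cG])
    from integrable_lborel_translate[OF this, of y]
    have i1: "integrable lborel (\<lambda>z. G i z * (z \<bullet> \<Psi> (y + z)))" by simp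
    have "(\<lambda>z. G i z * (z \<bullet> \<Psi> y)) = (\<lambda>z. G i z * (z \<bullet> \<Psi> (y + z)) - G i z * (z \<bullet> (\<Psi> (y + z) - \<Psi> y)))"
      by (auto simp: fun_eq_iff inner_diff_right algebra_simps)
    then have i2: "integrable lborel (\<lambda>z. G i z * (z \<bullet> \<Psi> y))"
      using Bochner_Integration.integrable_diff[OF i1 Gint] by simp
    \<comment> \<open>\<open>z \<mapsto> G i z *\<^sub>R z\<close> is odd\<close>
    have "(LINT z|lborel. G i (- z) * (- z \<bullet> \<Psi> y)) = (LINT z|lborel. G i z * (z \<bullet> \<Psi> y))"
      by (rule integral_lborel_reflect) (simp add: G_def)
    then have odd: "(LINT z|lborel. G i z * (z \<bullet> \<Psi> y)) = 0" by (simp add: G_def)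
    have "(LINT z|lborel. G i z * (z \<bullet> (\<Psi> (y + z) - \<Psi> y)))
        = (LINT z|lborel. G i z * (z \<bullet> \<Psi> (y + z)) - G i z * (z \<bullet> \<Psi> y))"
      by (simp add: inner_diff_right algebra_simps)
    also have "\<dots> = (LINT z|lborel. G i z * (z \<bullet> \<Psi> (y + z)))"
      using Bochner_Integration.integral_diff[OF i1 i2] odd by simp
    finally show ?thesis
      using regularized_kernel_by_parts[OF \<Psi> e, where a=a and y=y] by (simp add: g_def G_def)
  qed
  then have "(\<lambda>i. LINT z|lborel. g i z * divergence \<Psi> (y + z)) \<longlonglongrightarrow> a * (LINT z|lborel. J z)"
    using tendsto_mult_left[OF right, of a] by simp
  then have eq: "(LINT z|lborel. H z) = a * (LINT z|lborel. J z)"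
    using left(2) LIMSEQ_unique by blast
  show ?I using left(1) by (simp add: H_def[abs_def])
  have "J z = ((\<Psi> (y + z) - \<Psi> y) \<bullet> z) / norm z powr (real DIM('a) + s + 1)" for z
  proof -
    have "- a - 2 = - (real DIM('a) + s + 1)" by (simp add: a_def)
    then show ?thesis by (simp only: J_def powr_minus_divide inner_commute) simp
  qed
  then show ?E using eq by (simp add: H_def)
qed

text \<open>
  The mean value theorem for \<open>t \<mapsto> t powr - a\<close>, whose derivative decreases in absolute value.
\<close>

lemma powr_diff_bound:
  fixes p q m a :: real
  assumes "0 < m" "m \<le> p" "m \<le> q" "0 \<le> a"
  shows "\<bar>p powr - a - q powr - a\<bar> \<le> a * m powr - (a + 1) * \<bar>p - q\<bar>"
proof -
  have *: "\<bar>q powr - a - p powr - a\<bar> \<le> a * m powr - (a + 1) * (q - p)" if "p < q" "m \<le> p" for p q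
  proof -
    have "DERIV (\<lambda>t. t powr - a) t :> - a * t powr (- a - 1)" if "p \<le> t" "t \<le> q" for t
      using that \<open>m \<le> p\<close> assms(1) by (intro has_real_derivative_powr) simp
    from MVT2[OF \<open>p < q\<close> this] obtain t where t: "p < t" "t < q"
      "q powr - a - p powr - a = (q - p) * (- a * t powr (- a - 1))" by blast
    have "t powr (- a - 1) \<le> m powr (- a - 1)"
      using t that assms by (intro powr_mono2') auto
    then have "\<bar>q powr - a - p powr - a\<bar> \<le> (q - p) * (a * m powr (- a - 1))"
      unfolding t(3) using that assms by (auto simp: abs_mult intro!: mult_left_mono)
    also have "(q - p) * (a * m powr (- a - 1)) = a * m powr (- a - 1) * (q - p)"
      by (simp only: mult_ac)
    also have "- a - 1 = - (a + 1)" by simp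
    finally show ?thesis .
  qed
  show ?thesis
  proof (cases p q rule: linorder_cases)
    case less
    then show ?thesis using *[OF less assms(2)] by (simp only: abs_minus_commute) simp
  next
    case greater
    then show ?thesis using *[OF greater assms(3)] by simp
  qed simp
qed

text \<open>
  The integrand is estimated by both kernels separately for \<open>y\<close> in the ball of radius \<open>2 * R\<close>, and by the mean
  value theorem outside it, where the decay improves by one power. The condition \<open>a < DIM('a)\<close> serves
  the first region and \<open>DIM('a) < a + 1\<close> the second; the bound is uniform in \<open>x\<close>.
\<close>

lemma kernel_difference_integrable:
  fixes a R :: real
  assumes a: "0 < a" "a < DIM('a::euclidean_space)" "DIM('a) < a + 1" and R: "0 < R"
  obtains C where "0 \<le> C"
    "\<And>x::'a. norm x \<le> R \<Longrightarrow> integrable lborel (\<lambda>y. norm (x - y) powr - a - norm y powr - a)"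
    "\<And>x::'a. norm x \<le> R \<Longrightarrow> (LINT y|lborel. \<bar>norm (x - y) powr - a - norm y powr - a\<bar>) \<le> C"
proof -
  \<comment> \<open>\<open>norm y \<le> 2 * R\<close> and \<open>norm x \<le> R\<close> imply \<open>norm (x - y) \<le> 3 * R\<close>; outside, both norms are at least
    \<open>norm y / 2\<close>, which explains the factor \<open>2 powr (a + 1)\<close> in \<open>h\<close>.\<close>
  define f where "f r z = indicator (cball 0 r) z * norm z powr - a" for r and z :: 'a
  define h where "h z = a * 2 powr (a + 1) * R * (indicator (- cball 0 (2 * R)) z * norm z powr - (a + 1))" for z :: 'a
  have f: "integrable lborel (f r)" for r
    unfolding f_def using a by (intro integrable_powr_cball) auto
  have h: "integrable lborel h"
    unfolding h_def using a R by (intro integrable_mult_right integrable_powr_outside_cball) auto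
  have f0: "0 \<le> f r z" and h0: "0 \<le> h z" for r z using a R by (auto simp: f_def h_def)
  define C where "C = (LINT z|lborel. f (3 * R) z) + (LINT z|lborel. f (2 * R) z) + (LINT z|lborel. h z)"
  have C: "0 \<le> C" unfolding C_def using f0 h0 by (intro add_nonneg_nonneg integral_nonneg_AE) auto
  have bound: "\<bar>norm (x - y) powr - a - norm y powr - a\<bar> \<le> f (3 * R) (- x + y) + f (2 * R) y + h y"
    if x: "norm x \<le> R" for x y :: 'a
  proof (cases "norm y \<le> 2 * R")
    case True
    have "norm (y - x) \<le> 3 * R" using norm_triangle_ineq4[of y x] True x by linarith
    then have "f (3 * R) (- x + y) = norm (x - y) powr - a"
      by (simp add: f_def norm_minus_commute)
    moreover have "f (2 * R) y = norm y powr - a" using True by (simp add: f_def)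
    moreover have "\<bar>norm (x - y) powr - a - norm y powr - a\<bar> \<le> norm (x - y) powr - a + norm y powr - a"
      using powr_ge_zero[of "norm (x - y)" "- a"] powr_ge_zero[of "norm y" "- a"] by linarith
    ultimately show ?thesis using h0[of y] by linarith
  next
    case False
    have n: "\<bar>norm (x - y) - norm y\<bar> \<le> norm x"
      using norm_triangle_ineq3[of "y - x" y] by (simp add: norm_minus_commute)
    have "\<bar>norm (x - y) powr - a - norm y powr - a\<bar>
        \<le> a * (norm y / 2) powr - (a + 1) * \<bar>norm (x - y) - norm y\<bar>"
      by (rule powr_diff_bound) (use False x n a R in linarith)+
    also have "\<dots> \<le> a * (norm y / 2) powr - (a + 1) * R"
      using n x a by (intro mult_left_mono) auto
    also have "(norm y / 2) powr - (a + 1) = 2 powr (a + 1) * norm y powr - (a + 1)"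
      by (simp only: powr_divide powr_minus[of 2 "a + 1"]) (simp only: divide_inverse inverse_inverse_eq mult.commute)
    also have "a * (2 powr (a + 1) * norm y powr - (a + 1)) * R = h y" using False by (simp add: h_def)
    finally show ?thesis using f0[of "3 * R" "- x + y"] f0[of "2 * R" y] by linarith
  qed
  show thesis
  proof (rule that[OF C])
    fix x :: 'a assume x: "norm x \<le> R"
    have dom: "integrable lborel (\<lambda>y. f (3 * R) (- x + y) + f (2 * R) y + h y)"
      by (intro Bochner_Integration.integrable_add integrable_lborel_translate f h)
    have m: "(\<lambda>y. norm (x - y) powr - a - norm y powr - a) \<in> borel_measurable lborel" by measurable
    have i: "integrable lborel (\<lambda>y. norm (x - y) powr - a - norm y powr - a)"
      by (rule Bochner_Integration.integrable_bound[OF dom m], rule AE_I2)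
        (use bound[OF x] in \<open>simp only: real_norm_def, smt (verit) f0 h0\<close>)
    then show "integrable lborel (\<lambda>y. norm (x - y) powr - a - norm y powr - a)" .
    have "(LINT y|lborel. \<bar>norm (x - y) powr - a - norm y powr - a\<bar>)
        \<le> (LINT y|lborel. f (3 * R) (- x + y) + f (2 * R) y + h y)"
      by (rule integral_mono[OF integrable_abs[OF i] dom bound[OF x]])
    also have "\<dots> = (LINT y|lborel. f (3 * R) (- x + y)) + (LINT z|lborel. f (2 * R) z) + (LINT z|lborel. h z)"
      by (simp only: Bochner_Integration.integral_add[OF Bochner_Integration.integrable_add[OF integrable_lborel_translate[OF f] f] h]
        Bochner_Integration.integral_add[OF integrable_lborel_translate[OF f] f])
    also have "(LINT y|lborel. f (3 * R) (- x + y)) = (LINT z|lborel. f (3 * R) z)"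
      using f[of "3 * R"] by (intro integral_lborel_translate) auto
    finally show "(LINT y|lborel. \<bar>norm (x - y) powr - a - norm y powr - a\<bar>) \<le> C" by (simp add: C_def)
  qed
qed

lemma frac_div_eq_potential:
  fixes \<Psi> :: "'a::euclidean_space \<Rightarrow> 'a" and s :: real
  assumes \<Psi>: "\<Psi> \<in> C1c UNIV" and s: "0 < s" "s < 1"
  defines "a \<equiv> real DIM('a) + s - 1"
  shows "integrable lborel (\<lambda>x. norm (x - y) powr - a * divergence \<Psi> x)"
    and "frac_div s \<Psi> y = frac_const DIM('a) s / a * (LINT x|lborel. norm (x - y) powr - a * divergence \<Psi> x)"
proof -
  have D: "real DIM('a) \<ge> 1" by simp
  have a: "0 < a" using s D unfolding a_def by linarith
  obtain K where "continuous_on UNIV (divergence \<Psi>)" by (rule C1c_divergence[OF \<Psi>])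
  then have [measurable]: "divergence \<Psi> \<in> borel_measurable borel" by (rule borel_measurable_continuous_onI)
  obtain \<Psi>' K where "\<And>x. (\<Psi> has_derivative blinfun_apply (\<Psi>' x)) (at x)" by (rule C1cE[OF \<Psi>]) blast
  then have "continuous_on UNIV \<Psi>" by (rule continuous_if_has_derivative)
  then have [measurable]: "\<Psi> \<in> borel_measurable borel" by (rule borel_measurable_continuous_onI)
  show "integrable lborel (\<lambda>x. norm (x - y) powr - a * divergence \<Psi> x)"
    using integrable_lborel_translate[OF riesz_kernel_by_parts(1)[OF \<Psi> s, of y], of "- y"]
    by (simp add: a_def)
  have "(LINT x|lebesgue. ((\<Psi> x - \<Psi> y) \<bullet> (x - y)) / norm (x - y) powr (real DIM('a) + s + 1))
      = (LINT x|lborel. ((\<Psi> x - \<Psi> y) \<bullet> (x - y)) / norm (x - y) powr (real DIM('a) + s + 1))"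
    by (rule integral_completion) measurable
  also have "\<dots> = (LINT z|lborel. ((\<Psi> (y + z) - \<Psi> y) \<bullet> z) / norm z powr (real DIM('a) + s + 1))"
    using integral_lborel_translate[of "\<lambda>x. ((\<Psi> x - \<Psi> y) \<bullet> (x - y)) / norm (x - y) powr (real DIM('a) + s + 1)" y]
    by simp
  also have "\<dots> = (LINT z|lborel. norm z powr - a * divergence \<Psi> (y + z)) / a"
    using riesz_kernel_by_parts(2)[OF \<Psi> s, of y] a by (simp add: a_def)
  also have "(LINT z|lborel. norm z powr - a * divergence \<Psi> (y + z))
      = (LINT x|lborel. norm (x - y) powr - a * divergence \<Psi> x)"
    using integral_lborel_translate[of "\<lambda>x. norm (x - y) powr - a * divergence \<Psi> x" y] by simp
  finally show "frac_div s \<Psi> y = frac_const DIM('a) s / a * (LINT x|lborel. norm (x - y) powr - a * divergence \<Psi> x)"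
    by (simp add: frac_div_def)
qed

text \<open>
  Fubini's theorem is applied to products of Borel measures, so a Lebesgue measurable bounded function is
  replaced by a Borel function that agrees with it almost everywhere and is bounded everywhere.
\<close>

lemma Linfty_borel_version:
  fixes u :: "'a::euclidean_space \<Rightarrow> real"
  assumes "u \<in> Linfty"
  obtains v C where "v \<in> borel_measurable borel" "0 \<le> C" "\<And>x. \<bar>v x\<bar> \<le> C" "AE x in lebesgue. u x = v x"
proof -
  obtain v0 C0 where v0: "v0 \<in> borel_measurable lborel" "AE x in lborel. u x = v0 x"
    and C0: "AE x in lebesgue. \<bar>u x\<bar> \<le> C0"
    using assms completion_ex_borel_measurable_real[of u lborel] by (auto simp: Linfty_def)
  define v where "v x = max (- \<bar>C0\<bar>) (min \<bar>C0\<bar> (v0 x))" for x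
  show thesis
  proof (rule that)
    show "v \<in> borel_measurable borel" using v0(1) unfolding v_def[abs_def] by measurable
    show "0 \<le> \<bar>C0\<bar>" by simp
    show "\<bar>v x\<bar> \<le> \<bar>C0\<bar>" for x by (auto simp: v_def)
    show "AE x in lebesgue. u x = v x"
      using AE_completion[OF v0(2)] C0 by eventually_elim (auto simp: v_def)
  qed
qed

text \<open>
  Subtracting \<open>k y\<close> from the kernel \<open>k (x - y)\<close> makes the potential of a bounded function converge, and
  it goes unnoticed by the duality because \<open>divergence \<Psi>\<close> has integral \<open>0\<close>.
\<close>

proposition frac_div_dual_potential:
  fixes u :: "'a::euclidean_space \<Rightarrow> real" and s :: real
  assumes s: "0 < s" "s < 1" and u: "u \<in> Linfty"
  obtains w where "w \<in> borel_measurable borel"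
    "\<And>R. \<exists>C. \<forall>x. norm x \<le> R \<longrightarrow> \<bar>w x\<bar> \<le> C"
    "\<And>\<Psi>. \<Psi> \<in> C1c UNIV \<Longrightarrow>
      (LINT x|lborel. w x * divergence \<Psi> x) = (LINT y|lebesgue. u y * frac_div s \<Psi> y)"
proof -
  define a where "a = real DIM('a) + s - 1"
  have D: "real DIM('a) \<ge> 1" by simp
  have a: "0 < a" "a < DIM('a)" "DIM('a) < a + 1" using s D unfolding a_def by linarith+
  obtain v C where v[measurable]: "v \<in> borel_measurable borel" and C: "0 \<le> C" "\<And>x. \<bar>v x\<bar> \<le> C"
    and uv: "AE x in lebesgue. u x = v x" by (rule Linfty_borel_version[OF u]) blast
  define c where "c = frac_const DIM('a) s / a"
  define k where "k x y = norm (x - y) powr - a - norm y powr - a" for x y :: 'a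
  have [measurable]: "(\<lambda>(x, y). k x y) \<in> borel_measurable (borel \<Otimes>\<^sub>M borel)"
    "k x \<in> borel_measurable borel" "(\<lambda>x. k x y) \<in> borel_measurable borel" for x y
    unfolding k_def by measurable
  define w where "w x = c * (LINT y|lborel. v y * k x y)" for x
  have w[measurable]: "w \<in> borel_measurable borel"
    unfolding w_def[abs_def] by measurable
  have bd: "\<exists>B\<ge>0. \<forall>x. norm x \<le> R \<longrightarrow> integrable lborel (\<lambda>y. v y * k x y)
      \<and> (LINT y|lborel. \<bar>v y * k x y\<bar>) \<le> B" for R
  proof -
    obtain B where B: "0 \<le> B" "\<And>x. norm x \<le> max R 1 \<Longrightarrow> integrable lborel (k x)"
      "\<And>x. norm x \<le> max R 1 \<Longrightarrow> (LINT y|lborel. \<bar>k x y\<bar>) \<le> B"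
      by (rule kernel_difference_integrable[OF a, of "max R 1"]) (auto simp: k_def[abs_def])
    have "integrable lborel (\<lambda>y. v y * k x y) \<and> (LINT y|lborel. \<bar>v y * k x y\<bar>) \<le> C * B" if "norm x \<le> R" for x
    proof -
      have x: "norm x \<le> max R 1" using that by simp
      have i: "integrable lborel (\<lambda>y. C * \<bar>k x y\<bar>)" by (intro integrable_mult_right integrable_abs B x)
      have le: "\<bar>v y * k x y\<bar> \<le> C * \<bar>k x y\<bar>" for y by (simp add: abs_mult C mult_right_mono)
      have i2: "integrable lborel (\<lambda>y. v y * k x y)"
        by (rule Bochner_Integration.integrable_bound[OF i]) (use le in \<open>auto intro!: AE_I2 simp: abs_mult C(1)\<close>)
      have "(LINT y|lborel. \<bar>v y * k x y\<bar>) \<le> (LINT y|lborel. C * \<bar>k x y\<bar>)"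
        by (rule integral_mono[OF integrable_abs[OF i2] i le])
      also have "\<dots> \<le> C * B" using B(3)[OF x] C(1) by (simp add: mult_left_mono)
      finally show ?thesis using i2 by simp
    qed
    then show ?thesis using B(1) C(1) by (intro exI[of _ "C * B"]) auto
  qed
  show thesis
  proof (rule that[OF w])
    fix R
    obtain B where B: "\<And>x. norm x \<le> R \<Longrightarrow> integrable lborel (\<lambda>y. v y * k x y)
      \<and> (LINT y|lborel. \<bar>v y * k x y\<bar>) \<le> B" using bd[of R] by blast
    have "\<bar>w x\<bar> \<le> \<bar>c\<bar> * B" if "norm x \<le> R" for x
      using integral_abs_bound[of lborel "\<lambda>y. v y * k x y"] B[OF that]
      unfolding w_def abs_mult by (intro mult_left_mono) auto
    then show "\<exists>C. \<forall>x. norm x \<le> R \<longrightarrow> \<bar>w x\<bar> \<le> C" by blast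
  next
    fix \<Psi> :: "'a \<Rightarrow> 'a" assume \<Psi>: "\<Psi> \<in> C1c UNIV"
    obtain K where cd: "continuous_on UNIV (divergence \<Psi>)" and K: "compact K"
      "\<And>x. x \<notin> K \<Longrightarrow> divergence \<Psi> x = 0" by (rule C1c_divergence[OF \<Psi>]) blast
    have [measurable]: "divergence \<Psi> \<in> borel_measurable borel"
      using cd by (rule borel_measurable_continuous_onI)
    have id: "integrable lborel (divergence \<Psi>)" and d0: "(LINT x|lborel. divergence \<Psi> x) = 0"
      using integral_divergence_eq_0[OF \<Psi>] by auto
    obtain R where R: "\<And>x. x \<in> K \<Longrightarrow> norm x \<le> R"
      using compact_imp_bounded[OF K(1)] bounded_pos by blast
    obtain B where B: "0 \<le> B" "\<And>x. norm x \<le> R \<Longrightarrow> integrable lborel (\<lambda>y. v y * k x y)"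
      "\<And>x. norm x \<le> R \<Longrightarrow> (LINT y|lborel. \<bar>v y * k x y\<bar>) \<le> B" using bd[of R] by blast
    define F where "F x y = v y * k x y * divergence \<Psi> x" for x y
    have Fint: "integrable lborel (\<lambda>y. F x y)" for x
      using B(2)[of x] R[of x] K(2)[of x] by (cases "x \<in> K") (auto simp: F_def)
    have Fb: "(LINT y|lborel. norm (F x y)) \<le> B * \<bar>divergence \<Psi> x\<bar>" for x
      using B(3)[of x] R[of x] K(2)[of x]
      by (cases "x \<in> K") (auto simp: F_def abs_mult[of _ "divergence \<Psi> x"] intro!: mult_right_mono)
    have [measurable]: "(\<lambda>(x, y). F x y) \<in> borel_measurable (borel \<Otimes>\<^sub>M borel)"
      unfolding F_def by measurable
    have Fpair: "integrable (lborel \<Otimes>\<^sub>M lborel) (\<lambda>(x, y). F x y)"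
    proof (rule lborel_pair.Fubini_integrable)
      have "integrable lborel (\<lambda>x. LINT y|lborel. norm (F x y))"
      proof (rule Bochner_Integration.integrable_bound)
        show "integrable lborel (\<lambda>x. B * \<bar>divergence \<Psi> x\<bar>)"
          by (intro integrable_mult_right integrable_abs id)
        show "AE x in lborel. norm (LINT y|lborel. norm (F x y)) \<le> norm (B * \<bar>divergence \<Psi> x\<bar>)"
          using Fb B(1) by (intro AE_I2) (simp add: abs_mult)
      qed measurable
      then show "integrable lborel (\<lambda>x. LINT y|lborel. norm (case (x, y) of (x, y) \<Rightarrow> F x y))" by simp
    qed (use Fint in auto)
    have inner: "(LINT x|lborel. F x y) = v y * (LINT x|lborel. norm (x - y) powr - a * divergence \<Psi> x)" for y
    proof -
      have i1: "integrable lborel (\<lambda>x. norm (x - y) powr - a * divergence \<Psi> x)"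
        unfolding a_def by (rule frac_div_eq_potential(1)[OF \<Psi> s])
      have i2: "integrable lborel (\<lambda>x. norm y powr - a * divergence \<Psi> x)"
        by (intro integrable_mult_right id)
      have "(LINT x|lborel. F x y)
          = (LINT x|lborel. v y * (norm (x - y) powr - a * divergence \<Psi> x - norm y powr - a * divergence \<Psi> x))"
        unfolding F_def k_def by (intro Bochner_Integration.integral_cong) (simp_all add: algebra_simps)
      also have "\<dots> = v y * (LINT x|lborel. norm (x - y) powr - a * divergence \<Psi> x)"
        by (simp add: Bochner_Integration.integral_diff[OF i1 i2] d0)
      finally show ?thesis .
    qed
    have "w x * divergence \<Psi> x = c * (LINT y|lborel. F x y)" for x
      unfolding w_def F_def Bochner_Integration.integral_mult_left_zero by (rule mult.assoc)
    then have "(LINT x|lborel. w x * divergence \<Psi> x) = c * (LINT x|lborel. LINT y|lborel. F x y)"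
      by simp
    also have "(LINT x|lborel. LINT y|lborel. F x y) = (LINT y|lborel. LINT x|lborel. F x y)"
      using lborel_pair.Fubini_integral[OF Fpair] by simp
    also have "c * \<dots> = (LINT y|lborel. v y * frac_div s \<Psi> y)"
      by (simp add: inner frac_div_eq_potential(2)[OF \<Psi> s] c_def a_def mult_ac
          flip: Bochner_Integration.integral_mult_right_zero)
    also have "\<dots> = (LINT y|lebesgue. v y * frac_div s \<Psi> y)"
      unfolding frac_div_eq_potential(2)[OF \<Psi> s]
      by (rule integral_completion[symmetric]) measurable
    also have "\<dots> = (LINT y|lebesgue. u y * frac_div s \<Psi> y)"
    proof -
      have m: "(\<lambda>y. frac_div s \<Psi> y) \<in> borel_measurable lborel"
        unfolding frac_div_eq_potential(2)[OF \<Psi> s] by measurable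
      have "u \<in> borel_measurable lebesgue" using u by (simp add: Linfty_def)
      then have "(\<lambda>y. u y * frac_div s \<Psi> y) \<in> borel_measurable lebesgue"
        using measurable_completion[OF m] by (intro borel_measurable_times) auto
      moreover have "(\<lambda>y. v y * frac_div s \<Psi> y) \<in> borel_measurable lebesgue"
        using measurable_completion[of v lborel borel] measurable_completion[OF m] v
        by (intro borel_measurable_times) auto
      ultimately show ?thesis
        by (intro integral_cong_AE) (use uv in \<open>auto\<close>)
    qed
    finally show "(LINT x|lborel. w x * divergence \<Psi> x) = (LINT y|lebesgue. u y * frac_div s \<Psi> y)" .
  qed
qed

section \<open>Positive functionals on compactly supported continuous functions\<close>

definition Cc :: "'a::euclidean_space set \<Rightarrow> ('a \<Rightarrow> real) set" where
  "Cc \<Omega> = {f. continuous_on UNIV f \<and> (\<exists>K. compact K \<and> K \<subseteq> \<Omega> \<and> (\<forall>x. x \<notin> K \<longrightarrow> f x = 0))}"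

lemma CcI: "continuous_on UNIV f \<Longrightarrow> compact K \<Longrightarrow> K \<subseteq> \<Omega> \<Longrightarrow> (\<And>x. x \<notin> K \<Longrightarrow> f x = 0) \<Longrightarrow> f \<in> Cc \<Omega>"
  by (auto simp: Cc_def)

lemma Cc_cont: "f \<in> Cc \<Omega> \<Longrightarrow> continuous_on UNIV f"
  by (simp add: Cc_def)

text \<open>
  Closure of \<open>Cc \<Omega>\<close> under all the pointwise operations needed below comes from this one fact.
\<close>

lemma Cc_if_vanishes_jointly:
  assumes "f \<in> Cc \<Omega>" "g \<in> Cc \<Omega>" "continuous_on UNIV h" "\<And>x. f x = 0 \<Longrightarrow> g x = 0 \<Longrightarrow> h x = 0"
  shows "h \<in> Cc \<Omega>"
proof -
  obtain K L where K: "compact K" "K \<subseteq> \<Omega>" "\<And>x. x \<notin> K \<Longrightarrow> f x = 0"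
    and L: "compact L" "L \<subseteq> \<Omega>" "\<And>x. x \<notin> L \<Longrightarrow> g x = 0" using assms(1,2) by (auto simp: Cc_def)
  show ?thesis by (rule CcI[of _ "K \<union> L"]) (use assms K L in auto)
qed

lemma Cc_zero[simp]: "(\<lambda>_. 0) \<in> Cc \<Omega>"
  by (rule CcI[of _ "{}"]) auto

lemma Cc_closed:
  assumes "f \<in> Cc \<Omega>" "g \<in> Cc \<Omega>"
  shows "(\<lambda>x. f x + g x) \<in> Cc \<Omega>" "(\<lambda>x. f x - g x) \<in> Cc \<Omega>"
    "(\<lambda>x. max (f x) (g x)) \<in> Cc \<Omega>" "(\<lambda>x. min (f x) (g x)) \<in> Cc \<Omega>"
  by (auto intro!: Cc_if_vanishes_jointly[OF assms] continuous_intros Cc_cont[OF assms(1)] Cc_cont[OF assms(2)])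

lemma Cc_scale: "f \<in> Cc \<Omega> \<Longrightarrow> (\<lambda>x. c * f x) \<in> Cc \<Omega>"
  by (rule Cc_if_vanishes_jointly[of f \<Omega> f]) (auto intro!: continuous_intros dest: Cc_cont)

lemma Cc_sum: "finite A \<Longrightarrow> (\<And>i. i \<in> A \<Longrightarrow> f i \<in> Cc \<Omega>) \<Longrightarrow> (\<lambda>x. \<Sum>i\<in>A. f i x) \<in> Cc \<Omega>"
  by (induction A rule: finite_induct) (auto intro!: Cc_closed)

lemma Cc_bounded:
  assumes "f \<in> Cc \<Omega>"
  obtains c where "0 < c" "\<And>x. \<bar>f x\<bar> \<le> c"
proof -
  obtain K where K: "continuous_on UNIV f" "compact K" "\<And>x. x \<notin> K \<Longrightarrow> f x = 0"
    using assms by (auto simp: Cc_def)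
  show thesis using bounded_if_vanishes_off_compact[OF K] that by auto
qed

text \<open>
  Dini's theorem in the form that turns pointwise monotone convergence into the convergence of a functional
  that is bounded in the supremum norm.
\<close>

lemma Dini:
  fixes r :: "nat \<Rightarrow> 'a::euclidean_space \<Rightarrow> real"
  assumes r: "\<And>n. continuous_on UNIV (r n)" "\<And>n x. r (Suc n) x \<le> r n x"
    and lim: "\<And>x. (\<lambda>n. r n x) \<longlonglongrightarrow> 0"
    and K: "compact K" "\<And>n x. x \<notin> K \<Longrightarrow> r n x = 0" and \<epsilon>: "0 < \<epsilon>"
  shows "\<exists>N. \<forall>n\<ge>N. \<forall>x. r n x \<le> \<epsilon>"
proof -
  have mono: "r n x \<le> r m x" if "m \<le> n" for m n x
    using lift_Suc_antimono_le[of "\<lambda>n. r n x", OF r(2) that] .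
  have "K \<subseteq> (\<Union>n\<in>UNIV. {x. r n x < \<epsilon>})"
  proof
    fix x
    obtain n where "r n x < \<epsilon>"
      using order_tendstoD(2)[OF lim[of x] \<epsilon>] unfolding eventually_sequentially by blast
    then show "x \<in> (\<Union>n\<in>UNIV. {x. r n x < \<epsilon>})" by blast
  qed
  moreover have "open {x. r n x < \<epsilon>}" for n
    by (intro open_Collect_less r continuous_intros)
  ultimately obtain N where N: "finite N" "K \<subseteq> (\<Union>n\<in>N. {x. r n x < \<epsilon>})"
    using compactE_image[OF K(1), of UNIV "\<lambda>n. {x. r n x < \<epsilon>}"] by force
  have "r n x \<le> \<epsilon>" if "n \<ge> Max (insert 0 N)" for n x
  proof (cases "x \<in> K")
    case True
    then obtain m where "m \<in> N" "r m x < \<epsilon>" using N by blast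
    moreover have "m \<le> n" using \<open>m \<in> N\<close> N(1) that Max_ge[of "insert 0 N" m] by simp
    ultimately show ?thesis using mono[of m n x] by linarith
  qed (use K \<epsilon> in simp)
  then show ?thesis by blast
qed

text \<open>
  Only nonnegative functions occur, so that the positive part of a functional, defined as a supremum, can be
  used directly. The constant \<open>C\<close> bounds the total mass of the representing measure.
\<close>

locale positive_functional =
  fixes \<Omega> :: "'a::euclidean_space set" and I :: "('a \<Rightarrow> real) \<Rightarrow> real" and C :: real
  assumes open_domain: "open \<Omega>" and bounded_domain: "bounded \<Omega>"
    and additive: "\<And>f g. f \<in> Cc \<Omega> \<Longrightarrow> g \<in> Cc \<Omega> \<Longrightarrow> (\<And>x. 0 \<le> f x) \<Longrightarrow> (\<And>x. 0 \<le> g x)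
      \<Longrightarrow> I (\<lambda>x. f x + g x) = I f + I g"
    and homogeneous: "\<And>c f. 0 \<le> c \<Longrightarrow> f \<in> Cc \<Omega> \<Longrightarrow> (\<And>x. 0 \<le> f x) \<Longrightarrow> I (\<lambda>x. c * f x) = c * I f"
    and nonneg: "\<And>f. f \<in> Cc \<Omega> \<Longrightarrow> (\<And>x. 0 \<le> f x) \<Longrightarrow> 0 \<le> I f"
    and bounded_by: "\<And>f c. f \<in> Cc \<Omega> \<Longrightarrow> (\<And>x. 0 \<le> f x) \<Longrightarrow> (\<And>x. f x \<le> c) \<Longrightarrow> I f \<le> C * c"
begin

lemma I_zero: "I (\<lambda>_. 0) = 0"
  using homogeneous[of 0 "\<lambda>_. 0"] by simp

lemma I_sum:
  assumes "finite A" "\<And>i. i \<in> A \<Longrightarrow> f i \<in> Cc \<Omega>" "\<And>i x. i \<in> A \<Longrightarrow> 0 \<le> f i x"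
  shows "I (\<lambda>x. \<Sum>i\<in>A. f i x) = (\<Sum>i\<in>A. I (f i))"
  using assms by (induction A rule: finite_induct) (auto simp: I_zero additive Cc_sum sum_nonneg)

text \<open>
  The remainders of a pointwise convergent series of nonnegative functions with continuous sum decrease to \<open>0\<close>,
  hence uniformly by Dini's theorem, and \<open>I\<close> is bounded in the supremum norm. This is the only
  continuity that the extension to a measure requires.
\<close>

lemma I_countably_additive:
  assumes f: "\<And>n. f n \<in> Cc \<Omega>" "\<And>n x. 0 \<le> f n x" and g: "g \<in> Cc \<Omega>"
    and sums: "\<And>x. (\<lambda>n. f n x) sums g x"
  shows "(\<lambda>n. I (f n)) sums I g"
proof -
  obtain K where K: "compact K" "\<And>x. x \<notin> K \<Longrightarrow> g x = 0" using g by (auto simp: Cc_def)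
  define S where "S n x = (\<Sum>i<n. f i x)" for n x
  define r where "r n x = g x - S n x" for n x
  have S: "S n \<in> Cc \<Omega>" "0 \<le> S n x" for n x
    unfolding S_def[abs_def] using f by (auto intro!: Cc_sum sum_nonneg)
  have S_le: "S n x \<le> g x" for n x
    unfolding S_def using sums[of x] f by (metis sum_le_suminf finite_lessThan sums_iff)
  have r: "r n \<in> Cc \<Omega>" "0 \<le> r n x" for n x
    using S_le[of n x] by (auto simp: r_def[abs_def] intro!: Cc_closed g S)
  have "I g = I (\<lambda>x. S n x + r n x)" for n by (simp add: r_def)
  then have I_r: "I g = I (S n) + I (r n)" for n using additive[of "S n" "r n"] S r by simp
  have I_S: "I (S n) = (\<Sum>i<n. I (f i))" for n
    unfolding S_def[abs_def] using f by (intro I_sum) auto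
  \<comment> \<open>\<open>C\<close> itself may be \<open>0\<close>, and \<open>e\<close> is divided by this constant.\<close>
  define C' where "C' = max 1 C"
  have "(\<lambda>n. I (r n)) \<longlonglongrightarrow> 0"
  proof (rule LIMSEQ_I)
    fix e :: real assume e: "0 < e"
    have "\<exists>N. \<forall>n\<ge>N. \<forall>x. r n x \<le> e / (2 * C')"
    proof (rule Dini[OF _ _ _ K(1)])
      show "continuous_on UNIV (r n)" for n using r Cc_cont by blast
      show "r (Suc n) x \<le> r n x" for n x using f by (simp add: r_def S_def)
      show "(\<lambda>n. r n x) \<longlonglongrightarrow> 0" for x
        using tendsto_diff[OF tendsto_const[of "g x"] sums[of x, unfolded sums_def]] by (simp add: r_def S_def)
      show "r n x = 0" if "x \<notin> K" for n x
        using K(2)[OF that] S_le[of n x] S(2)[of n x] by (simp add: r_def)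
      show "0 < e / (2 * C')" using e by (simp add: C'_def)
    qed
    then obtain N where N: "\<And>n x. N \<le> n \<Longrightarrow> r n x \<le> e / (2 * C')" by blast
    have "norm (I (r n) - 0) < e" if "N \<le> n" for n
    proof -
      have "I (r n) \<le> C * (e / (2 * C'))" by (rule bounded_by) (use r N[OF that] in auto)
      also have "\<dots> \<le> C' * (e / (2 * C'))" using e by (intro mult_right_mono) (auto simp: C'_def)
      also have "\<dots> = e / 2" by (simp add: C'_def)
      finally show ?thesis using e nonneg[of "r n"] r by simp
    qed
    then show "\<exists>N. \<forall>n\<ge>N. norm (I (r n) - 0) < e" by blast
  qed
  then have "(\<lambda>n. I g - I (r n)) \<longlonglongrightarrow> I g - 0" by (intro tendsto_diff tendsto_const)
  moreover have "I g - I (r n) = (\<Sum>i<n. I (f i))" for n using I_r[of n] I_S[of n] by simp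
  ultimately show ?thesis unfolding sums_def by simp
qed

definition idx :: "(('a \<Rightarrow> real) \<times> ('a \<Rightarrow> real)) set" where
  "idx = {(f, g). f \<in> Cc \<Omega> \<and> g \<in> Cc \<Omega> \<and> (\<forall>x. f x \<le> g x)}"

definition between :: "('a \<Rightarrow> real) \<times> ('a \<Rightarrow> real) \<Rightarrow> ('a \<times> real) set" where
  "between = (\<lambda>(f, g). {(x, t). f x \<le> t \<and> t < g x})"

text \<open>
  In hindsight, this is the mass of the region between the two graphs under the product of the representing
  measure with Lebesgue measure.
\<close>

definition vol :: "('a \<Rightarrow> real) \<times> ('a \<Rightarrow> real) \<Rightarrow> ennreal" where
  "vol = (\<lambda>(f, g). ennreal (I (\<lambda>x. g x - f x)))"

definition graph_measure :: "('a \<times> real) measure" where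
  "graph_measure = extend_measure UNIV idx between vol"

text \<open>
  Intersections of regions between graphs are of the same kind, with the maximum of the lower and the minimum of
  the upper functions; a difference splits into the part below the second region and the part
  above it. The nested maxima and minima only keep the lower function below the upper one.
\<close>

lemma semiring_between: "semiring_of_sets UNIV (between ` idx)"
proof (unfold_locales)
  show "between ` idx \<subseteq> Pow UNIV" by simp
  have "between (\<lambda>_. 0, \<lambda>_. 0) = {}" by (auto simp: between_def)
  moreover have "(\<lambda>_. 0, \<lambda>_. 0) \<in> idx" by (simp add: idx_def)
  ultimately show "{} \<in> between ` idx" by (metis image_eqI)
next
  fix a b assume "a \<in> between ` idx" "b \<in> between ` idx"
  then obtain f g f' g' where a: "a = between (f, g)" "f \<in> Cc \<Omega>" "g \<in> Cc \<Omega>" "\<And>x. f x \<le> g x"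
    and b: "b = between (f', g')" "f' \<in> Cc \<Omega>" "g' \<in> Cc \<Omega>" "\<And>x. f' x \<le> g' x"
    by (auto simp: idx_def)
  let ?i = "(\<lambda>x. max (f x) (f' x), \<lambda>x. max (max (f x) (f' x)) (min (g x) (g' x)))"
  have "a \<inter> b = between ?i" unfolding a b by (auto simp: between_def)
  moreover have "?i \<in> idx" using a b by (auto simp: idx_def intro!: Cc_closed)
  ultimately show "a \<inter> b \<in> between ` idx" by blast
  let ?l = "(f, \<lambda>x. max (f x) (min (g x) (f' x)))" and ?u = "(\<lambda>x. min (g x) (max (f x) (g' x)), g)"
  have "a - b = \<Union> {between ?l, between ?u} \<and> between ?l \<inter> between ?u = {}"
  proof -
    have "((x, t) \<in> a - b \<longleftrightarrow> (x, t) \<in> between ?l \<union> between ?u) \<and> (x, t) \<notin> between ?l \<inter> between ?u" for x t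
      using a(4)[of x] b(4)[of x] by (simp add: a(1) b(1) between_def) linarith
    then show ?thesis by auto
  qed
  moreover from this have "disjoint {between ?l, between ?u}"
    by (auto simp: disjoint_def)
  moreover have "?l \<in> idx" "?u \<in> idx" using a b by (auto simp: idx_def intro!: Cc_closed)
  ultimately show "\<exists>C\<subseteq>between ` idx. finite C \<and> disjoint C \<and> a - b = \<Union> C"
    by (intro exI[of _ "{between ?l, between ?u}"]) auto
qed

text \<open>
  If a region is the disjoint union of countably many others, then over each point the vertical slices are
  intervals and their lengths add up. So \<open>g - f\<close> is the pointwise sum of the corresponding
  differences, and countable additivity of the volume is that of \<open>I\<close>.
\<close>

lemma emeasure_between:
  assumes "f \<in> Cc \<Omega>" "g \<in> Cc \<Omega>" "\<And>x. f x \<le> g x"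
  shows "emeasure graph_measure (between (f, g)) = ennreal (I (\<lambda>x. g x - f x))"
proof -
  have slice: "{t. (x, t) \<in> between (f, g)} = {f x..<g x}" for f g x by (auto simp: between_def)
  have "emeasure graph_measure (between (f, g)) = vol (f, g)"
  proof (rule extend_measure_caratheodory[OF graph_measure_def _ semiring_between])
    show "(f, g) \<in> idx" using assms by (simp add: idx_def)
  next
    fix i j assume "i \<in> idx" "j \<in> idx" and eq: "between i = between j"
    then obtain f g f' g' where i: "i = (f, g)" "\<And>x. f x \<le> g x" and j: "j = (f', g')" "\<And>x. f' x \<le> g' x"
      by (auto simp: idx_def)
    have "g x - f x = g' x - f' x" for x
    proof -
      have "{f x..<g x} = {f' x..<g' x}" using eq unfolding i j slice[symmetric] by simp
      then show ?thesis using i(2)[of x] j(2)[of x] measure_lborel_Ico by metis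
    qed
    then show "vol i = vol j" by (simp add: i j vol_def)
  next
    fix i assume "i \<in> idx" and e: "between i = {}"
    then obtain f g where i: "i = (f, g)" "\<And>x. f x \<le> g x" by (auto simp: idx_def)
    have "g x - f x = 0" for x
    proof -
      have "{f x..<g x} = {}" using e unfolding i slice[symmetric] by simp
      then show ?thesis using i(2)[of x] by simp
    qed
    then show "vol i = 0" by (simp add: i vol_def I_zero)
  next
    fix A :: "nat \<Rightarrow> _" and j
    assume A: "A \<in> UNIV \<rightarrow> idx" and j: "j \<in> idx" and disj: "disjoint_family (between \<circ> A)"
      and un: "(\<Union>n. between (A n)) = between j"
    obtain f g where fg: "j = (f, g)" "f \<in> Cc \<Omega>" "g \<in> Cc \<Omega>" "\<And>x. f x \<le> g x" using j by (auto simp: idx_def)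
    define a b where "a n = fst (A n)" and "b n = snd (A n)" for n
    have An: "A n = (a n, b n)" for n by (simp add: a_def b_def)
    have "A n \<in> idx" for n using A by auto
    then have ab: "a n \<in> Cc \<Omega>" "b n \<in> Cc \<Omega>" "a n x \<le> b n x" for n x unfolding An by (auto simp: idx_def)
    have "(\<lambda>n. b n x - a n x) sums (g x - f x)" for x
    proof -
      have u: "(\<Union>n. {a n x..<b n x}) = {f x..<g x}"
        using un unfolding fg An slice[symmetric] by blast
      have "disjoint_family (\<lambda>n. {a n x..<b n x})"
        using disj unfolding disjoint_family_on_def comp_def An slice[symmetric] by blast
      then have "(\<lambda>n. measure lborel {a n x..<b n x}) sums measure lborel (\<Union>n. {a n x..<b n x})"
        by (intro measure_UNION) (auto simp: u fg(4))
      then show ?thesis using ab(3) fg(4) by (simp add: u)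
    qed
    then have "(\<lambda>n. I (\<lambda>x. b n x - a n x)) sums I (\<lambda>x. g x - f x)"
      using ab fg by (intro I_countably_additive Cc_closed) auto
    then show "(\<Sum>n. vol (A n)) = vol j"
      unfolding An fg vol_def prod.case using ab
      by (intro suminf_ennreal_eq nonneg Cc_closed) auto
  qed (simp_all add: vol_def split: prod.split)
  then show ?thesis by (simp add: vol_def)
qed

lemma sets_between:
  assumes "f \<in> Cc \<Omega>" "g \<in> Cc \<Omega>" "\<And>x. f x \<le> g x"
  shows "between (f, g) \<in> sets graph_measure"
  unfolding graph_measure_def using assms
  by (subst sets_extend_measure) (auto simp: idx_def intro!: sigma_sets.Basic)

lemma emeasure_between_zero:
  assumes "f \<in> Cc \<Omega>" "\<And>x. 0 \<le> f x"
  shows "emeasure graph_measure (between (\<lambda>_. 0, f)) = ennreal (I f)"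
    "between (\<lambda>_. 0, f) \<in> sets graph_measure"
  using emeasure_between[of "\<lambda>_. 0" f] sets_between[of "\<lambda>_. 0" f] assms by simp_all

text \<open>
  The cylinder is the increasing union of the regions under truncated multiples of the distance to the complement
  of \<open>A\<close>.
\<close>

lemma cylinder_over_open:
  assumes A: "open A" "A \<subseteq> \<Omega>"
  shows "A \<times> {0..<1} \<in> sets graph_measure" "emeasure graph_measure (A \<times> {0..<1}) \<le> ennreal C"
proof -
  \<comment> \<open>Subtracting \<open>1\<close> keeps the support of \<open>g n\<close> away from the boundary of \<open>A\<close>.\<close>
  define g where "g n x = min 1 (max 0 (real n * infdist x (- A) - 1))" for n x
  have bA: "bounded A" using A bounded_domain bounded_subset by blast
  have ne: "- A \<noteq> {}"
  proof
    assume "- A = {}"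
    then have "bounded (UNIV :: 'a set)" using bA by (metis double_compl Compl_empty_eq)
    then show False by simp
  qed
  have pos: "0 < infdist x (- A)" if "x \<in> A" for x
    using that A in_closed_iff_infdist_zero[of "- A" x] ne infdist_nonneg[of x "- A"]
    by (auto simp: less_le closed_Compl)
  have g: "g n \<in> Cc \<Omega>" for n
  proof (rule CcI[of _ "{x. 1 \<le> real n * infdist x (- A)}"])
    let ?K = "{x. 1 \<le> real n * infdist x (- A)}"
    have "?K \<subseteq> A"
    proof
      fix x assume x: "x \<in> ?K"
      show "x \<in> A"
      proof (rule ccontr)
        assume "x \<notin> A"
        then have "infdist x (- A) = 0" by simp
        then show False using x by simp
      qed
    qed
    then show "?K \<subseteq> \<Omega>" using A by blast
    have "closed ?K" by (intro closed_Collect_le continuous_intros)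
    moreover have "bounded ?K" using \<open>?K \<subseteq> A\<close> bA bounded_subset by blast
    ultimately show "compact ?K" by (simp add: compact_eq_bounded_closed)
    show "continuous_on UNIV (g n)" unfolding g_def[abs_def] by (intro continuous_intros)
  qed (auto simp: g_def)
  have g01: "0 \<le> g n x" "g n x \<le> 1" for n x by (auto simp: g_def)
  have A_eq: "A \<times> {0..<1} = (\<Union>n. between (\<lambda>_. 0, g n))"
  proof (intro set_eqI iffI)
    fix p assume p: "p \<in> A \<times> {0..<1::real}"
    obtain x t where xt: "p = (x, t)" by (cases p)
    then have x: "x \<in> A" "0 \<le> t" "t < 1" using p by auto
    obtain n where "2 / infdist x (- A) < real n" using reals_Archimedean2 by blast
    then have "g n x = 1" using pos[OF x(1)] by (simp add: g_def field_simps)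
    then have "p \<in> between (\<lambda>_. 0, g n)" using x by (simp add: xt between_def)
    then show "p \<in> (\<Union>n. between (\<lambda>_. 0, g n))" by blast
  next
    fix p assume "p \<in> (\<Union>n. between (\<lambda>_. 0, g n))"
    then obtain x t n where xt: "p = (x, t)" "0 \<le> t" "t < g n x" by (auto simp: between_def)
    have "x \<in> A"
    proof (rule ccontr)
      assume "x \<notin> A"
      then have "infdist x (- A) = 0" by simp
      then show False using xt by (simp add: g_def)
    qed
    then show "p \<in> A \<times> {0..<1}" using xt g01(2)[of n x] by auto
  qed
  show "A \<times> {0..<1} \<in> sets graph_measure" unfolding A_eq
    using emeasure_between_zero(2)[OF g g01(1)] by blast
  have "incseq (\<lambda>n. between (\<lambda>_. 0, g n))"
  proof (rule incseq_SucI)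
    fix n
    have "g n x \<le> g (Suc n) x" for x
    proof -
      have "real n * infdist x (- A) \<le> real (Suc n) * infdist x (- A)"
        by (intro mult_right_mono) (auto simp: infdist_nonneg)
      then show ?thesis unfolding g_def by (intro min.mono max.mono) auto
    qed
    then show "between (\<lambda>_. 0, g n) \<subseteq> between (\<lambda>_. 0, g (Suc n))"
      by (auto simp: between_def intro: less_le_trans)
  qed
  then have "emeasure graph_measure (A \<times> {0..<1}) = (SUP n. emeasure graph_measure (between (\<lambda>_. 0, g n)))"
    unfolding A_eq using emeasure_between_zero(2)[OF g g01(1)]
    by (intro SUP_emeasure_incseq[symmetric]) auto
  also have "\<dots> \<le> ennreal C"
    using bounded_by[OF g g01] by (auto intro!: SUP_least ennreal_leI simp: emeasure_between_zero(1)[OF g g01(1)])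
  finally show "emeasure graph_measure (A \<times> {0..<1}) \<le> ennreal C" .
qed

definition riesz_measure :: "'a measure" where
  "riesz_measure = distr (restrict_space graph_measure (\<Omega> \<times> {0..<1})) (restrict_space borel \<Omega>) fst"

lemma space_graph_measure: "space graph_measure = UNIV"
  by (simp add: graph_measure_def space_extend_measure)

lemma measurable_fst_graph_measure:
  "fst \<in> restrict_space graph_measure (\<Omega> \<times> {0..<1}) \<rightarrow>\<^sub>M restrict_space borel \<Omega>"
proof (rule measurable_restrict_space2)
  let ?S = "\<Omega> \<times> {0..<1::real}"
  have sp: "space (restrict_space graph_measure ?S) = ?S"
    by (simp add: space_restrict_space space_graph_measure)
  show "fst \<in> space (restrict_space graph_measure ?S) \<rightarrow> \<Omega>" by (auto simp: sp)
  show "fst \<in> borel_measurable (restrict_space graph_measure ?S)"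
  proof (rule borel_measurableI)
    fix U :: "'a set" assume "open U"
    then have "(U \<inter> \<Omega>) \<times> {0..<1::real} \<in> sets graph_measure"
      using open_domain by (intro cylinder_over_open) auto
    then have "?S \<inter> ((U \<inter> \<Omega>) \<times> {0..<1}) \<in> sets (restrict_space graph_measure ?S)"
      by (auto simp: sets_restrict_space)
    also have "?S \<inter> ((U \<inter> \<Omega>) \<times> {0..<1}) = fst -` U \<inter> space (restrict_space graph_measure ?S)"
      by (auto simp: sp)
    finally show "fst -` U \<inter> space (restrict_space graph_measure ?S) \<in> sets (restrict_space graph_measure ?S)" .
  qed
qed

lemma sets_riesz_measure: "sets riesz_measure = sets (restrict_space borel \<Omega>)"
  by (simp add: riesz_measure_def)

lemma emeasure_riesz_measure:
  assumes "A \<in> sets (restrict_space borel \<Omega>)"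
  shows "emeasure riesz_measure A = emeasure graph_measure (A \<times> {0..<1})" "A \<times> {0..<1} \<in> sets graph_measure"
proof -
  let ?S = "\<Omega> \<times> {0..<1::real}"
  have S: "?S \<in> sets graph_measure" using open_domain by (intro cylinder_over_open) auto
  have "A \<subseteq> \<Omega>" using sets.sets_into_space[OF assms] by (simp add: space_restrict_space)
  then have eq: "fst -` A \<inter> space (restrict_space graph_measure ?S) = A \<times> {0..<1}"
    by (auto simp: space_restrict_space space_graph_measure)
  have "A \<times> {0..<1} \<in> sets (restrict_space graph_measure ?S)"
    using measurable_sets[OF measurable_fst_graph_measure assms] by (simp add: eq)
  then show *: "A \<times> {0..<1} \<in> sets graph_measure"
    using S by (simp add: sets_restrict_space_iff space_graph_measure)
  have "emeasure riesz_measure A = emeasure (restrict_space graph_measure ?S) (A \<times> {0..<1})"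
    unfolding riesz_measure_def emeasure_distr[OF measurable_fst_graph_measure assms] eq ..
  also have "\<dots> = emeasure graph_measure (A \<times> {0..<1})"
    using S \<open>A \<subseteq> \<Omega>\<close> by (intro emeasure_restrict_space) (auto simp: space_graph_measure)
  finally show "emeasure riesz_measure A = emeasure graph_measure (A \<times> {0..<1})" .
qed

lemma finite_riesz_measure: "finite_measure riesz_measure"
proof
  have "\<Omega> \<in> sets (restrict_space borel \<Omega>)" using sets.top[of "restrict_space borel \<Omega>"] by (simp add: space_restrict_space)
  then have "emeasure riesz_measure \<Omega> \<le> ennreal C"
    using cylinder_over_open(2)[OF open_domain] by (simp add: emeasure_riesz_measure)
  moreover have "space riesz_measure = \<Omega>" by (simp add: riesz_measure_def space_restrict_space)
  ultimately show "emeasure riesz_measure (space riesz_measure) \<noteq> \<infinity>" by (auto simp: top_unique)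
qed

lemma integrable_Cc_riesz_measure:
  assumes f: "f \<in> Cc \<Omega>"
  shows "integrable riesz_measure f"
proof -
  interpret finite_measure riesz_measure by (rule finite_riesz_measure)
  obtain c where c: "\<And>x. \<bar>f x\<bar> \<le> c" using Cc_bounded[OF f] by blast
  have "f \<in> borel_measurable (restrict_space borel \<Omega>)"
    using Cc_cont[OF f] by (intro measurable_restrict_space1 borel_measurable_continuous_onI)
  then have "f \<in> borel_measurable riesz_measure" by (simp add: measurable_cong_sets[OF sets_riesz_measure refl])
  then show ?thesis using c by (intro integrable_const_bound[of _ c]) auto
qed

text \<open>
  The region under \<open>\<phi>\<close> lies between the cylinders over \<open>B\<close> and \<open>A\<close>, so \<open>I \<phi>\<close> obeys the same estimates as the
  integral of \<open>\<phi>\<close>.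
\<close>

lemma I_between_measures:
  assumes \<phi>: "\<phi> \<in> Cc \<Omega>" "\<And>x. 0 \<le> \<phi> x" "\<And>x. \<phi> x \<le> 1"
    and A: "A \<in> sets riesz_measure" "\<And>x. 0 < \<phi> x \<Longrightarrow> x \<in> A"
    and B: "B \<in> sets riesz_measure" "\<And>x. x \<in> B \<Longrightarrow> \<phi> x = 1"
  shows "measure riesz_measure B \<le> I \<phi>" "I \<phi> \<le> measure riesz_measure A"
    "measure riesz_measure B \<le> (LINT x|riesz_measure. \<phi> x)"
    "(LINT x|riesz_measure. \<phi> x) \<le> measure riesz_measure A"
proof -
  interpret finite_measure riesz_measure by (rule finite_riesz_measure)
  have A': "A \<in> sets (restrict_space borel \<Omega>)" and B': "B \<in> sets (restrict_space borel \<Omega>)"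
    using A B sets_riesz_measure by auto
  have "emeasure graph_measure (between (\<lambda>_. 0, \<phi>)) \<le> emeasure graph_measure (A \<times> {0..<1})"
    using emeasure_riesz_measure(2)[OF A'] A(2) \<phi>(3)
    by (intro emeasure_mono) (auto simp: between_def intro: le_less_trans less_le_trans[OF _ \<phi>(3)])
  then have "ennreal (I \<phi>) \<le> ennreal (measure riesz_measure A)"
    by (simp add: emeasure_between_zero(1)[OF \<phi>(1,2)] emeasure_riesz_measure(1)[OF A', symmetric] emeasure_eq_measure)
  then show "I \<phi> \<le> measure riesz_measure A" by simp
  have "emeasure graph_measure (B \<times> {0..<1}) \<le> emeasure graph_measure (between (\<lambda>_. 0, \<phi>))"
    using emeasure_between_zero(2)[OF \<phi>(1,2)] B(2)
    by (intro emeasure_mono) (auto simp: between_def)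
  then have "ennreal (measure riesz_measure B) \<le> ennreal (I \<phi>)"
    by (simp add: emeasure_between_zero(1)[OF \<phi>(1,2)] emeasure_riesz_measure(1)[OF B', symmetric] emeasure_eq_measure)
  then show "measure riesz_measure B \<le> I \<phi>" using nonneg[OF \<phi>(1,2)] by simp
  have iA: "integrable riesz_measure (indicat_real A)" and iB: "integrable riesz_measure (indicat_real B)"
    using A(1) B(1) by (auto intro!: integrable_real_indicator simp: emeasure_eq_measure)
  have i: "integrable riesz_measure \<phi>" by (rule integrable_Cc_riesz_measure[OF \<phi>(1)])
  have "(LINT x|riesz_measure. \<phi> x) \<le> (LINT x|riesz_measure. indicator A x)"
    using A \<phi>(2,3) by (intro integral_mono i iA iB) (auto split: split_indicator simp: not_less intro: antisym less_imp_le dest: not_le_imp_less)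
  then show "(LINT x|riesz_measure. \<phi> x) \<le> measure riesz_measure A" using A(1) sets.sets_into_space[OF A(1)] by (simp add: Int_absorb1 Int_absorb2)
  have "(LINT x|riesz_measure. indicator B x) \<le> (LINT x|riesz_measure. \<phi> x)"
    using B \<phi>(2) by (intro integral_mono i iA iB) (auto split: split_indicator)
  then show "measure riesz_measure B \<le> (LINT x|riesz_measure. \<phi> x)" using B(1) sets.sets_into_space[OF B(1)] by (simp add: Int_absorb1 Int_absorb2)
qed

text \<open>
  Slicing \<open>f\<close> horizontally into \<open>N\<close> layers of height \<open>h\<close>, the values of \<open>I\<close> and of the integral on each
  layer lie between the measures of two consecutive superlevel sets. The errors telescope, and the total
  is at most \<open>h\<close> times the mass of the measure.
\<close>

proposition integral_riesz_measure:
  assumes f: "f \<in> Cc \<Omega>" "\<And>x. 0 \<le> f x"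
  shows "(LINT x|riesz_measure. f x) = I f"
proof -
  interpret finite_measure riesz_measure by (rule finite_riesz_measure)
  obtain c where c: "0 < c" "\<And>x. f x \<le> c" using Cc_bounded[OF f(1)] by (metis abs_ge_self order_trans)
  let ?m = "measure riesz_measure (space riesz_measure)"
  have "\<bar>(LINT x|riesz_measure. f x) - I f\<bar> \<le> c * ?m / real N" if N: "0 < N" for N :: nat
  proof -
    define h where "h = c / real N"
    have h: "0 < h" "real N * h = c" using c N by (auto simp: h_def)
    \<comment> \<open>\<open>h * \<phi> j x\<close> is the part of the graph of \<open>f\<close> between the heights \<open>j * h\<close> and \<open>(j + 1) * h\<close>.\<close>
    define \<phi> where "\<phi> j x = (min (f x) (real (Suc j) * h) - min (f x) (real j * h)) / h" for j x
    define A where "A j = {x\<in>\<Omega>. real j * h < f x}" for j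
    have jh: "real j * h \<le> real (Suc j) * h" "real (Suc j) * h = real j * h + h" "0 \<le> real j * h" for j
      using h by (auto simp: algebra_simps)
    have \<phi>: "\<phi> j \<in> Cc \<Omega>" for j
    proof (rule Cc_if_vanishes_jointly[OF f(1) f(1)])
      show "continuous_on UNIV (\<phi> j)"
        unfolding \<phi>_def[abs_def] using h by (intro continuous_intros Cc_cont[OF f(1)]) auto
    qed (use jh[of j] h in \<open>auto simp: \<phi>_def\<close>)
    have \<phi>01: "0 \<le> \<phi> j x" "\<phi> j x \<le> 1" for j x
      using jh[of j] h by (auto simp: \<phi>_def min_def field_simps)
    have A: "A j \<in> sets riesz_measure" for j
    proof -
      have "open {x. real j * h < f x}" using Cc_cont[OF f(1)] by (intro open_Collect_less continuous_intros)
      then have "\<Omega> \<inter> {x. real j * h < f x} \<in> sets (restrict_space borel \<Omega>)"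
        by (auto simp: sets_restrict_space)
      also have "\<Omega> \<inter> {x. real j * h < f x} = A j" by (auto simp: A_def)
      finally show ?thesis by (simp add: sets_riesz_measure)
    qed
    have in_\<Omega>: "x \<in> \<Omega>" if "f x \<noteq> 0" for x using f(1) that by (auto simp: Cc_def)
    have below: "x \<in> A j" if "0 < \<phi> j x" for j x
    proof -
      have "real j * h < f x" using that h(1) jh(2)[of j] by (auto simp: \<phi>_def min_def zero_less_divide_iff simp del: of_nat_Suc split: if_splits)
      then show ?thesis using in_\<Omega>[of x] jh(3)[of j] by (auto simp: A_def)
    qed
    have above: "\<phi> j x = 1" if "x \<in> A (Suc j)" for j x
      using that h(1) jh[of j] by (auto simp: A_def \<phi>_def min_def)
    have sandwich:
      "measure riesz_measure (A (Suc j)) \<le> I (\<phi> j)" "I (\<phi> j) \<le> measure riesz_measure (A j)"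
      "measure riesz_measure (A (Suc j)) \<le> (LINT x|riesz_measure. \<phi> j x)"
      "(LINT x|riesz_measure. \<phi> j x) \<le> measure riesz_measure (A j)" for j
      by (rule I_between_measures[OF \<phi> \<phi>01 A below[of j] A above[of _ j]], assumption+)+
    have "(\<Sum>j<N. h * \<phi> j x) = f x" for x
    proof -
      have "(\<Sum>j<N. h * \<phi> j x) = (\<Sum>j<N. min (f x) (real (Suc j) * h) - min (f x) (real j * h))"
        using h by (simp add: \<phi>_def)
      also have "\<dots> = min (f x) (real N * h) - min (f x) (real 0 * h)" by (rule sum_lessThan_telescope)
      finally show ?thesis using f(2)[of x] c(2)[of x] h(2) by simp
    qed
    then have f_eq: "f = (\<lambda>x. \<Sum>j<N. h * \<phi> j x)" by auto
    have "I f = (\<Sum>j<N. I (\<lambda>x. h * \<phi> j x))"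
      by (subst f_eq, rule I_sum) (use h \<phi> \<phi>01 in \<open>auto intro!: Cc_scale\<close>)
    also have "\<dots> = (\<Sum>j<N. h * I (\<phi> j))" using h \<phi> \<phi>01 by (intro sum.cong homogeneous) auto
    finally have I: "I f = (\<Sum>j<N. h * I (\<phi> j))" .
    have L: "(LINT x|riesz_measure. f x) = (\<Sum>j<N. h * (LINT x|riesz_measure. \<phi> j x))"
      by (subst f_eq, subst Bochner_Integration.integral_sum)
        (auto intro!: integrable_Cc_riesz_measure \<phi>)
    have "\<bar>(LINT x|riesz_measure. f x) - I f\<bar> = \<bar>\<Sum>j<N. h * ((LINT x|riesz_measure. \<phi> j x) - I (\<phi> j))\<bar>"
      by (simp only: I L sum_subtractf right_diff_distrib)
    also have "\<dots> \<le> (\<Sum>j<N. h * (measure riesz_measure (A j) - measure riesz_measure (A (Suc j))))"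
    proof (rule order_trans[OF sum_abs], rule sum_mono)
      fix j
      have "\<bar>(LINT x|riesz_measure. \<phi> j x) - I (\<phi> j)\<bar> \<le> measure riesz_measure (A j) - measure riesz_measure (A (Suc j))"
        using sandwich[of j] by linarith
      then show "\<bar>h * ((LINT x|riesz_measure. \<phi> j x) - I (\<phi> j))\<bar>
          \<le> h * (measure riesz_measure (A j) - measure riesz_measure (A (Suc j)))"
        using h by (simp add: abs_mult)
    qed
    also have "\<dots> = h * (measure riesz_measure (A 0) - measure riesz_measure (A N))"
      by (simp only: sum_distrib_left[symmetric] sum_lessThan_telescope'[of "\<lambda>j. measure riesz_measure (A j)"])
    also have "\<dots> \<le> h * ?m"
    proof (rule mult_left_mono)
      show "measure riesz_measure (A 0) - measure riesz_measure (A N) \<le> ?m"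
        using bounded_measure[of "A 0"] measure_nonneg[of riesz_measure "A N"] by linarith
    qed (use h in simp)
    finally show ?thesis by (simp add: h_def)
  qed
  then have "\<bar>(LINT x|riesz_measure. f x) - I f\<bar> \<le> 0"
    by (intro LIMSEQ_le_const[OF lim_const_over_n[of "c * ?m"]]) (auto intro!: exI[of _ 1])
  then show ?thesis by simp
qed

end

section \<open>Bounded functionals on compactly supported differentiable functions\<close>

lemma C1c_subset_Cc:
  assumes "\<phi> \<in> C1c \<Omega>" shows "\<phi> \<in> Cc \<Omega>"
proof -
  obtain \<phi>' K where d: "\<And>x. (\<phi> has_derivative blinfun_apply (\<phi>' x)) (at x)" 
    and K: "compact K" "K \<subseteq> \<Omega>" "\<And>x. x \<notin> K \<Longrightarrow> \<phi> x = 0"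
    by (rule C1cE[OF assms]) blast
  show ?thesis by (rule CcI[OF continuous_if_has_derivative[OF d] K])
qed

lemma real_polynomial_function_C1:
  fixes p :: "'a::euclidean_space \<Rightarrow> real"
  assumes "real_polynomial_function p"
  shows "\<exists>p' :: 'a \<Rightarrow> 'a \<Rightarrow>\<^sub>L real. (\<forall>x. (p has_derivative blinfun_apply (p' x)) (at x)) \<and> continuous_on UNIV p'"
  using assms
proof induction
  case (linear f)
  then show ?case
    by (intro exI[of _ "\<lambda>_. Blinfun f"])
      (auto simp: bounded_linear_Blinfun_apply bounded_linear_imp_has_derivative)
next
  case (const c)
  show ?case by (intro exI[of _ "\<lambda>_. 0"]) auto
next
  case (add f g)
  then obtain f' g' where "\<And>x. (f has_derivative blinfun_apply (f' x)) (at x)" "continuous_on UNIV f'"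
    "\<And>x. (g has_derivative blinfun_apply (g' x)) (at x)" "continuous_on UNIV g'" by blast
  then show ?case
    by (intro exI[of _ "\<lambda>x. f' x + g' x"])
      (auto intro!: continuous_intros has_derivative_add simp: plus_blinfun.rep_eq)
next
  case (mult f g)
  then obtain f' g' where fg: "\<And>x. (f has_derivative blinfun_apply (f' x)) (at x)" "continuous_on UNIV f'"
    "\<And>x. (g has_derivative blinfun_apply (g' x)) (at x)" "continuous_on UNIV g'" by blast
  have c: "continuous_on UNIV f" "continuous_on UNIV g" 
    by (rule continuous_if_has_derivative[OF fg(1)], rule continuous_if_has_derivative[OF fg(3)])
  show ?case
  proof (intro exI[of _ "\<lambda>x. f x *\<^sub>R g' x + g x *\<^sub>R f' x"] conjI allI)
    fix x
    have "((\<lambda>x. f x * g x) has_derivative (\<lambda>h. f x * g' x h + f' x h * g x)) (at x)"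
      by (rule has_derivative_mult[OF fg(1,3)])
    also have "(\<lambda>h. f x * g' x h + f' x h * g x) = blinfun_apply (f x *\<^sub>R g' x + g x *\<^sub>R f' x)"
      by (auto simp: fun_eq_iff blinfun.add_left blinfun.scaleR_left)
    finally show "((\<lambda>x. f x * g x) has_derivative blinfun_apply (f x *\<^sub>R g' x + g x *\<^sub>R f' x)) (at x)" .
  qed (intro continuous_intros c fg)
qed

lemma has_derivative_pos_part_squared:
  "((\<lambda>t::real. (max 0 t)\<^sup>2) has_real_derivative 2 * max 0 t) (at t)"
proof (cases t "0 :: real" rule: linorder_cases)
  case less
  have "((\<lambda>t::real. 0) has_real_derivative 0) (at t)" by simp
  then have "((\<lambda>t::real. (max 0 t)\<^sup>2) has_real_derivative 0) (at t)"
    by (rule has_field_derivative_transform_within_open[of _ _ _ "{..<0}"]) (use less in auto)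
  then show ?thesis using less by simp
next
  case greater
  have "((\<lambda>t::real. t\<^sup>2) has_real_derivative 2 * t) (at t)" by (auto intro!: derivative_eq_intros)
  then have "((\<lambda>t::real. (max 0 t)\<^sup>2) has_real_derivative 2 * t) (at t)"
    by (rule has_field_derivative_transform_within_open[of _ _ _ "{0<..}"]) (use greater in auto)
  then show ?thesis using greater by simp
next
  case equal
  have "((\<lambda>h::real. (max 0 h)\<^sup>2 / h) \<longlongrightarrow> 0) (at 0)"
  proof (rule Lim_null_comparison)
    show "\<forall>\<^sub>F h::real in at 0. norm ((max 0 h)\<^sup>2 / h) \<le> \<bar>h\<bar>"
      by (intro always_eventually allI) (auto simp: max_def power2_eq_square)
    show "((\<lambda>h::real. \<bar>h\<bar>) \<longlongrightarrow> 0) (at 0)" by (rule tendsto_rabs_zero) simp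
  qed
  then show ?thesis using equal by (simp add: DERIV_def)
qed

text \<open>
  A continuously differentiable replacement for soft thresholding. It is built from
  \<open>sqrt ((max 0 (t - d))\<^sup>2 + d\<^sup>2) - d\<close>, which is differentiable since the square of the positive part is.
\<close>

lemma C1_threshold:
  fixes d :: real
  assumes d: "0 < d"
  obtains H H' :: "real \<Rightarrow> real" where "\<And>t. (H has_real_derivative H' t) (at t)" "continuous_on UNIV H'"
    "\<And>t. \<bar>t\<bar> \<le> d \<Longrightarrow> H t = 0" "\<And>t. \<bar>t\<bar> \<le> d \<Longrightarrow> H' t = 0" "\<And>t. \<bar>H t - t\<bar> \<le> 2 * d"
proof -
  define s where "s t = max 0 (t - d)" for t
  define F where "F t = sqrt ((s t)\<^sup>2 + d\<^sup>2) - d" for t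
  define F' where "F' t = s t / sqrt ((s t)\<^sup>2 + d\<^sup>2)" for t
  have pos: "0 < (s t)\<^sup>2 + d\<^sup>2" for t using d by (simp add: add_nonneg_pos)
  have ds: "((\<lambda>t. (s t)\<^sup>2) has_real_derivative 2 * s t) (at t)" for t
  proof -
    have "((\<lambda>t. t - d) has_real_derivative 1) (at t)" by (auto intro!: derivative_eq_intros)
    from DERIV_chain2[OF has_derivative_pos_part_squared this] show ?thesis by (simp add: s_def)
  qed
  have dF: "(F has_real_derivative F' t) (at t)" for t
  proof -
    have "((\<lambda>t. sqrt ((s t)\<^sup>2 + d\<^sup>2)) has_real_derivative (2 * s t + 0) * (inverse (sqrt ((s t)\<^sup>2 + d\<^sup>2)) / 2)) (at t)"
      using DERIV_chain2[OF DERIV_real_sqrt[OF pos[of t]] DERIV_add[OF ds DERIV_const[of "d\<^sup>2"]]]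
      by (simp add: mult.commute)
    then have "(F has_real_derivative (2 * s t + 0) * (inverse (sqrt ((s t)\<^sup>2 + d\<^sup>2)) / 2) - 0) (at t)"
      unfolding F_def[abs_def] by (intro DERIV_diff DERIV_const)
    moreover have "(2 * s t + 0) * (inverse (sqrt ((s t)\<^sup>2 + d\<^sup>2)) / 2) - 0 = F' t"
      by (simp add: F'_def inverse_eq_divide)
    ultimately show ?thesis by simp
  qed
  have cs: "continuous_on UNIV s" unfolding s_def[abs_def] by (intro continuous_intros)
  have ne: "sqrt ((s t)\<^sup>2 + d\<^sup>2) \<noteq> 0" for t
    using real_sqrt_gt_zero[OF pos[of t]] by linarith
  have cF': "continuous_on UNIV F'" unfolding F'_def[abs_def] by (intro continuous_intros cs) (use ne in auto)
  have F0: "F t = 0" "F' t = 0" if "t \<le> d" for t using that d by (auto simp: F_def F'_def s_def)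
  have Fle: "F t \<le> s t" "s t - d \<le> F t" for t
  proof -
    have "sqrt ((s t)\<^sup>2 + d\<^sup>2) \<le> s t + d"
      using sqrt_sum_squares_le_sum[of "s t" d] d by (simp add: s_def)
    then show "F t \<le> s t" by (simp add: F_def)
    have "s t \<le> sqrt ((s t)\<^sup>2 + d\<^sup>2)" by (rule real_le_rsqrt) simp
    then show "s t - d \<le> F t" by (simp add: F_def)
  qed
  show thesis
  proof (rule that[of "\<lambda>t. F t - F (- t)" "\<lambda>t. F' t + F' (- t)"])
    show "((\<lambda>t. F t - F (- t)) has_real_derivative F' t + F' (- t)) (at t)" for t
    proof -
      have "((\<lambda>t. F (- t)) has_real_derivative F' (- t) * - 1) (at t)"
        by (rule DERIV_chain2[OF dF]) (auto intro!: derivative_eq_intros)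
      from DERIV_diff[OF dF this] show ?thesis by simp
    qed
    show "continuous_on UNIV (\<lambda>t. F' t + F' (- t))"
      by (intro continuous_intros cF' continuous_on_compose2[OF cF']) auto
    show "F t - F (- t) = 0" "F' t + F' (- t) = 0" if "\<bar>t\<bar> \<le> d" for t using F0[of t] F0[of "- t"] that by auto
    show "\<bar>F t - F (- t) - t\<bar> \<le> 2 * d" for t
      using Fle[of t] Fle[of "- t"] F0(1)[of t] F0(1)[of "- t"] d by (auto simp: s_def max_def split: if_splits)
  qed
qed

text \<open>
  A polynomial that is uniformly close to \<open>f\<close> on a ball around the support is small where \<open>f\<close> vanishes. The
  threshold function sends these small values to \<open>0\<close>, so the composition has its support inside that
  of \<open>f\<close> and can be continued by \<open>0\<close> beyond the ball.
\<close>

lemma C1c_dense_in_Cc: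
  fixes f :: "'a::euclidean_space \<Rightarrow> real"
  assumes f: "f \<in> Cc \<Omega>" and \<epsilon>: "0 < \<epsilon>"
  obtains \<phi> where "\<phi> \<in> C1c \<Omega>" "\<And>x. \<bar>\<phi> x - f x\<bar> \<le> \<epsilon>"
proof -
  obtain K where cf: "continuous_on UNIV f" and K: "compact K" "K \<subseteq> \<Omega>" "\<And>x. x \<notin> K \<Longrightarrow> f x = 0"
    using f by (auto simp: Cc_def)
  obtain r0 where r0: "\<And>x. x \<in> K \<Longrightarrow> norm x \<le> r0" using compact_imp_bounded[OF K(1)] bounded_pos by blast
  define r where "r = r0 + 1"
  have KB: "K \<subseteq> ball 0 r" using r0 by (force simp: r_def)
  define d where "d = \<epsilon> / 3"
  have d: "0 < d" using \<epsilon> by (simp add: d_def)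
  obtain p where p: "real_polynomial_function p" "\<And>x. x \<in> cball 0 r \<Longrightarrow> \<bar>f x - p x\<bar> < d"
    using Stone_Weierstrass_real_polynomial_function[of "cball 0 r" f d] continuous_on_subset[OF cf] d by auto
  obtain p' where p': "\<And>x. (p has_derivative blinfun_apply (p' x)) (at x)" "continuous_on UNIV p'"
    using real_polynomial_function_C1[OF p(1)] by blast
  have cp: "continuous_on UNIV p" by (rule continuous_if_has_derivative[OF p'(1)])
  obtain H H' where H: "\<And>t. (H has_real_derivative H' t) (at t)" "continuous_on UNIV H'"
    "\<And>t. \<bar>t\<bar> \<le> d \<Longrightarrow> H t = 0" "\<And>t. \<bar>t\<bar> \<le> d \<Longrightarrow> H' t = 0" "\<And>t. \<bar>H t - t\<bar> \<le> 2 * d"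
    by (rule C1_threshold[OF d]) blast
  define \<phi> where "\<phi> x = (if x \<in> ball 0 r then H (p x) else 0)" for x
  define \<phi>' where "\<phi>' x = (if x \<in> ball 0 r then H' (p x) *\<^sub>R p' x else 0)" for x
  have off: "\<phi> x = 0" "\<phi>' x = 0" if "x \<notin> K" for x
    using that p(2)[of x] K(3)[of x] H(3,4)[of "p x"] by (auto simp: \<phi>_def \<phi>'_def)
  have oK: "open (- K)" using K(1) compact_imp_closed by blast
  have "\<phi> \<in> C1c \<Omega>"
  proof (rule C1cI[OF _ _ K(1,2) off(1)])
    show "(\<phi> has_derivative blinfun_apply (\<phi>' x)) (at x)" for x
    proof (cases "x \<in> ball 0 r")
      case True
      have "((\<lambda>x. H (p x)) has_derivative (\<lambda>h. H' (p x) * p' x h)) (at x)"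
        by (rule has_derivative_compose[OF p'(1)]) (use H(1) in \<open>simp add: has_field_derivative_def\<close>)
      moreover have "(\<lambda>h. H' (p x) * p' x h) = blinfun_apply (\<phi>' x)"
        using True by (auto simp: fun_eq_iff \<phi>'_def blinfun.scaleR_left)
      ultimately have "((\<lambda>x. H (p x)) has_derivative blinfun_apply (\<phi>' x)) (at x)" by simp
      then show ?thesis
        by (rule has_derivative_transform_within_open[of _ _ _ _ "ball 0 r"]) (use True in \<open>auto simp: \<phi>_def\<close>)
    next
      case False
      then have x: "x \<in> - K" using KB by blast
      then have "((\<lambda>_. 0) has_derivative blinfun_apply (\<phi>' x)) (at x)" using off by (simp add: zero_blinfun.rep_eq)
      then show ?thesis
        by (rule has_derivative_transform_within_open[OF _ oK x]) (use off in auto)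
    qed
    have "continuous_on (ball 0 r) \<phi>'"
    proof (rule continuous_on_eq)
      have "continuous_on UNIV (\<lambda>x. H' (p x) *\<^sub>R p' x)"
        by (intro continuous_intros p' continuous_on_compose2[OF H(2) cp]) auto
      then show "continuous_on (ball 0 r) (\<lambda>x. H' (p x) *\<^sub>R p' x)" by (rule continuous_on_subset) auto
    qed (simp add: \<phi>'_def)
    moreover have "continuous_on (- K) \<phi>'"
      by (rule continuous_on_eq[of _ "\<lambda>_. 0"]) (use off in auto)
    ultimately have "continuous_on (ball 0 r \<union> - K) \<phi>'" using oK by (intro continuous_on_open_Un) auto
    moreover have "ball 0 r \<union> - K = UNIV" using KB by blast
    ultimately show "continuous_on UNIV \<phi>'" by simp
  qed
  moreover have "\<bar>\<phi> x - f x\<bar> \<le> \<epsilon>" for x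
  proof (cases "x \<in> ball 0 r")
    case True
    then have "\<bar>f x - p x\<bar> < d" "\<phi> x = H (p x)" using p(2)[of x] by (auto simp: \<phi>_def)
    moreover have "3 * d = \<epsilon>" by (simp add: d_def)
    ultimately show ?thesis using H(5)[of "p x"] by linarith
  next
    case False
    then have "x \<notin> K" using KB by blast
    then show ?thesis using off(1) K(3) \<epsilon> by simp
  qed
  ultimately show thesis by (rule that)
qed

lemma eq_zero_if_abs_le_mult: "x = 0" if "\<And>d. 0 < d \<Longrightarrow> \<bar>x\<bar> \<le> B * d" for x B :: real
proof (rule ccontr)
  assume "x \<noteq> 0"
  then have "\<bar>x\<bar> \<le> B * (\<bar>x\<bar> / (2 * (\<bar>B\<bar> + 1)))" by (intro that) auto
  also have "\<dots> \<le> (\<bar>B\<bar> + 1) * (\<bar>x\<bar> / (2 * (\<bar>B\<bar> + 1)))" by (intro mult_right_mono) auto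
  also have "\<dots> = \<bar>x\<bar> / 2" by (simp add: field_simps)
  finally show False using \<open>x \<noteq> 0\<close> by simp
qed

locale bounded_C1c_functional =
  fixes \<Omega> :: "'a::euclidean_space set" and l :: "('a \<Rightarrow> real) \<Rightarrow> real" and C :: real
  assumes open_domain: "open \<Omega>" and bounded_domain: "bounded \<Omega>"
    and l_add: "\<And>\<phi> \<psi>. \<phi> \<in> C1c \<Omega> \<Longrightarrow> \<psi> \<in> C1c \<Omega> \<Longrightarrow> l (\<lambda>x. \<phi> x + \<psi> x) = l \<phi> + l \<psi>"
    and l_scale: "\<And>c \<phi>. \<phi> \<in> C1c \<Omega> \<Longrightarrow> l (\<lambda>x. c * \<phi> x) = c * l \<phi>"
    and l_bound: "\<And>\<phi> c. \<phi> \<in> C1c \<Omega> \<Longrightarrow> (\<And>x. \<bar>\<phi> x\<bar> \<le> c) \<Longrightarrow> \<bar>l \<phi>\<bar> \<le> C * c"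
    and C_nonneg: "0 \<le> C"
begin

lemma l_diff_bound:
  assumes "\<phi> \<in> C1c \<Omega>" "\<psi> \<in> C1c \<Omega>" "\<And>x. \<bar>\<phi> x - \<psi> x\<bar> \<le> c"
  shows "\<bar>l \<phi> - l \<psi>\<bar> \<le> C * c"
proof -
  have "l (\<lambda>x. \<phi> x + - 1 * \<psi> x) = l \<phi> + - 1 * l \<psi>"
    using assms by (simp only: l_add l_scale C1c_scale)
  moreover have "\<bar>l (\<lambda>x. \<phi> x + - 1 * \<psi> x)\<bar> \<le> C * c"
    using assms by (intro l_bound C1c_add C1c_scale) auto
  ultimately show ?thesis by simp
qed

text \<open>
  The limit of \<open>l\<close> along any approximating sequence. The quantitative form of the conclusion determines the
  value and yields linearity and the norm bound of the extension without a return to sequences.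
\<close>

lemma extension_exists:
  assumes f: "f \<in> Cc \<Omega>"
  shows "\<exists>y. \<forall>\<phi>\<in>C1c \<Omega>. \<forall>d. (\<forall>x. \<bar>\<phi> x - f x\<bar> \<le> d) \<longrightarrow> \<bar>l \<phi> - y\<bar> \<le> C * d"
proof -
  define e where "e n = inverse (real (Suc n))" for n
  have e: "0 < e n" for n by (simp add: e_def)
  have e0: "e \<longlonglongrightarrow> 0" unfolding e_def by (rule LIMSEQ_inverse_real_of_nat)
  have "\<exists>\<phi>. \<phi> \<in> C1c \<Omega> \<and> (\<forall>x. \<bar>\<phi> x - f x\<bar> \<le> e n)" for n using C1c_dense_in_Cc[OF f e] by metis
  then obtain \<phi> where \<phi>: "\<And>n. \<phi> n \<in> C1c \<Omega>" "\<And>n x. \<bar>\<phi> n x - f x\<bar> \<le> e n" by metis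
  have near: "\<bar>l \<psi> - l (\<phi> n)\<bar> \<le> C * (d + e n)" if "\<psi> \<in> C1c \<Omega>" "\<And>x. \<bar>\<psi> x - f x\<bar> \<le> d" for \<psi> d n
  proof (rule l_diff_bound[OF that(1) \<phi>(1)])
    fix x show "\<bar>\<psi> x - \<phi> n x\<bar> \<le> d + e n" using that(2)[of x] \<phi>(2)[of n x] by linarith
  qed
  have "Cauchy (\<lambda>n. l (\<phi> n))"
  proof (rule metric_CauchyI)
    fix \<epsilon> :: real assume \<epsilon>: "0 < \<epsilon>"
    have "(\<lambda>n. C * e n) \<longlonglongrightarrow> C * 0" by (intro tendsto_intros e0)
    then have "\<forall>\<^sub>F n in sequentially. C * e n < \<epsilon> / 2" using \<epsilon> by (intro order_tendstoD(2)) auto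
    then obtain M where M: "\<And>n. M \<le> n \<Longrightarrow> C * e n < \<epsilon> / 2" unfolding eventually_sequentially by blast
    have "dist (l (\<phi> m)) (l (\<phi> n)) < \<epsilon>" if "M \<le> m" "M \<le> n" for m n
      using near[OF \<phi>, of m n] M[OF that(1)] M[OF that(2)] by (simp add: dist_real_def distrib_left)
    then show "\<exists>M. \<forall>m\<ge>M. \<forall>n\<ge>M. dist (l (\<phi> m)) (l (\<phi> n)) < \<epsilon>" by blast
  qed
  then obtain y where y: "(\<lambda>n. l (\<phi> n)) \<longlonglongrightarrow> y" using Cauchy_convergent convergent_def by blast
  show ?thesis
  proof (intro exI[of _ y] ballI allI impI)
    fix \<psi> d assume \<psi>: "\<psi> \<in> C1c \<Omega>" "\<forall>x. \<bar>\<psi> x - f x\<bar> \<le> d"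
    have "(\<lambda>n. \<bar>l \<psi> - l (\<phi> n)\<bar>) \<longlonglongrightarrow> \<bar>l \<psi> - y\<bar>" by (intro tendsto_intros y)
    moreover have "(\<lambda>n. C * (d + e n)) \<longlonglongrightarrow> C * (d + 0)" by (intro tendsto_intros e0)
    ultimately have "\<bar>l \<psi> - y\<bar> \<le> C * (d + 0)"
      by (rule LIMSEQ_le) (use near \<psi> in blast)
    then show "\<bar>l \<psi> - y\<bar> \<le> C * d" by simp
  qed
qed

text \<open>
  The value is unique when \<open>f\<close> lies in \<open>Cc \<Omega>\<close>, because arbitrarily close approximations \<open>\<phi>\<close> exist.
\<close>

definition ext :: "('a \<Rightarrow> real) \<Rightarrow> real" where
  "ext f = (SOME y. \<forall>\<phi>\<in>C1c \<Omega>. \<forall>d. (\<forall>x. \<bar>\<phi> x - f x\<bar> \<le> d) \<longrightarrow> \<bar>l \<phi> - y\<bar> \<le> C * d)"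

lemma ext_near:
  assumes "f \<in> Cc \<Omega>" "\<phi> \<in> C1c \<Omega>" "\<And>x. \<bar>\<phi> x - f x\<bar> \<le> d"
  shows "\<bar>l \<phi> - ext f\<bar> \<le> C * d"
  using someI_ex[OF extension_exists[OF assms(1)]] assms(2,3) unfolding ext_def by blast

lemma ext_C1c: "\<phi> \<in> C1c \<Omega> \<Longrightarrow> ext \<phi> = l \<phi>"
  using ext_near[OF C1c_subset_Cc, of \<phi> \<phi> 0] by simp

lemma ext_add:
  assumes f: "f \<in> Cc \<Omega>" and g: "g \<in> Cc \<Omega>"
  shows "ext (\<lambda>x. f x + g x) = ext f + ext g"
proof -
  have "\<bar>ext (\<lambda>x. f x + g x) - (ext f + ext g)\<bar> \<le> (4 * C) * d" if d: "0 < d" for d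
  proof -
    obtain \<phi> where \<phi>: "\<phi> \<in> C1c \<Omega>" "\<And>x. \<bar>\<phi> x - f x\<bar> \<le> d" using C1c_dense_in_Cc[OF f d] by blast
    obtain \<psi> where \<psi>: "\<psi> \<in> C1c \<Omega>" "\<And>x. \<bar>\<psi> x - g x\<bar> \<le> d" using C1c_dense_in_Cc[OF g d] by blast
    have "\<bar>l (\<lambda>x. \<phi> x + \<psi> x) - ext (\<lambda>x. f x + g x)\<bar> \<le> C * (2 * d)"
    proof (rule ext_near[OF Cc_closed(1)[OF f g] C1c_add[OF \<phi>(1) \<psi>(1)]])
      fix x show "\<bar>\<phi> x + \<psi> x - (f x + g x)\<bar> \<le> 2 * d" using \<phi>(2)[of x] \<psi>(2)[of x] by linarith
    qed
    then show ?thesis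
      using ext_near[OF f \<phi>] ext_near[OF g \<psi>] l_add[OF \<phi>(1) \<psi>(1)] by (simp add: algebra_simps)
  qed
  then have "ext (\<lambda>x. f x + g x) - (ext f + ext g) = 0" by (rule eq_zero_if_abs_le_mult)
  then show ?thesis by simp
qed

lemma ext_scale:
  assumes f: "f \<in> Cc \<Omega>"
  shows "ext (\<lambda>x. c * f x) = c * ext f"
proof -
  have "\<bar>ext (\<lambda>x. c * f x) - c * ext f\<bar> \<le> (2 * C * \<bar>c\<bar>) * d" if d: "0 < d" for d
  proof -
    obtain \<phi> where \<phi>: "\<phi> \<in> C1c \<Omega>" "\<And>x. \<bar>\<phi> x - f x\<bar> \<le> d" using C1c_dense_in_Cc[OF f d] by blast
    have "\<bar>l (\<lambda>x. c * \<phi> x) - ext (\<lambda>x. c * f x)\<bar> \<le> C * (\<bar>c\<bar> * d)"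
    proof (rule ext_near[OF Cc_scale[OF f] C1c_scale[OF \<phi>(1)]])
      fix x show "\<bar>c * \<phi> x - c * f x\<bar> \<le> \<bar>c\<bar> * d"
        using \<phi>(2)[of x] by (simp add: right_diff_distrib[symmetric] abs_mult mult_left_mono)
    qed
    moreover have "\<bar>c * l \<phi> - c * ext f\<bar> \<le> \<bar>c\<bar> * (C * d)"
      using ext_near[OF f \<phi>] by (simp add: right_diff_distrib[symmetric] abs_mult mult_left_mono)
    ultimately show ?thesis using l_scale[OF \<phi>(1), of c] by (simp add: algebra_simps)
  qed
  then have "ext (\<lambda>x. c * f x) - c * ext f = 0" by (rule eq_zero_if_abs_le_mult)
  then show ?thesis by simp
qed

lemma ext_diff:
  assumes "f \<in> Cc \<Omega>" "g \<in> Cc \<Omega>"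
  shows "ext (\<lambda>x. f x - g x) = ext f - ext g"
  using ext_add[OF assms(1) Cc_scale[OF assms(2), of "- 1"]] ext_scale[OF assms(2), of "- 1"] by simp

lemma ext_bound:
  assumes f: "f \<in> Cc \<Omega>" "\<And>x. \<bar>f x\<bar> \<le> c"
  shows "\<bar>ext f\<bar> \<le> C * c"
proof (rule field_le_epsilon)
  fix e :: real assume e: "0 < e"
  define d where "d = e / (2 * (C + 1))"
  have d: "0 < d" using e C_nonneg by (simp add: d_def)
  obtain \<phi> where \<phi>: "\<phi> \<in> C1c \<Omega>" "\<And>x. \<bar>\<phi> x - f x\<bar> \<le> d" using C1c_dense_in_Cc[OF f(1) d] by blast
  have "\<bar>l \<phi>\<bar> \<le> C * (c + d)"
  proof (rule l_bound[OF \<phi>(1)])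
    fix x show "\<bar>\<phi> x\<bar> \<le> c + d" using f(2)[of x] \<phi>(2)[of x] by linarith
  qed
  moreover have "C * (2 * d) \<le> e"
    using e C_nonneg by (simp add: d_def field_simps)
  ultimately show "\<bar>ext f\<bar> \<le> C * c + e" using ext_near[OF f(1) \<phi>] by (simp add: algebra_simps)
qed

text \<open>
  The Jordan decomposition of the extended functional: \<open>pos_part\<close> and \<open>pos_part - ext\<close> are both positive.
\<close>

definition pos_part :: "('a \<Rightarrow> real) \<Rightarrow> real" where
  "pos_part f = (SUP g\<in>{g\<in>Cc \<Omega>. \<forall>x. 0 \<le> g x \<and> g x \<le> f x}. ext g)"

lemma pos_part_bdd:
  assumes "f \<in> Cc \<Omega>"
  shows "bdd_above (ext ` {g\<in>Cc \<Omega>. \<forall>x. 0 \<le> g x \<and> g x \<le> f x})"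
proof -
  obtain c where c: "\<And>x. \<bar>f x\<bar> \<le> c" using Cc_bounded[OF assms] by blast
  have "ext g \<le> C * c" if g: "g \<in> Cc \<Omega>" "\<forall>x. 0 \<le> g x \<and> g x \<le> f x" for g
  proof -
    have "\<bar>g x\<bar> \<le> c" for x using g(2) c[of x] by (smt (verit))
    then show ?thesis using ext_bound[OF g(1)] by (smt (verit))
  qed
  then show ?thesis by (intro bdd_aboveI[of _ "C * c"]) auto
qed

lemma pos_part_upper: "f \<in> Cc \<Omega> \<Longrightarrow> g \<in> Cc \<Omega> \<Longrightarrow> (\<And>x. 0 \<le> g x) \<Longrightarrow> (\<And>x. g x \<le> f x) \<Longrightarrow> ext g \<le> pos_part f"
  unfolding pos_part_def by (intro cSUP_upper pos_part_bdd) auto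

lemma pos_part_least:
  assumes "\<And>x. 0 \<le> f x" "\<And>g. g \<in> Cc \<Omega> \<Longrightarrow> (\<And>x. 0 \<le> g x) \<Longrightarrow> (\<And>x. g x \<le> f x) \<Longrightarrow> ext g \<le> y"
  shows "pos_part f \<le> y"
  unfolding pos_part_def
proof (rule cSUP_least)
  show "{g\<in>Cc \<Omega>. \<forall>x. 0 \<le> g x \<and> g x \<le> f x} \<noteq> {}" using assms(1) Cc_zero by blast
qed (use assms(2) in auto)

text \<open>
  A competitor \<open>g \<le> f1 + f2\<close> splits as \<open>min g f1\<close> and the rest, which is at most \<open>f2\<close>. The minimum leaves the
  class of differentiable functions, and this is why the functional was first extended.
\<close>

lemma pos_part_add:
  assumes f: "f1 \<in> Cc \<Omega>" "f2 \<in> Cc \<Omega>" "\<And>x. 0 \<le> f1 x" "\<And>x. 0 \<le> f2 x"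
  shows "pos_part (\<lambda>x. f1 x + f2 x) = pos_part f1 + pos_part f2"
proof (rule antisym)
  show "pos_part (\<lambda>x. f1 x + f2 x) \<le> pos_part f1 + pos_part f2"
  proof (rule pos_part_least)
    fix g assume g: "g \<in> Cc \<Omega>" "\<And>x. 0 \<le> g x" "\<And>x. g x \<le> f1 x + f2 x"
    define m where "m x = min (g x) (f1 x)" for x
    have m: "m \<in> Cc \<Omega>" "(\<lambda>x. g x - m x) \<in> Cc \<Omega>" unfolding m_def[abs_def] by (intro Cc_closed g f)+
    have b: "0 \<le> m x" "m x \<le> f1 x" "0 \<le> g x - m x" "g x - m x \<le> f2 x" for x
      using g(2,3)[of x] f(3,4)[of x] by (auto simp: m_def)
    have "ext g = ext m + ext (\<lambda>x. g x - m x)" using ext_diff[OF g(1) m(1)] by simp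
    also have "\<dots> \<le> pos_part f1 + pos_part f2" by (intro add_mono pos_part_upper f m b)
    finally show "ext g \<le> pos_part f1 + pos_part f2" .
  qed (use f in simp)
  have "pos_part f1 \<le> pos_part (\<lambda>x. f1 x + f2 x) - pos_part f2"
  proof (rule pos_part_least[OF f(3)])
    fix g1 assume g1: "g1 \<in> Cc \<Omega>" "\<And>x. 0 \<le> g1 x" "\<And>x. g1 x \<le> f1 x"
    have "pos_part f2 \<le> pos_part (\<lambda>x. f1 x + f2 x) - ext g1"
    proof (rule pos_part_least[OF f(4)])
      fix g2 assume g2: "g2 \<in> Cc \<Omega>" "\<And>x. 0 \<le> g2 x" "\<And>x. g2 x \<le> f2 x"
      have "ext (\<lambda>x. g1 x + g2 x) \<le> pos_part (\<lambda>x. f1 x + f2 x)"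
        by (intro pos_part_upper Cc_closed f g1 g2 add_nonneg_nonneg add_mono)
      then show "ext g2 \<le> pos_part (\<lambda>x. f1 x + f2 x) - ext g1" using ext_add[OF g1(1) g2(1)] by simp
    qed
    then show "ext g1 \<le> pos_part (\<lambda>x. f1 x + f2 x) - pos_part f2" by simp
  qed
  then show "pos_part f1 + pos_part f2 \<le> pos_part (\<lambda>x. f1 x + f2 x)" by simp
qed

lemma pos_part_scale_le:
  assumes f: "f \<in> Cc \<Omega>" "\<And>x. 0 \<le> f x" and c: "0 < c"
  shows "c * pos_part f \<le> pos_part (\<lambda>x. c * f x)"
proof -
  have "pos_part f \<le> pos_part (\<lambda>x. c * f x) / c"
  proof (rule pos_part_least[OF f(2)])
    fix g assume g: "g \<in> Cc \<Omega>" "\<And>x. 0 \<le> g x" "\<And>x. g x \<le> f x"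
    have "ext (\<lambda>x. c * g x) \<le> pos_part (\<lambda>x. c * f x)"
      by (intro pos_part_upper Cc_scale f g mult_left_mono mult_nonneg_nonneg) (use c in auto)
    then show "ext g \<le> pos_part (\<lambda>x. c * f x) / c" using ext_scale[OF g(1), of c] c by (simp add: field_simps)
  qed
  then show ?thesis using c by (simp add: field_simps)
qed

lemma pos_part_scale:
  assumes f: "f \<in> Cc \<Omega>" "\<And>x. 0 \<le> f x" and c: "0 \<le> c"
  shows "pos_part (\<lambda>x. c * f x) = c * pos_part f"
proof (cases "c = 0")
  case True
  have "ext (\<lambda>_. 0) = 0" using ext_scale[OF Cc_zero, of 0] by simp
  moreover have "{g \<in> Cc \<Omega>. \<forall>x. 0 \<le> g x \<and> g x \<le> (0::real)} = {\<lambda>_. 0}"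
    by (auto simp: fun_eq_iff intro: antisym)
  ultimately show ?thesis using True by (simp add: pos_part_def)
next
  case False
  then have c: "0 < c" using c by simp
  have "(1 / c) * pos_part (\<lambda>x. c * f x) \<le> pos_part (\<lambda>x. (1 / c) * (c * f x))"
    by (rule pos_part_scale_le) (use f c in \<open>auto intro!: Cc_scale\<close>)
  then have "pos_part (\<lambda>x. c * f x) \<le> c * pos_part f" using c by (simp add: field_simps)
  then show ?thesis using pos_part_scale_le[OF f c] by simp
qed

lemma pos_part_bound:
  assumes f: "f \<in> Cc \<Omega>" "\<And>x. 0 \<le> f x" "\<And>x. f x \<le> c"
  shows "pos_part f \<le> C * c"
proof (rule pos_part_least[OF f(2)])
  fix g assume g: "g \<in> Cc \<Omega>" "\<And>x. 0 \<le> g x" "\<And>x. g x \<le> f x"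
  have "\<bar>g x\<bar> \<le> c" for x using g(2,3)[of x] f(3)[of x] by linarith
  then show "ext g \<le> C * c" using ext_bound[OF g(1)] by (smt (verit))
qed

sublocale pos: positive_functional \<Omega> pos_part C
proof
  show "0 \<le> pos_part f" if "f \<in> Cc \<Omega>" "\<And>x. 0 \<le> f x" for f
  proof -
    have "ext (\<lambda>_. 0) = 0" using ext_scale[OF Cc_zero, of 0] by simp
    then show ?thesis using pos_part_upper[OF that(1) Cc_zero] that(2) by simp
  qed
qed (auto intro!: open_domain bounded_domain pos_part_add pos_part_scale pos_part_bound)

sublocale neg: positive_functional \<Omega> "\<lambda>f. pos_part f - ext f" "2 * C"
proof
  fix f g assume *: "f \<in> Cc \<Omega>" "g \<in> Cc \<Omega>" "\<And>x. 0 \<le> f x" "\<And>x. 0 \<le> g x"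
  then show "pos_part (\<lambda>x. f x + g x) - ext (\<lambda>x. f x + g x) = pos_part f - ext f + (pos_part g - ext g)"
    using pos_part_add[of f g] ext_add[of f g] by simp
next
  fix c :: real and f assume *: "0 \<le> c" "f \<in> Cc \<Omega>" "\<And>x. 0 \<le> f x"
  then show "pos_part (\<lambda>x. c * f x) - ext (\<lambda>x. c * f x) = c * (pos_part f - ext f)"
    using pos_part_scale[of f c] ext_scale[of f c] by (simp add: right_diff_distrib)
next
  fix f assume f: "f \<in> Cc \<Omega>" "\<And>x. 0 \<le> f x"
  show "0 \<le> pos_part f - ext f" using pos_part_upper[OF f(1) f(1) f(2)] by simp
  fix c :: real assume c: "\<And>x. f x \<le> c"
  have "\<bar>f x\<bar> \<le> c" for x using f(2)[of x] c[of x] by linarith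
  then have "\<bar>ext f\<bar> \<le> C * c" by (rule ext_bound[OF f(1)])
  then show "pos_part f - ext f \<le> 2 * C * c" using pos_part_bound[OF f c] by simp
qed (fact open_domain bounded_domain)+

proposition riesz_representation:
  assumes \<phi>: "\<phi> \<in> C1c \<Omega>"
  shows "l \<phi> = (LINT x|pos.riesz_measure. \<phi> x) - (LINT x|neg.riesz_measure. \<phi> x)"
proof -
  have \<phi>C: "\<phi> \<in> Cc \<Omega>" by (rule C1c_subset_Cc[OF \<phi>])
  define p q where "p x = max (\<phi> x) 0" and "q x = max (- \<phi> x) 0" for x
  have m\<phi>: "(\<lambda>x. - \<phi> x) \<in> Cc \<Omega>" using Cc_scale[OF \<phi>C, of "- 1"] by simp
  have p: "p \<in> Cc \<Omega>" "\<And>x. 0 \<le> p x" and q: "q \<in> Cc \<Omega>" "\<And>x. 0 \<le> q x"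
    unfolding p_def[abs_def] q_def[abs_def] by (auto intro!: Cc_closed \<phi>C m\<phi>)
  have \<phi>_eq: "\<phi> = (\<lambda>x. p x - q x)" by (auto simp: p_def q_def fun_eq_iff)
  have "l \<phi> = ext p - ext q"
    using ext_C1c[OF \<phi>] ext_diff[OF p(1) q(1)] by (simp flip: \<phi>_eq)
  moreover have "(LINT x|pos.riesz_measure. \<phi> x) = pos_part p - pos_part q"
    by (subst \<phi>_eq, subst Bochner_Integration.integral_diff)
      (simp_all add: pos.integrable_Cc_riesz_measure pos.integral_riesz_measure p q)
  moreover have "(LINT x|neg.riesz_measure. \<phi> x) = (pos_part p - ext p) - (pos_part q - ext q)"
    by (subst \<phi>_eq, subst Bochner_Integration.integral_diff)
      (simp_all add: neg.integrable_Cc_riesz_measure neg.integral_riesz_measure p q)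
  ultimately show ?thesis by simp
qed

end

section \<open>Integration against a difference of two measures\<close>

text \<open>
  When both measures have densities with respect to \<open>M\<close>, the set \<open>{x. n x < p x}\<close> is the positive set of
  a Hahn decomposition: intersecting \<open>A\<close> with it attains the supremum in the definition of \<open>jordan_pos\<close>.
\<close>

lemma jordan_pos_density:
  fixes p n :: "'a::euclidean_space \<Rightarrow> real"
  assumes sets: "sets M = sets (restrict_space borel \<Omega>)"
    and [measurable]: "p \<in> borel_measurable M" "n \<in> borel_measurable M"
    and nonneg: "\<And>x. 0 \<le> p x" "\<And>x. 0 \<le> n x"
    and P: "finite_measure P" "P = density M p" and N: "finite_measure N" "N = density M n"
  shows "jordan_pos \<Omega> (\<lambda>A. measure P A - measure N A) = density M (\<lambda>x. ennreal (max 0 (p x - n x)))"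
proof -
  interpret P: finite_measure P by fact
  interpret N: finite_measure N by fact
  define D where "D = density M (\<lambda>x. ennreal (max 0 (p x - n x)))"
  let ?S = "sets (restrict_space borel \<Omega>)"
  have sD: "sets D = ?S" by (simp add: D_def sets)
  then have spD: "space D = \<Omega>" using sets_eq_imp_space_eq[OF sD] by (simp add: space_restrict_space)
  have DN: "emeasure D E + emeasure N E
      = (\<integral>\<^sup>+x. (ennreal (max 0 (p x - n x)) + ennreal (n x)) * indicator E x \<partial>M)" if E: "E \<in> sets M" for E
    using E by (simp add: D_def N(2) emeasure_density nn_integral_add[symmetric] distrib_right)
  have le: "emeasure P E \<le> emeasure D E + emeasure N E" if E: "E \<in> sets M" for E
    unfolding DN[OF E] P(2) using E nonneg
    by (subst emeasure_density) (auto intro!: nn_integral_mono mult_right_mono ennreal_leI simp: ennreal_plus[symmetric] simp del: ennreal_plus)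
  have eq: "emeasure P E = emeasure D E + emeasure N E" if E: "E \<in> sets M" "\<And>x. x \<in> E \<Longrightarrow> n x \<le> p x" for E
    unfolding DN[OF E(1)] P(2) using E nonneg
    by (subst emeasure_density)
      (auto intro!: nn_integral_cong simp: ennreal_plus[symmetric] split: split_indicator simp del: ennreal_plus)
  have \<mu>: "ennreal (measure P E - measure N E) = emeasure P E - emeasure N E" for E
    by (simp add: P.emeasure_eq_measure N.emeasure_eq_measure ennreal_minus)
  have "(SUP E\<in>{E \<in> ?S. E \<subseteq> A}. ennreal (measure P E - measure N E)) = emeasure D A" if A: "A \<in> ?S" for A
  proof (rule antisym)
    show "(SUP E\<in>{E \<in> ?S. E \<subseteq> A}. ennreal (measure P E - measure N E)) \<le> emeasure D A"
    proof (rule SUP_least)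
      fix E assume E: "E \<in> {E \<in> ?S. E \<subseteq> A}"
      have "emeasure P E - emeasure N E \<le> emeasure D E"
        using le[of E] E by (intro ennreal_minus_le_iff[THEN iffD2]) (auto simp: sets add.commute)
      also have "\<dots> \<le> emeasure D A" using E A by (intro emeasure_mono) (auto simp: sD)
      finally show "ennreal (measure P E - measure N E) \<le> emeasure D A" by (simp add: \<mu>)
    qed
    define E where "E = {x \<in> space M. n x < p x} \<inter> A"
    have E: "E \<in> ?S" using A unfolding E_def sets[symmetric] by measurable
    have "A \<subseteq> space M" using A sets.sets_into_space[of A M] by (simp add: sets)
    then have "emeasure D A = emeasure D E"
      using A E unfolding D_def by (auto simp: emeasure_density sets E_def split: split_indicator intro!: nn_integral_cong)
    also have "\<dots> = emeasure P E - emeasure N E"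
      using eq[of E] E by (auto simp: sets E_def N.emeasure_eq_measure)
    also have "\<dots> \<le> (SUP E\<in>{E \<in> ?S. E \<subseteq> A}. ennreal (measure P E - measure N E))"
      unfolding \<mu>[symmetric] using E by (intro SUP_upper) (auto simp: E_def)
    finally show "emeasure D A \<le> (SUP E\<in>{E \<in> ?S. E \<subseteq> A}. ennreal (measure P E - measure N E))" .
  qed
  then have "jordan_pos \<Omega> (\<lambda>A. measure P A - measure N A) = measure_of \<Omega> ?S (emeasure D)"
    unfolding jordan_pos_def using sets.sigma_sets_eq[of D] sets.space_closed[of D]
    by (intro measure_of_eq) (auto simp: sD spD)
  also have "\<dots> = D" using measure_of_of_measure[of D] by (simp add: sD spD)
  finally show ?thesis by (simp add: D_def)
qed

text \<open>
  Both measures are absolutely continuous with respect to their sum, so the Radon-Nikodym theorem applies.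
\<close>

lemma finite_measures_common_density:
  assumes P: "finite_measure P" and N: "finite_measure N" and sets: "sets P = sets N"
  obtains M p n where "sets M = sets P" "p \<in> borel_measurable M" "n \<in> borel_measurable M"
    "\<And>x. 0 \<le> (p x :: real)" "\<And>x. 0 \<le> (n x :: real)" "P = density M p" "N = density M n"
proof -
  interpret P: finite_measure P by fact
  interpret N: finite_measure N by fact
  define M where "M = measure_of (space P) (sets P) (\<lambda>A. emeasure P A + emeasure N A)"
  have sM: "sets M = sets P" unfolding M_def by simp
  have spM: "space M = space P" by (rule sets_eq_imp_space_eq[OF sM])
  have M: "emeasure M A = emeasure P A + emeasure N A" if "A \<in> sets P" for A
  proof (rule emeasure_measure_of[OF M_def])
    show "countably_additive (sets M) (\<lambda>A. emeasure P A + emeasure N A)"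
    proof (rule countably_additiveI)
      fix A :: "nat \<Rightarrow> _" assume A: "range A \<subseteq> sets M" "disjoint_family A"
      then show "(\<Sum>i. emeasure P (A i) + emeasure N (A i)) = emeasure P (\<Union> (range A)) + emeasure N (\<Union> (range A))"
        using suminf_emeasure[of A P] suminf_emeasure[of A N]
        by (simp add: sM sets suminf_add[symmetric] flip: suminf_add)
    qed
  qed (use that sets.space_closed[of P] in \<open>auto simp: sM positive_def\<close>)
  interpret M: finite_measure M
  proof
    show "emeasure M (space M) \<noteq> \<infinity>"
      using P.emeasure_finite N.emeasure_finite by (simp add: spM M)
  qed
  have "\<exists>D\<in>borel_measurable M. (\<forall>x. 0 \<le> (D x :: real)) \<and> Q = density M D"
    if Q: "finite_measure Q" "sets Q = sets P" "\<And>A. A \<in> sets P \<Longrightarrow> emeasure Q A \<le> emeasure M A" for Q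
  proof -
    have ac: "absolutely_continuous M Q"
      unfolding absolutely_continuous_def
    proof
      fix A assume "A \<in> null_sets M"
      then have "A \<in> sets P" "emeasure M A = 0" by (auto simp: sM)
      then show "A \<in> null_sets Q" using Q(3)[of A] by (auto simp: Q(2))
    qed
    have sQ: "sets Q = sets M" by (simp add: Q(2) sM)
    obtain D where D: "D \<in> borel_measurable M" "AE x in M. RN_deriv M Q x = ennreal (D x)" "\<And>x. 0 \<le> D x"
      using M.real_RN_deriv[OF Q(1) ac sQ] by metis
    have "Q = density M (RN_deriv M Q)" using M.density_RN_deriv[OF ac sQ] by simp
    also have "\<dots> = density M D" using D by (intro density_cong) auto
    finally show ?thesis using D by blast
  qed
  from this[OF P refl] this[OF N sets[symmetric]]
  show thesis using that[OF sM] M by (metis (no_types, lifting) add.commute le_iff_add)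
qed

text \<open>
  The two measures need not be mutually singular, so they need not be the Jordan decomposition of their
  difference; the common part \<open>min (p x) (n x)\<close> of the densities cancels in the difference of the integrals.
\<close>

proposition signed_integral_difference:
  fixes f :: "'a::euclidean_space \<Rightarrow> real"
  assumes P: "finite_measure P" "sets P = sets (restrict_space borel \<Omega>)"
    and N: "finite_measure N" "sets N = sets (restrict_space borel \<Omega>)"
    and f: "integrable P f" "integrable N f"
  shows "signed_integral \<Omega> (\<lambda>A. measure P A - measure N A) f = (LINT x|P. f x) - (LINT x|N. f x)"
proof -
  obtain M p n where sM: "sets M = sets P" and [measurable]: "p \<in> borel_measurable M" "n \<in> borel_measurable M"
    and pn: "\<And>x. 0 \<le> (p x :: real)" "\<And>x. 0 \<le> (n x :: real)" and PM: "P = density M p" and NM: "N = density M n"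
    by (rule finite_measures_common_density[OF P(1) N(1) trans[OF P(2) N(2)[symmetric]]]) blast
  have S: "sets M = sets (restrict_space borel \<Omega>)" using sM P by simp
  have "f \<in> borel_measurable P" using f by auto
  then have [measurable]: "f \<in> borel_measurable M" using measurable_cong_sets[OF sM refl] by metis
  have fp: "integrable M (\<lambda>x. p x * f x)" using f(1) pn by (simp add: PM integrable_density)
  have fn: "integrable M (\<lambda>x. n x * f x)" using f(2) pn by (simp add: NM integrable_density)
  have i1: "integrable M (\<lambda>x. max 0 (p x - n x) * f x)"
    by (rule Bochner_Integration.integrable_bound[OF fp])
      (use pn in \<open>auto intro!: AE_I2 mult_right_mono simp: abs_mult\<close>)
  have i2: "integrable M (\<lambda>x. max 0 (n x - p x) * f x)"
    by (rule Bochner_Integration.integrable_bound[OF fn])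
      (use pn in \<open>auto intro!: AE_I2 mult_right_mono simp: abs_mult\<close>)
  have neg: "(\<lambda>A. - (measure P A - measure N A)) = (\<lambda>A. measure N A - measure P A)" by simp
  have "signed_integral \<Omega> (\<lambda>A. measure P A - measure N A) f
      = (LINT x|M. max 0 (p x - n x) * f x) - (LINT x|M. max 0 (n x - p x) * f x)"
    unfolding signed_integral_def neg
    by (simp add: jordan_pos_density[OF S _ _ pn P(1) PM N(1) NM]
        jordan_pos_density[OF S _ _ pn(2,1) N(1) NM P(1) PM] integral_density)
  also have "\<dots> = (LINT x|M. max 0 (p x - n x) * f x - max 0 (n x - p x) * f x)"
    by (rule Bochner_Integration.integral_diff[OF i1 i2, symmetric])
  also have "\<dots> = (LINT x|M. p x * f x - n x * f x)"
    by (intro Bochner_Integration.integral_cong) (auto simp: max_def algebra_simps)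
  also have "\<dots> = (LINT x|M. p x * f x) - (LINT x|M. n x * f x)"
    by (rule Bochner_Integration.integral_diff[OF fp fn])
  also have "\<dots> = (LINT x|P. f x) - (LINT x|N. f x)" using pn by (simp add: PM NM integral_density)
  finally show ?thesis .
qed

section \<open>Riesz representation for vector fields\<close>

lemma C1c_additive_sum:
  fixes \<Psi> :: "'i \<Rightarrow> 'a::euclidean_space \<Rightarrow> 'b::real_normed_vector"
  assumes L: "\<And>\<Psi> \<Phi>. \<Psi> \<in> C1c \<Omega> \<Longrightarrow> \<Phi> \<in> C1c \<Omega> \<Longrightarrow> L (\<lambda>x. \<Psi> x + \<Phi> x) = L \<Psi> + (L \<Phi> :: real)"
    and L0: "L (\<lambda>_. 0) = 0" and "finite A" "\<And>i. i \<in> A \<Longrightarrow> \<Psi> i \<in> C1c \<Omega>"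
  shows "(\<lambda>x. \<Sum>i\<in>A. \<Psi> i x) \<in> C1c \<Omega> \<and> L (\<lambda>x. \<Sum>i\<in>A. \<Psi> i x) = (\<Sum>i\<in>A. L (\<Psi> i))"
  using assms(3,4)
proof (induction A rule: finite_induct)
  case empty
  show ?case using L0 C1c_zero by simp
next
  case (insert i A)
  then show ?case using L[of "\<Psi> i" "\<lambda>x. \<Sum>i\<in>A. \<Psi> i x"] C1c_add[of "\<Psi> i" \<Omega> "\<lambda>x. \<Sum>i\<in>A. \<Psi> i x"] by simp
qed

text \<open>
  Each coordinate \<open>\<phi> \<mapsto> L (\<lambda>x. \<phi> x *\<^sub>R b)\<close> is a bounded scalar functional and hence the difference of two
  finite measures; these are the coordinates of \<open>\<nu>\<close>.
\<close>

proposition vector_riesz_representation: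
  fixes L :: "('a::euclidean_space \<Rightarrow> 'b::euclidean_space) \<Rightarrow> real"
  assumes \<Omega>: "open \<Omega>" "bounded \<Omega>"
    and L_add: "\<And>\<Psi> \<Phi>. \<Psi> \<in> C1c \<Omega> \<Longrightarrow> \<Phi> \<in> C1c \<Omega> \<Longrightarrow> L (\<lambda>x. \<Psi> x + \<Phi> x) = L \<Psi> + L \<Phi>"
    and L_scale: "\<And>c \<Psi>. \<Psi> \<in> C1c \<Omega> \<Longrightarrow> L (\<lambda>x. c *\<^sub>R \<Psi> x) = c * L \<Psi>"
    and L_bound: "\<And>\<Psi>. \<Psi> \<in> C1c \<Omega> \<Longrightarrow> (\<And>x. norm (\<Psi> x) \<le> 1) \<Longrightarrow> L \<Psi> \<le> C"
  shows "\<exists>\<nu>\<in>Mb \<Omega>. \<forall>\<Psi>\<in>C1c \<Omega>. vector_integral \<Omega> \<nu> \<Psi> = L \<Psi>"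
proof -
  let ?S = "sets (restrict_space borel \<Omega>)"
  have L0: "L (\<lambda>_. 0) = 0" using L_scale[OF C1c_zero, of 0] by simp
  have C0: "0 \<le> C" using L_bound[OF C1c_zero] L0 by simp
  define l where "l b \<phi> = L (\<lambda>x. \<phi> x *\<^sub>R b)" for b and \<phi> :: "'a \<Rightarrow> real"
  have sc: "(\<lambda>x. \<phi> x *\<^sub>R b) \<in> C1c \<Omega>" if "\<phi> \<in> C1c \<Omega>" for \<phi> and b :: 'b
    by (rule C1c_linear[OF that]) (rule bounded_linear_scaleR_left)
  have functional: "bounded_C1c_functional \<Omega> (l b) C" if b: "b \<in> Basis" for b
  proof
    fix \<phi> \<psi> :: "'a \<Rightarrow> real" assume "\<phi> \<in> C1c \<Omega>" "\<psi> \<in> C1c \<Omega>"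
    then show "l b (\<lambda>x. \<phi> x + \<psi> x) = l b \<phi> + l b \<psi>"
      unfolding l_def by (simp add: scaleR_add_left L_add sc)
  next
    fix c and \<phi> :: "'a \<Rightarrow> real" assume "\<phi> \<in> C1c \<Omega>"
    then show "l b (\<lambda>x. c * \<phi> x) = c * l b \<phi>"
      using L_scale[OF sc, of \<phi> c b] by (simp add: l_def)
  next
    fix c and \<phi> :: "'a \<Rightarrow> real" assume \<phi>: "\<phi> \<in> C1c \<Omega>" and le: "\<And>x. \<bar>\<phi> x\<bar> \<le> c"
    have c: "0 \<le> c" using le[of 0] by linarith
    show "\<bar>l b \<phi>\<bar> \<le> C * c"
    proof (cases "c = 0")
      case True
      then have "\<phi> = (\<lambda>_. 0)" using le by auto
      then show ?thesis using True by (simp add: l_def L0)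
    next
      case False
      \<comment> \<open>Test fields of norm at most \<open>1\<close> come from dividing \<open>\<phi>\<close> by \<open>c\<close>; both signs of \<open>r\<close> are needed.\<close>
      have one: "r * l b \<phi> \<le> C" if "\<bar>r\<bar> = 1 / c" for r
      proof -
        have "norm (r *\<^sub>R \<phi> x *\<^sub>R b) \<le> 1" for x
        proof -
          have "norm (r *\<^sub>R \<phi> x *\<^sub>R b) = \<bar>\<phi> x\<bar> / c" using that b by (simp add: abs_mult)
          then show ?thesis using le[of x] False c by simp
        qed
        moreover have "(\<lambda>x. r *\<^sub>R \<phi> x *\<^sub>R b) \<in> C1c \<Omega>"
          by (rule C1c_linear[OF sc[OF \<phi>]]) (rule bounded_linear_scaleR_right)
        ultimately have "L (\<lambda>x. r *\<^sub>R \<phi> x *\<^sub>R b) \<le> C" by (intro L_bound)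
        then show ?thesis using L_scale[OF sc[OF \<phi>], of r b] by (simp add: l_def)
      qed
      show ?thesis using one[of "1 / c"] one[of "- 1 / c"] c False by (simp add: field_simps abs_le_iff)
    qed
  qed (use \<Omega> C0 in auto)
  define P where "P b = positive_functional.riesz_measure \<Omega> (bounded_C1c_functional.pos_part \<Omega> (l b) C)" for b
  define N where "N b = positive_functional.riesz_measure \<Omega> (\<lambda>f. bounded_C1c_functional.pos_part \<Omega> (l b) C f
    - bounded_C1c_functional.ext \<Omega> (l b) C f)" for b
  have PN: "finite_measure (P b)" "finite_measure (N b)" "sets (P b) = ?S" "sets (N b) = ?S"
    "\<And>\<phi> :: 'a \<Rightarrow> real. \<phi> \<in> C1c \<Omega> \<Longrightarrow> integrable (P b) \<phi>"
    "\<And>\<phi> :: 'a \<Rightarrow> real. \<phi> \<in> C1c \<Omega> \<Longrightarrow> integrable (N b) \<phi>"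
    "\<And>\<phi>. \<phi> \<in> C1c \<Omega> \<Longrightarrow> l b \<phi> = (LINT x|P b. \<phi> x) - (LINT x|N b. \<phi> x)" if b: "b \<in> Basis" for b
  proof -
    interpret bounded_C1c_functional \<Omega> "l b" C by (rule functional[OF b])
    show "finite_measure (P b)" "finite_measure (N b)" "sets (P b) = ?S" "sets (N b) = ?S"
      unfolding P_def N_def
      by (fact pos.finite_riesz_measure neg.finite_riesz_measure pos.sets_riesz_measure neg.sets_riesz_measure)+
    fix \<phi> :: "'a \<Rightarrow> real" assume \<phi>: "\<phi> \<in> C1c \<Omega>"
    show "integrable (P b) \<phi>" "integrable (N b) \<phi>"
      unfolding P_def N_def
      by (rule pos.integrable_Cc_riesz_measure neg.integrable_Cc_riesz_measure, rule C1c_subset_Cc[OF \<phi>])+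
    show "l b \<phi> = (LINT x|P b. \<phi> x) - (LINT x|N b. \<phi> x)"
      unfolding P_def N_def by (rule riesz_representation[OF \<phi>])
  qed
  define \<nu> where "\<nu> A = (\<Sum>b\<in>Basis. (measure (P b) A - measure (N b) A) *\<^sub>R b)" for A
  have \<nu>_b: "\<nu> A \<bullet> b = measure (P b) A - measure (N b) A" if "b \<in> Basis" for A b
    unfolding \<nu>_def using that by (rule inner_sum_left_Basis)
  have "\<nu> \<in> Mb \<Omega>"
    unfolding Mb_def
  proof (intro CollectI conjI allI impI)
    fix A :: "nat \<Rightarrow> 'a set" assume A: "range A \<subseteq> ?S" "disjoint_family A"
    have m: "(\<lambda>i. measure (P b) (A i)) sums measure (P b) (\<Union> (range A))"
      "(\<lambda>i. measure (N b) (A i)) sums measure (N b) (\<Union> (range A))" if "b \<in> Basis" for b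
      using A PN(3,4)[OF that]
      by (auto intro!: finite_measure.finite_measure_UNION PN(1,2) that)
    show "(\<lambda>i. \<nu> (A i)) sums \<nu> (\<Union> (range A))"
      unfolding \<nu>_def
      by (intro sums_sum bounded_linear.sums[OF bounded_linear_scaleR_left] sums_diff m)
  next
    fix A assume "A \<notin> ?S"
    then show "\<nu> A = 0" unfolding \<nu>_def using PN(3,4) by (intro sum.neutral) (auto simp: measure_notin_sets)
  qed
  moreover have "vector_integral \<Omega> \<nu> \<Psi> = L \<Psi>" if \<Psi>: "\<Psi> \<in> C1c \<Omega>" for \<Psi>
  proof -
    have comp: "(\<lambda>x. \<Psi> x \<bullet> b) \<in> C1c \<Omega>" for b by (rule C1c_linear[OF \<Psi>]) (rule bounded_linear_inner_left)
    have "vector_integral \<Omega> \<nu> \<Psi> = (\<Sum>b\<in>Basis. L (\<lambda>x. (\<Psi> x \<bullet> b) *\<^sub>R b))"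
      unfolding vector_integral_def
    proof (rule sum.cong[OF refl])
      fix b :: 'b assume b: "b \<in> Basis"
      have "signed_integral \<Omega> (\<lambda>A. \<nu> A \<bullet> b) (\<lambda>x. \<Psi> x \<bullet> b)
          = (LINT x|P b. \<Psi> x \<bullet> b) - (LINT x|N b. \<Psi> x \<bullet> b)"
        unfolding \<nu>_b[OF b] using PN(1-6)[OF b] comp by (intro signed_integral_difference) auto
      also have "\<dots> = l b (\<lambda>x. \<Psi> x \<bullet> b)" by (rule PN(7)[OF b comp, symmetric])
      finally show "signed_integral \<Omega> (\<lambda>A. \<nu> A \<bullet> b) (\<lambda>x. \<Psi> x \<bullet> b) = L (\<lambda>x. (\<Psi> x \<bullet> b) *\<^sub>R b)"
        by (simp add: l_def)
    qed
    also have "\<dots> = L (\<lambda>x. \<Sum>b\<in>Basis. (\<Psi> x \<bullet> b) *\<^sub>R b)"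
      by (rule C1c_additive_sum[where \<Omega> = \<Omega> and L = L and A = Basis and \<Psi> = "\<lambda>b x. (\<Psi> x \<bullet> b) *\<^sub>R b",
            THEN conjunct2, symmetric]) (intro L_add L0 finite_Basis sc comp; assumption)+
    also have "\<dots> = L \<Psi>" by (simp add: euclidean_representation)
    finally show ?thesis .
  qed
  ultimately show ?thesis by blast
qed

section \<open>The function of bounded variation\<close>

lemma integrable_locally_bounded_times_divergence:
  fixes \<Psi> :: "'a::euclidean_space \<Rightarrow> 'a" and w :: "'a \<Rightarrow> real"
  assumes \<Psi>: "\<Psi> \<in> C1c UNIV" and [measurable]: "w \<in> borel_measurable borel"
    and w: "\<And>R. \<exists>C. \<forall>x. norm x \<le> R \<longrightarrow> \<bar>w x\<bar> \<le> C"
  shows "integrable lborel (\<lambda>x. w x * divergence \<Psi> x)"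
proof -
  obtain K where cd: "continuous_on UNIV (divergence \<Psi>)" and K: "compact K"
    "\<And>x. x \<notin> K \<Longrightarrow> divergence \<Psi> x = 0" by (rule C1c_divergence[OF \<Psi>]) blast
  have [measurable]: "divergence \<Psi> \<in> borel_measurable borel" using cd by (rule borel_measurable_continuous_onI)
  obtain R where R: "\<And>x. x \<in> K \<Longrightarrow> norm x \<le> R" using compact_imp_bounded[OF K(1)] bounded_pos by blast
  obtain C where C: "\<And>x. norm x \<le> R \<Longrightarrow> \<bar>w x\<bar> \<le> C" using w by blast
  show ?thesis
  proof (rule Bochner_Integration.integrable_bound)
    show "integrable lborel (\<lambda>x. C * divergence \<Psi> x)"
      by (intro integrable_mult_right integral_divergence_eq_0[OF \<Psi>])
    show "AE x in lborel. norm (w x * divergence \<Psi> x) \<le> norm (C * divergence \<Psi> x)"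
    proof (rule AE_I2)
      fix x show "norm (w x * divergence \<Psi> x) \<le> norm (C * divergence \<Psi> x)"
      proof (cases "x \<in> K")
        case True
        then have "\<bar>w x\<bar> \<le> \<bar>C\<bar>" using C[OF R] by force
        then show ?thesis by (simp add: abs_mult mult_right_mono)
      qed (simp add: K(2))
    qed
  qed measurable
qed

lemma set_integrable_locally_bounded:
  fixes w :: "'a::euclidean_space \<Rightarrow> real"
  assumes \<Omega>: "open \<Omega>" "bounded \<Omega>" and [measurable]: "w \<in> borel_measurable borel"
    and w: "\<And>R. \<exists>C. \<forall>x. norm x \<le> R \<longrightarrow> \<bar>w x\<bar> \<le> C"
  shows "set_integrable lebesgue \<Omega> w"
proof -
  obtain R where R: "\<And>x. x \<in> \<Omega> \<Longrightarrow> norm x \<le> R" using \<Omega>(2) bounded_pos by blast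
  obtain C where C: "\<And>x. norm x \<le> R \<Longrightarrow> \<bar>w x\<bar> \<le> C" using w by blast
  have [measurable]: "\<Omega> \<in> sets borel" using \<Omega>(1) by simp
  have "integrable lborel (\<lambda>x. indicator \<Omega> x *\<^sub>R w x)"
  proof (rule Bochner_Integration.integrable_bound)
    show "integrable lborel (\<lambda>x. indicat_real \<Omega> x * C)"
      using emeasure_bounded_finite[OF \<Omega>(2)] by (intro integrable_mult_left integrable_real_indicator) simp_all
    show "AE x in lborel. norm (indicator \<Omega> x *\<^sub>R w x) \<le> norm (indicat_real \<Omega> x * C)"
      using C[OF R] by (intro AE_I2) (force split: split_indicator)
  qed measurable
  then show ?thesis unfolding set_integrable_def by (subst integrable_completion) auto
qed

theorem proposition5p3:
  fixes \<Omega> :: "(real ^ 'n) set" and u :: "real ^ 'n \<Rightarrow> real" and s :: real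
  assumes "0 < s" and "s < 1"
    and "open \<Omega>" and "bounded \<Omega>" and "lipschitz_boundary \<Omega>"
    and "u \<in> Linfty"
    and "frac_variation s u \<Omega> < \<infinity>"
  shows "\<exists>w\<in>BV \<Omega>. distr_deriv \<Omega> w = frac_deriv s \<Omega> u"
proof -
  obtain w where w: "w \<in> borel_measurable borel" "\<And>R. \<exists>C. \<forall>x. norm x \<le> R \<longrightarrow> \<bar>w x\<bar> \<le> C"
    and dual: "\<And>\<Psi>. \<Psi> \<in> C1c UNIV \<Longrightarrow>
      (LINT x|lborel. w x * divergence \<Psi> x) = (LINT y|lebesgue. u y * frac_div s \<Psi> y)"
    by (rule frac_div_dual_potential[OF assms(1,2,6)]) blast
  define L where "L \<Psi> = - (LINT x|lborel. w x * divergence \<Psi> x)" for \<Psi> :: "real^'n \<Rightarrow> real^'n"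
  have UNIV: "\<Psi> \<in> C1c UNIV" if "\<Psi> \<in> C1c \<Omega>" for \<Psi> :: "real^'n \<Rightarrow> real^'n"
    using that by (rule C1c_mono) simp
  have L_frac: "L \<Psi> = - (LINT y|lebesgue. u y * frac_div s \<Psi> y)" if "\<Psi> \<in> C1c \<Omega>" for \<Psi>
    using dual[OF UNIV[OF that]] by (simp add: L_def)
  have L_distr: "L \<Psi> = - (LINT x:\<Omega>|lebesgue. w x * divergence \<Psi> x)" if \<Psi>: "\<Psi> \<in> C1c \<Omega>" for \<Psi>
  proof -
    obtain K where cd: "continuous_on UNIV (divergence \<Psi>)" and K: "K \<subseteq> \<Omega>"
      "\<And>x. x \<notin> K \<Longrightarrow> divergence \<Psi> x = 0" by (rule C1c_divergence[OF \<Psi>]) blast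
    have "(\<lambda>x. indicator \<Omega> x *\<^sub>R (w x * divergence \<Psi> x)) = (\<lambda>x. w x * divergence \<Psi> x)"
      using K by (fastforce simp: fun_eq_iff split: split_indicator)
    moreover have "(\<lambda>x. w x * divergence \<Psi> x) \<in> borel_measurable lborel"
      using w(1) borel_measurable_continuous_onI[OF cd] by simp
    ultimately show ?thesis
      by (simp add: L_def set_lebesgue_integral_def integral_completion)
  qed
  have L_int: "integrable lborel (\<lambda>x. w x * divergence \<Psi> x)" if "\<Psi> \<in> C1c \<Omega>" for \<Psi>
    by (rule integrable_locally_bounded_times_divergence[OF UNIV[OF that] w])
  obtain C where C: "frac_variation s u \<Omega> \<le> ereal C"
    using assms(7) by (cases "frac_variation s u \<Omega>") auto
  have bound: "- L \<Psi> \<le> C" if "\<Psi> \<in> C1c \<Omega>" "\<And>x. norm (\<Psi> x) \<le> 1" for \<Psi>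
  proof -
    have "ereal (- L \<Psi>) \<le> frac_variation s u \<Omega>"
      unfolding frac_variation_def L_frac[OF that(1)] using that by (intro SUP_upper2[of \<Psi>]) auto
    then show ?thesis using C order_trans by fastforce
  qed
  have L_add: "L (\<lambda>x. \<Psi> x + \<Phi> x) = L \<Psi> + L \<Phi>" if \<Psi>: "\<Psi> \<in> C1c \<Omega>" and \<Phi>: "\<Phi> \<in> C1c \<Omega>" for \<Psi> \<Phi>
    using Bochner_Integration.integral_add[OF L_int[OF \<Psi>] L_int[OF \<Phi>]]
    by (simp add: L_def divergence_linear(1)[OF \<Psi> \<Phi>] distrib_left)
  have L_scale: "L (\<lambda>x. c *\<^sub>R \<Psi> x) = c * L \<Psi>" if \<Psi>: "\<Psi> \<in> C1c \<Omega>" for \<Psi> c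
    by (simp add: L_def divergence_linear(2)[OF \<Psi>] mult.left_commute)
  have L_bound: "L \<Psi> \<le> C" if \<Psi>: "\<Psi> \<in> C1c \<Omega>" "\<And>x. norm (\<Psi> x) \<le> 1" for \<Psi>
  proof -
    have "(\<lambda>x. - 1 *\<^sub>R \<Psi> x) \<in> C1c \<Omega>" by (rule C1c_linear[OF \<Psi>(1) bounded_linear_scaleR_right])
    then have "- L (\<lambda>x. - 1 *\<^sub>R \<Psi> x) \<le> C" by (rule bound) (simp add: \<Psi>(2))
    then show ?thesis using L_scale[OF \<Psi>(1), of "- 1"] by simp
  qed
  obtain \<nu> where \<nu>: "\<nu> \<in> Mb \<Omega>" "\<And>\<Psi>. \<Psi> \<in> C1c \<Omega> \<Longrightarrow> vector_integral \<Omega> \<nu> \<Psi> = L \<Psi>"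
    using vector_riesz_representation[OF assms(3,4), where L = L and C = C, OF L_add L_scale L_bound] by blast
  \<comment> \<open>Both notions ask for the same measure, namely the one that represents \<open>L\<close>.\<close>
  have equiv: "is_distr_deriv \<Omega> w = is_frac_deriv s \<Omega> u"
    unfolding is_distr_deriv_def is_frac_deriv_def fun_eq_iff by (simp flip: L_distr L_frac cong: ball_cong)
  have "is_distr_deriv \<Omega> w \<nu>"
    unfolding is_distr_deriv_def using \<nu> by (simp flip: L_distr cong: ball_cong)
  then have "w \<in> BV \<Omega>"
    unfolding BV_def using set_integrable_locally_bounded[OF assms(3,4) w] by blast
  moreover have "distr_deriv \<Omega> w = frac_deriv s \<Omega> u"
    by (simp add: distr_deriv_def frac_deriv_def equiv)
  ultimately show ?thesis by blast
qed

end
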